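(* Let $\gamma>\sqrt{8\ln 2}$. Then the proportion of matroids $M$ with ground set $\{1,\dots,n\}$ for which the algorithm $\mathsf{RB}$ is $\left(2+\tfrac{\gamma}{\sqrt n}\right)$-competitive for $M$ tends to $1$ as $n\to\infty$.
   Context: Matroid secretary problem: a matroid $M$ with ground set $E$ is known in advance; an unknown weight function $w\colon E\to\mathbb{R}_{\ge 0}$ is given. The elements of $E$ are revealed one at a time in a uniformly random order; when $e$ is revealed, $w(e)$ is learned and the algorithm must irrevocably decide whether to select $e$, subject to the selected set always being independent in $M$. The algorithm may use internal randomness. The value of the algorithm on $(M,w)$ is the expected weight of the selected set (over the random order and internal randomness). $\mathrm{opt}(M,w)$ is the maximum weight of an independent set of $M$. For $c\ge1$, an algorithm is $c$-competitive for $M$ if its value is at least $\tfrac1c\mathrm{opt}(M,w)$ for every $w$. The algorithm $\mathsf{RB}$ for a matroid $M$: choose a basis $B$ of $M$ uniformly at random from the set of all bases of $M$ (ignoring weights), and select exactly the elements of $B$ as they are revealed. *)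

theory Defs
  imports "HOL-Probability.Probability" "HOL-Combinatorics.Multiset_Permutations"
begin

section \<open>Matroids\<close>

text \<open>A matroid with ground set \<open>E\<close> is identified with its family \<open>\<I>\<close> of independent sets, so that
  the matroids with ground set \<open>E\<close> are counted by \<open>card {\<I>. matroid E \<I>}\<close> (labelled matroids, not
  isomorphism classes).\<close>

locale matroid =
  fixes E :: "'a set" and \<I> :: "'a set set"
  assumes finite_ground: "finite E"
    and indep_subset: "X \<in> \<I> \<Longrightarrow> X \<subseteq> E"
    and indep_empty: "{} \<in> \<I>"
    and indep_hereditary: "X \<in> \<I> \<Longrightarrow> Y \<subseteq> X \<Longrightarrow> Y \<in> \<I>"
    and indep_augment:
      "X \<in> \<I> \<Longrightarrow> Y \<in> \<I> \<Longrightarrow> card X < card Y \<Longrightarrow> \<exists>y\<in>Y - X. insert y X \<in> \<I>"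

definition bases :: "'a set set \<Rightarrow> 'a set set" where
  "bases \<I> = {B \<in> \<I>. \<forall>X\<in>\<I>. B \<subseteq> X \<longrightarrow> X = B}"

definition opt :: "'a set set \<Rightarrow> ('a \<Rightarrow> real) \<Rightarrow> real" where
  "opt \<I> w = Max ((\<lambda>X. \<Sum>e\<in>X. w e) ` \<I>)"


section \<open>Online algorithms for the matroid secretary problem\<close>

text \<open>A deterministic online strategy decides whether to select the element just revealed. Its input
  is everything revealed so far: the list of pairs (element, weight) in order of arrival, the element
  under consideration being the last entry. The matroid is known in advance, so strategies may depend
  on it. A randomized algorithm is a probability distribution on deterministic strategies.\<close>

type_synonym 'a strategy = "('a \<times> real) list \<Rightarrow> bool"
type_synonym 'a algorithm = "'a strategy pmf"

definition selected :: "'a strategy \<Rightarrow> ('a \<Rightarrow> real) \<Rightarrow> 'a list \<Rightarrow> 'a set" where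
  "selected D w xs = {xs ! i | i. i < length xs \<and> D (map (\<lambda>e. (e, w e)) (take (Suc i) xs))}"

text \<open>Decisions are irrevocable, so the set selected after \<open>k\<close> arrivals is \<open>selected D w (take k xs)\<close>;
  it has to be independent at every moment.\<close>

definition feasible :: "'a set \<Rightarrow> 'a set set \<Rightarrow> 'a algorithm \<Rightarrow> bool" where
  "feasible E \<I> A \<longleftrightarrow>
     (\<forall>D\<in>set_pmf A. \<forall>w. (\<forall>e\<in>E. 0 \<le> w e) \<longrightarrow>
        (\<forall>xs\<in>permutations_of_set E. \<forall>k\<le>length xs. selected D w (take k xs) \<in> \<I>))"

text \<open>The arrival order is uniform and independent of the internal randomness.\<close>

definition alg_value :: "'a set \<Rightarrow> 'a algorithm \<Rightarrow> ('a \<Rightarrow> real) \<Rightarrow> real" where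
  "alg_value E A w =
     measure_pmf.expectation (pair_pmf (pmf_of_set (permutations_of_set E)) A)
       (\<lambda>(xs, D). \<Sum>e\<in>selected D w xs. w e)"

definition competitive :: "real \<Rightarrow> 'a set \<Rightarrow> 'a set set \<Rightarrow> 'a algorithm \<Rightarrow> bool" where
  "competitive c E \<I> A \<longleftrightarrow>
     feasible E \<I> A \<and>
     (\<forall>w. (\<forall>e\<in>E. 0 \<le> w e) \<longrightarrow> alg_value E A w \<ge> 1 / c * opt \<I> w)"


section \<open>The random basis algorithm\<close>

definition select_from :: "'a set \<Rightarrow> 'a strategy" where
  "select_from B h \<longleftrightarrow> fst (last h) \<in> B"

definition RB :: "'a set set \<Rightarrow> 'a algorithm" where
  "RB \<I> = map_pmf select_from (pmf_of_set (bases \<I>))"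

lemma selected_select_from: "selected (select_from B) w xs = B \<inter> set xs"
proof -
  have "fst (last (map (\<lambda>e. (e, w e)) (take (Suc i) xs))) = xs ! i" if "i < length xs" for i
    using that by (simp add: take_Suc_conv_app_nth)
  then show ?thesis
    unfolding selected_def select_from_def set_conv_nth by auto
qed

end

theory Submission
  imports Defs "HOL-Real_Asymp.Real_Asymp"
begin

text \<open>
  \<open>RB\<close> selects \<open>e\<close> with probability equal to the proportion of the bases that contain \<open>e\<close>, so it
  suffices that in almost every matroid each element lies in almost half of the bases.

  The bases of a matroid of rank \<open>r\<close> live on the Johnson graph \<open>J(n,r)\<close>. Every stable set of this graph
  is the set of nonbases of a sparse paving matroid, and one colour class of the colouring by the
  element sum modulo \<open>n\<close> already gives \<open>2 ^ (C(n, n/2) / n)\<close> matroids. Conversely, a matroid is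
  encoded by a negligible amount of side information together with a stable set of nonbases, and the
  Kleitman-Winston argument bounds the number of stable sets by \<open>2 ^ ((2 + o(1)) C(n,r) / n)\<close>. Hence
  ranks with \<open>C(n,r) \<le> \<eta> C(n, n/2)\<close>, \<open>\<eta> < 1/2\<close>, are negligible; these include all
  \<open>r < n/2 - c sqrt n\<close> with \<open>2 c\<^sup>2 > ln 2\<close>, which is where the constant \<open>sqrt (8 ln 2)\<close> comes from.

  For the remaining ranks, double counting of basis exchanges shows that \<open>e\<close> lies in a proportion of
  at least \<open>r/n - o(1 / sqrt n)\<close> of the bases unless exchanges that fail to produce a basis are
  frequent. In a matroid of the latter kind the stable set of the encoding can be chosen in so
  many ways that there can be only few such matroids.
\<close>

section \<open>Basis systems and the Johnson graph\<close>

text \<open>The nonbases of a general matroid are far from stable. Tokens dispose of the nonbases of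
  high rate. Each remaining nonbasis has at least \<open>n^2 / 5\<close> bases among its neighbours,
  and this density forces every adjacent pair of unblocked nonbases, one of them uncovered, to be an
  exchange along a circuit or cocircuit of size \<open>O(n^0.9)\<close>. Families of such small sets
  are cheap to record, and the exchanges preserve being a basis, so one representative per component
  suffices, and representatives are never adjacent.

  Upper and lower bounds on the number of matroids differ by a factor 2 in the exponent, which the
  threshold \<open>1/2\<close> for \<eta> absorbs. Central ranks cannot afford that factor. There a
  matroid with many failing exchanges is the decoding of \<open>2 ^ g\<close> different stable sets,
  and the total is compared with the number of stable sets of the same or the complementary rank,
  which injects into the matroids. Hence no sharp count of matroids is needed.

  A rank of at least \<open>n/2 - c sqrt n\<close> gives each element a share
  \<open>1/2 - c / sqrt n\<close> up to lower order, with inverse about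
  \<open>2 + 4 c / sqrt n\<close>; the least \<open>c\<close> is \<open>sqrt (ln 2 / 2)\<close>, and
  four times it is \<open>sqrt (8 ln 2)\<close>.\<close>

definition lvl :: "'a set \<Rightarrow> nat \<Rightarrow> 'a set set" where
  "lvl E r = {X. X \<subseteq> E \<and> card X = r}"

definition swap :: "'a set \<Rightarrow> 'a \<Rightarrow> 'a \<Rightarrow> 'a set" where
  "swap X x y = insert y (X - {x})"

definition adj :: "'a set \<Rightarrow> 'a set \<Rightarrow> bool" where
  "adj X Y \<longleftrightarrow> (\<exists>x\<in>X. \<exists>y. y \<notin> X \<and> Y = swap X x y)"

definition stable :: "'a set set \<Rightarrow> bool" where
  "stable V \<longleftrightarrow> (\<forall>X\<in>V. \<forall>Y\<in>V. \<not> adj X Y)"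

lemma finite_lvl: "finite E \<Longrightarrow> finite (lvl E r)"
  unfolding lvl_def by (rule finite_subset[of _ "Pow E"]) auto

lemma card_lvl: "finite E \<Longrightarrow> card (lvl E r) = card E choose r"
  unfolding lvl_def by (rule n_subsets)

lemma adj_sym: "adj X Y \<Longrightarrow> adj Y X"
proof -
  assume "adj X Y"
  then obtain x y where xy: "x \<in> X" "y \<notin> X" "Y = swap X x y" unfolding adj_def by auto
  then have "y \<in> Y" "x \<notin> Y" "X = swap Y y x" unfolding swap_def by auto
  then show ?thesis unfolding adj_def by blast
qed

lemma swap_in_lvl:
  assumes "X \<in> lvl E r" "x \<in> X" "y \<in> E - X"
  shows "swap X x y \<in> lvl E r"
proof -
  have "card (insert y (X - {x})) = card X"
  proof (cases "finite X")
    case True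
    then have "card (insert y (X - {x})) = Suc (card (X - {x}))" using assms(3) by (intro card_insert_disjoint) auto
    also have "\<dots> = card X" using True assms(2) by (rule card_Suc_Diff1)
    finally show ?thesis .
  qed auto
  then show ?thesis using assms unfolding lvl_def swap_def by auto
qed

lemma adj_lvlE:
  assumes "adj X Y" "X \<in> lvl E r" "Y \<in> lvl E r"
  obtains x y where "x \<in> X" "y \<in> E - X" "Y = swap X x y"
  using assms unfolding adj_def lvl_def swap_def by auto

lemma adjI: "x \<in> X \<Longrightarrow> y \<notin> X \<Longrightarrow> adj X (swap X x y)"
  unfolding adj_def by auto

lemma swap_inv: "x \<in> X \<Longrightarrow> y \<notin> X \<Longrightarrow> swap (swap X x y) y x = X"
  unfolding swap_def by auto

lemma swap_inj:
  assumes "x \<in> X" "x' \<in> X" "y \<notin> X" "y' \<notin> X" "swap X x y = swap X x' y'"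
  shows "x = x' \<and> y = y'"
proof -
  have "y \<in> swap X x' y'" "y' \<in> swap X x y" "x \<notin> swap X x' y'" "x' \<notin> swap X x y"
    using assms unfolding swap_def by auto
  then show ?thesis using assms unfolding swap_def by auto
qed

text \<open>The bases of a matroid, axiomatised by both exchange properties so that the notion is visibly
  self-dual; the dual system consists of the complements.\<close>

locale basis_system =
  fixes E :: "'a set" and r :: nat and \<B> :: "'a set set"
  assumes finE: "finite E"
    and nonempty: "\<B> \<noteq> {}"
    and basis_lvl: "B \<in> \<B> \<Longrightarrow> B \<in> lvl E r"
    and exch: "A \<in> \<B> \<Longrightarrow> B \<in> \<B> \<Longrightarrow> x \<in> A - B \<Longrightarrow> \<exists>y\<in>B - A. swap A x y \<in> \<B>"
    and coexch: "A \<in> \<B> \<Longrightarrow> B \<in> \<B> \<Longrightarrow> y \<in> B - A \<Longrightarrow> \<exists>x\<in>A - B. swap A x y \<in> \<B>"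
begin

definition K :: "'a set set" where "K = lvl E r - \<B>"

text \<open>If \<open>X\<close> has rank \<open>r - 1\<close>, then \<open>P X\<close> is its unique circuit and \<open>Q X\<close> the complement of its closure;
  for nonbases of smaller rank both are empty. Likewise \<open>circ J\<close> is the unique circuit of a spanning
  \<open>(r + 1)\<close>-set \<open>J\<close>, \<open>coc I\<close> is the cocircuit complementary to the closure of an independent
  \<open>(r - 1)\<close>-set \<open>I\<close>, and they are empty for all other \<open>J\<close> and \<open>I\<close>.\<close>

definition P :: "'a set \<Rightarrow> 'a set" where
  "P X = {x \<in> X. \<exists>y\<in>E - X. swap X x y \<in> \<B>}"

definition Q :: "'a set \<Rightarrow> 'a set" where
  "Q X = {y \<in> E - X. \<exists>x\<in>X. swap X x y \<in> \<B>}"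

definition circ :: "'a set \<Rightarrow> 'a set" where
  "circ J = {z \<in> J. J - {z} \<in> \<B>}"

definition coc :: "'a set \<Rightarrow> 'a set" where
  "coc I = {y \<in> E - I. insert y I \<in> \<B>}"

lemma basis_sub: "B \<in> \<B> \<Longrightarrow> B \<subseteq> E" and basis_card: "B \<in> \<B> \<Longrightarrow> card B = r"
  using basis_lvl unfolding lvl_def by auto

lemma basis_fin: "B \<in> \<B> \<Longrightarrow> finite B"
  using basis_sub finE finite_subset by blast

lemma K_lvl: "X \<in> K \<Longrightarrow> X \<in> lvl E r" and K_sub: "X \<in> K \<Longrightarrow> X \<subseteq> E" and K_notin: "X \<in> K \<Longrightarrow> X \<notin> \<B>"
  unfolding K_def lvl_def by auto

lemma K_card: "X \<in> K \<Longrightarrow> card X = r"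
  unfolding K_def lvl_def by auto

lemma K_fin: "X \<in> K \<Longrightarrow> finite X"
  using K_sub finE finite_subset by blast

lemma finK: "finite K" "finite \<B>"
  using finite_lvl[OF finE] basis_lvl unfolding K_def by (auto intro: finite_subset)

text \<open>The two given bases are \<open>X - x + y1\<close> and \<open>X - x1 + y\<close>.
  Exchanging \<open>y1\<close> out of the first can bring in only \<open>x\<close> or
  \<open>y\<close>; \<open>x\<close> would restore the nonbasis \<open>X\<close>, so it is
  \<open>y\<close>. Thus the bases adjacent to a nonbasis form a full product set.\<close>

lemma rectangle:
  assumes "X \<in> K"
  shows "x \<in> P X \<Longrightarrow> y \<in> Q X \<Longrightarrow> swap X x y \<in> \<B>"
proof -
  assume x: "x \<in> P X" and y: "y \<in> Q X"
  obtain y1 where y1: "y1 \<in> E - X" "swap X x y1 \<in> \<B>" "x \<in> X" using x unfolding P_def by auto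
  obtain x1 where x1: "x1 \<in> X" "swap X x1 y \<in> \<B>" "y \<in> E - X" using y unfolding Q_def by auto
  show "swap X x y \<in> \<B>"
  proof (cases "x = x1 \<or> y = y1")
    case True then show ?thesis using x1 y1 by auto
  next
    case False
    have "y1 \<in> swap X x y1 - swap X x1 y" using False y1 x1 unfolding swap_def by auto
    from exch[OF y1(2) x1(2) this] obtain z where
      z: "z \<in> swap X x1 y - swap X x y1" "swap (swap X x y1) y1 z \<in> \<B>" by auto
    have "z = x \<or> z = y" using z(1) unfolding swap_def by auto
    moreover have "swap (swap X x y1) y1 x = X" using y1 by (intro swap_inv) auto
    moreover have "swap (swap X x y1) y1 y = swap X x y" using y1 unfolding swap_def by auto
    ultimately show ?thesis using z(2) K_notin[OF assms] by auto
  qed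
qed

lemma swap_K:
  assumes "X \<in> K" "x \<in> X" "y \<in> E - X" "x \<notin> P X \<or> y \<notin> Q X"
  shows "swap X x y \<in> K"
  using assms swap_in_lvl[OF K_lvl[OF assms(1)] assms(2,3)] unfolding K_def P_def Q_def by auto

lemma swap_K_iff:
  assumes "X \<in> K" "x \<in> X" "y \<in> E - X"
  shows "swap X x y \<in> K \<longleftrightarrow> x \<notin> P X \<or> y \<notin> Q X"
  using assms swap_K rectangle K_notin by blast

lemma P_empty_iff: "P X = {} \<longleftrightarrow> Q X = {}"
  unfolding P_def Q_def by blast

text \<open>Otherwise coexchange brings \<open>z\<close> into the basis \<open>J - z\<close> at the
  expense of some \<open>x\<close> outside \<open>B\<close>; then \<open>J - x\<close> is a basis,
  so \<open>x\<close> lies in \<open>circ J\<close>, hence in \<open>B\<close>.\<close>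

lemma no_basis_circ:
  assumes "B \<in> \<B>" "z \<in> circ J"
  shows "\<not> circ J \<subseteq> B"
proof
  assume s: "circ J \<subseteq> B"
  have z: "z \<in> J" "J - {z} \<in> \<B>" using assms unfolding circ_def by auto
  have "z \<in> B - (J - {z})" using s assms(2) by auto
  from coexch[OF z(2) assms(1) this] obtain x where
    x: "x \<in> J - {z} - B" "swap (J - {z}) x z \<in> \<B>" by auto
  have "swap (J - {z}) x z = J - {x}" using x(1) z(1) unfolding swap_def by auto
  then have "x \<in> circ J" using x unfolding circ_def by auto
  then show False using s x(1) by auto
qed

lemma basis_meets_coc:
  assumes "B \<in> \<B>" "z \<in> coc I"
  shows "B \<inter> coc I \<noteq> {}"
proof
  assume s: "B \<inter> coc I = {}"
  have z: "z \<notin> I" "insert z I \<in> \<B>" using assms unfolding coc_def by auto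
  have "z \<in> insert z I - B" using s assms(2) by auto
  from exch[OF z(2) assms(1) this] obtain y where
    y: "y \<in> B - insert z I" "swap (insert z I) z y \<in> \<B>" by auto
  have "swap (insert z I) z y = insert y I" using z(1) unfolding swap_def by auto
  then have "y \<in> coc I" using y basis_sub[OF assms(1)] unfolding coc_def by auto
  then show False using s y(1) by auto
qed

text \<open>Exchanging \<open>x\<close> against the basis \<open>insert y I\<close> must bring in an
  element of the cocircuit, since every basis meets it, and \<open>y\<close> is the only candidate.
  With its dual \<open>circ_swap_basis\<close> this makes linked sets both bases or both
  nonbases.\<close>

lemma coc_swap_basis:
  assumes "X \<in> \<B>" "X \<inter> coc I = {x}" "y \<in> coc I"
  shows "swap X x y \<in> \<B>"
proof (cases "x = y")
  case True
  then have "x \<in> X" using assms by auto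
  then have "swap X x y = X" using True unfolding swap_def by auto
  then show ?thesis using assms by simp
next
  case False
  have y: "y \<notin> I" "insert y I \<in> \<B>" and x: "x \<in> X" "x \<notin> I" using assms unfolding coc_def by auto
  have "x \<in> X - insert y I" using x False by auto
  from exch[OF assms(1) y(2) this] obtain z where z: "z \<in> insert y I - X" "swap X x z \<in> \<B>" by auto
  have "swap X x z \<inter> coc I \<noteq> {}" using basis_meets_coc[OF z(2) assms(3)] .
  then have "z \<in> coc I" using assms(2) unfolding swap_def by auto
  then have "z = y" using z(1) unfolding coc_def by auto
  then show ?thesis using z by auto
qed

lemma circ_swap_basis:
  assumes "X \<in> \<B>" "circ J - X = {y}" "x \<in> circ J" "x \<noteq> y"
  shows "swap X x y \<in> \<B>"
proof -
  have x: "x \<in> J" "J - {x} \<in> \<B>" and y: "y \<in> J" "y \<notin> X" using assms unfolding circ_def by auto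
  have xX: "x \<in> X" using assms(2,3,4) by auto
  have "x \<in> X - (J - {x})" using xX by auto
  have "y \<in> (J - {x}) - X" using y assms(4) by auto
  from coexch[OF assms(1) x(2)] this obtain z where z: "z \<in> X - (J - {x})" "swap X z y \<in> \<B>" by blast
  show ?thesis
  proof (cases "z = x")
    case False
    then have "z \<notin> J" using z(1) by auto
    then have "z \<notin> circ J" unfolding circ_def by auto
    then have "circ J \<subseteq> swap X z y" using assms(2) unfolding swap_def by auto
    then show ?thesis using no_basis_circ[OF z(2) assms(3)] by auto
  qed (use z in auto)
qed

text \<open>This is uniqueness of the fundamental circuit of \<open>c\<close> with respect to
  \<open>B\<close>, in the form needed to identify two small circuits.\<close>

lemma circ_eq:
  assumes "B \<in> \<B>" "c \<notin> B" "circ J - B = {c}"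
  shows "circ J = circ (insert c B)"
proof
  show "circ J \<subseteq> circ (insert c B)"
  proof
    fix z assume z: "z \<in> circ J"
    show "z \<in> circ (insert c B)"
    proof (cases "z = c")
      case True then show ?thesis using assms unfolding circ_def by auto
    next
      case False
      then have "z \<in> B" using z assms(3) by auto
      have "swap B z c \<in> \<B>" using circ_swap_basis[OF assms(1,3) z False] .
      moreover have "swap B z c = insert c B - {z}" using False unfolding swap_def by auto
      ultimately show ?thesis using \<open>z \<in> B\<close> unfolding circ_def by auto
    qed
  qed
  show "circ (insert c B) \<subseteq> circ J"
  proof
    fix z assume "z \<in> circ (insert c B)"
    then have z: "z \<in> insert c B" "insert c B - {z} \<in> \<B>" unfolding circ_def by auto
    have c: "c \<in> circ J" using assms by auto
    have "\<not> circ J \<subseteq> insert c B - {z}" using no_basis_circ[OF z(2) c] .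
    then show "z \<in> circ J" using assms(3) by auto
  qed
qed

text \<open>A basis that contains \<open>circ J - {e}\<close> and agrees as much as possible with \<open>insert e I\<close> would have
  to contain the whole circuit.\<close>

lemma orthogonality:
  assumes "circ J \<inter> coc I = {e}"
  shows False
proof -
  have e: "e \<in> J" "J - {e} \<in> \<B>" "e \<in> E" "e \<notin> I" "insert e I \<in> \<B>" using assms unfolding circ_def coc_def by auto
  define S where "S = {B \<in> \<B>. circ J - {e} \<subseteq> B}"
  have S: "J - {e} \<in> S" using e unfolding S_def circ_def by auto
  have finS: "finite S" unfolding S_def using finK by auto
  obtain B where B: "B \<in> S" "\<And>B'. B' \<in> S \<Longrightarrow> card (B' \<inter> insert e I) \<le> card (B \<inter> insert e I)"
  proof -
    let ?f = "\<lambda>B'. card (B' \<inter> insert e I)"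
    have "Max (?f ` S) \<in> ?f ` S" using finS S by (intro Max_in) auto
    then obtain B where "B \<in> S" "?f B = Max (?f ` S)" by auto
    then show ?thesis using that finS by (metis (mono_tags, lifting) Max_ge finite_imageI imageI)
  qed
  have BB: "B \<in> \<B>" "circ J - {e} \<subseteq> B" using B(1) unfolding S_def by auto
  have sub: "B \<subseteq> (circ J - {e}) \<union> insert e I"
  proof (rule ccontr)
    assume "\<not> ?thesis"
    then obtain z where z: "z \<in> B - insert e I" "z \<notin> circ J - {e}" by auto
    from exch[OF BB(1) e(5) z(1)] obtain y where y: "y \<in> insert e I - B" "swap B z y \<in> \<B>" by auto
    have "swap B z y \<in> S" using y(2) BB(2) z unfolding S_def swap_def by auto
    from B(2)[OF this] have le: "card (swap B z y \<inter> insert e I) \<le> card (B \<inter> insert e I)" .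
    have eq: "swap B z y \<inter> insert e I = insert y (B \<inter> insert e I)" using z y unfolding swap_def by auto
    have "finite (B \<inter> insert e I)" using basis_fin[OF BB(1)] by auto
    then show False using le eq y(1) by auto
  qed
  have ec: "e \<in> coc I" "e \<in> circ J" using assms by auto
  have "B \<inter> coc I \<noteq> {}" using basis_meets_coc[OF BB(1) ec(1)] .
  moreover have "B \<inter> coc I \<subseteq> {e}" using sub assms unfolding coc_def by auto
  ultimately have "e \<in> B" by auto
  then have "circ J \<subseteq> B" using BB(2) by auto
  then show False using no_basis_circ[OF BB(1) ec(2)] by auto
qed

text \<open>By \<open>rectangle\<close>, every \<open>q\<close> in \<open>Q X\<close> yields the
  same set, so \<open>P X\<close> is a genuine circuit although its definition mentions no fixed
  \<open>(r + 1)\<close>-set.\<close>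

lemma P_eq_circ:
  assumes "X \<in> K" "q \<in> Q X"
  shows "P X = circ (insert q X)"
proof -
  have q: "q \<in> E - X" using assms unfolding Q_def by auto
  have "z \<in> P X \<longleftrightarrow> z \<in> circ (insert q X)" for z
  proof (cases "z \<in> X")
    case True
    then have "swap X z q = insert q X - {z}" using q unfolding swap_def by auto
    moreover have "z \<in> P X \<longleftrightarrow> swap X z q \<in> \<B>"
      using rectangle[OF assms(1) _ assms(2)] True q unfolding P_def by auto
    ultimately show ?thesis using True unfolding circ_def by auto
  next
    case False
    moreover have "insert q X - {q} = X" using q by auto
    ultimately show ?thesis using K_notin[OF assms(1)] unfolding P_def circ_def by auto
  qed
  then show ?thesis by auto
qed

lemma Q_eq_coc:
  assumes "X \<in> K" "p \<in> P X"
  shows "Q X = coc (X - {p})"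
proof -
  have p: "p \<in> X" using assms unfolding P_def by auto
  have "z \<in> Q X \<longleftrightarrow> z \<in> coc (X - {p})" for z
  proof (cases "z \<in> E - X")
    case True
    then have "z \<in> Q X \<longleftrightarrow> swap X p z \<in> \<B>"
      using rectangle[OF assms(1) assms(2)] p unfolding Q_def by auto
    then show ?thesis using True unfolding coc_def swap_def by auto
  next
    case False
    moreover have "insert p (X - {p}) = X" using p by auto
    ultimately show ?thesis using K_notin[OF assms(1)] unfolding Q_def coc_def by auto
  qed
  then show ?thesis by auto
qed

end

section \<open>Tokens\<close>

lemma card_le_mult_fibres:
  assumes "finite A" "\<And>y. y \<in> f ` A \<Longrightarrow> card {a \<in> A. f a = y} \<le> m"
  shows "card A \<le> m * card (f ` A)"
proof -
  have "card A = (\<Sum>y\<in>f ` A. \<Sum>a | a \<in> A \<and> f a = y. 1)"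
    using sum.image_gen[OF assms(1), of "\<lambda>_. 1::nat" f] by simp
  also have "\<dots> \<le> (\<Sum>y\<in>f ` A. m)" using assms(2) by (intro sum_mono) simp
  finally show ?thesis by (simp add: mult.commute)
qed

text \<open>Only the order of the pair is lost. The map \<open>g\<close> is the identity in
  \<open>small_coc\<close> and a relative complement in \<open>small_circ\<close>.\<close>

lemma two_to_one:
  assumes "finite A" "\<And>u v. (u, v) \<in> A \<Longrightarrow> u \<notin> S \<and> v \<notin> S"
    and "inj_on g ((\<lambda>(u,v). {u,v} \<union> S) ` A)"
  shows "card A \<le> 2 * card ((\<lambda>(u,v). g ({u,v} \<union> S)) ` A)"
proof (rule card_le_mult_fibres[OF assms(1)])
  fix y assume "y \<in> (\<lambda>(u,v). g ({u,v} \<union> S)) ` A"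
  then obtain u v where uv: "(u,v) \<in> A" "y = g ({u,v} \<union> S)" by auto
  have "{a \<in> A. (\<lambda>(u,v). g ({u,v} \<union> S)) a = y} \<subseteq> {(u,v),(v,u)}"
  proof
    fix a assume a: "a \<in> {a \<in> A. (\<lambda>(u,v). g ({u,v} \<union> S)) a = y}"
    obtain u' v' where a': "a = (u',v')" by (cases a)
    have "{u',v'} \<union> S = {u,v} \<union> S"
      using inj_onD[OF assms(3), of "{u',v'} \<union> S" "{u,v} \<union> S"] a a' uv by force
    then have "{u',v'} = {u,v}" using assms(2)[OF uv(1)] assms(2)[of u' v'] a a' by auto
    then show "a \<in> {(u,v),(v,u)}" using a' by (auto simp: doubleton_eq_iff)
  qed
  then have "card {a \<in> A. (\<lambda>(u,v). g ({u,v} \<union> S)) a = y} \<le> card {(u,v),(v,u)}" by (intro card_mono) auto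
  also have "card {(u,v),(v,u)} \<le> 2" by (cases "u = v") simp_all
  finally show "card {a \<in> A. (\<lambda>(u,v). g ({u,v} \<union> S)) a = y} \<le> 2" .
qed

context basis_system
begin

lemma card_lvl_sub: "X \<in> lvl E m \<Longrightarrow> finite X \<and> X \<subseteq> E \<and> card X = m"
  unfolding lvl_def using finE finite_subset by auto

lemma circ_card: "z \<in> circ J \<Longrightarrow> card J = Suc r"
proof -
  assume "z \<in> circ J"
  then have "z \<in> J" and b: "J - {z} \<in> \<B>" unfolding circ_def by auto
  then have "finite J" using basis_fin[OF b] by auto
  then show ?thesis using basis_card[OF b] card_Suc_Diff1[OF _ \<open>z \<in> J\<close>] by auto
qed

lemma coc_card: "z \<in> coc I \<Longrightarrow> Suc (card I) = r"
proof -
  assume "z \<in> coc I"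
  then have "z \<notin> I" and b: "insert z I \<in> \<B>" unfolding coc_def by auto
  then have "finite I" using basis_fin[OF b] by auto
  then show ?thesis using basis_card[OF b] \<open>z \<notin> I\<close> by auto
qed

text \<open>Each set \<open>t\<close> of size \<open>r - 1\<close>, \<open>r\<close> or \<open>r + 1\<close> is a token revealing up to one circuit, up to one
  cocircuit or, for a nonbasis surrounded by nonbases, a ball of the Johnson graph. The nonbases that
  many tokens reveal are revealed by few well chosen ones.\<close>

definition tok_circ :: "'a set \<Rightarrow> 'a set" where "tok_circ t = (if t \<in> K then P t else circ t)"
definition tok_coc :: "'a set \<Rightarrow> 'a set" where "tok_coc t = (if t \<in> K then Q t else coc t)"

definition tok_cover :: "'a set \<Rightarrow> 'a set set" where
  "tok_cover t = {X \<in> lvl E r. tok_circ t \<noteq> {} \<and> tok_circ t \<subseteq> X \<or> tok_coc t \<noteq> {} \<and> tok_coc t \<inter> X = {} \<or>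
     t \<in> K \<and> P t = {} \<and> (X = t \<or> adj t X)}"

definition tokens :: "'a set set" where "tokens = lvl E (r - 1) \<union> lvl E r \<union> lvl E (Suc r)"

lemma fin_tokens: "finite tokens"
  unfolding tokens_def using finite_lvl[OF finE] by auto

lemma tok_circ_circ: assumes "tok_circ t \<noteq> {}" obtains J where "tok_circ t = circ J" "circ J \<noteq> {}"
proof (cases "t \<in> K")
  case True
  then have "Q t \<noteq> {}" using assms P_empty_iff unfolding tok_circ_def by auto
  then obtain q where "q \<in> Q t" by auto
  then show ?thesis using that P_eq_circ[OF True] True assms unfolding tok_circ_def by auto
qed (use that assms in \<open>auto simp: tok_circ_def\<close>)

lemma tok_coc_coc: assumes "tok_coc t \<noteq> {}" obtains I where "tok_coc t = coc I" "coc I \<noteq> {}"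
proof (cases "t \<in> K")
  case True
  then have "P t \<noteq> {}" using assms P_empty_iff unfolding tok_coc_def by auto
  then obtain q where "q \<in> P t" by auto
  then show ?thesis using that Q_eq_coc[OF True] True assms unfolding tok_coc_def by auto
qed (use that assms in \<open>auto simp: tok_coc_def\<close>)

lemma tok_cover_K: "tok_cover t \<subseteq> K"
proof
  fix X assume "X \<in> tok_cover t"
  then have X: "X \<in> lvl E r" and c: "tok_circ t \<noteq> {} \<and> tok_circ t \<subseteq> X \<or> tok_coc t \<noteq> {} \<and> tok_coc t \<inter> X = {} \<or>
     t \<in> K \<and> P t = {} \<and> (X = t \<or> adj t X)" unfolding tok_cover_def by auto
  have "X \<notin> \<B>"
  proof
    assume B: "X \<in> \<B>"
    from c consider "tok_circ t \<noteq> {}" "tok_circ t \<subseteq> X" | "tok_coc t \<noteq> {}" "tok_coc t \<inter> X = {}"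
      | "t \<in> K" "P t = {}" "X = t \<or> adj t X" by auto
    then show False
    proof cases
      case 1
      obtain J where "tok_circ t = circ J" "circ J \<noteq> {}" using tok_circ_circ[OF 1(1)] .
      then show ?thesis using no_basis_circ[OF B] 1 by auto
    next
      case 2
      obtain J where "tok_coc t = coc J" "coc J \<noteq> {}" using tok_coc_coc[OF 2(1)] .
      then show ?thesis using basis_meets_coc[OF B] 2 by auto
    next
      case 3
      have "X \<noteq> t" using B K_notin[OF 3(1)] by auto
      then have "adj t X" using 3 by auto
      then obtain x y where "x \<in> t" "y \<in> E - t" "X = swap t x y" using K_lvl[OF 3(1)] X by (rule adj_lvlE)
      then show ?thesis using B 3(2) unfolding P_def by auto
    qed
  qed
  then show "X \<in> K" using X unfolding K_def by auto
qed

text \<open>If \<open>Y = X - x + y\<close>, then \<open>Y - y + q = X - x + q\<close>. So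
  \<open>x\<close> outside \<open>P X\<close> puts \<open>y\<close> outside \<open>P Y\<close>, and
  the circuit \<open>P Y\<close> lies in \<open>X\<close>; dually, \<open>y\<close> outside
  \<open>Q X\<close> makes \<open>Q Y\<close> disjoint from \<open>X\<close>. By
  \<open>rectangle\<close> one of the two happens. Hence the rate of a nonbasis dominates its number
  of nonbasis neighbours.\<close>

lemma nbr_covers:
  assumes "X \<in> K" "Y \<in> K" "adj X Y"
  shows "X \<in> tok_cover Y"
proof (cases "P Y = {}")
  case True
  then show ?thesis using assms adj_sym K_lvl unfolding tok_cover_def by auto
next
  case ne: False
  obtain x y where xy: "x \<in> X" "y \<in> E - X" "Y = swap X x y"
    using adj_lvlE[OF assms(3) K_lvl[OF assms(1)] K_lvl[OF assms(2)]] .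
  have "x \<notin> P X \<or> y \<notin> Q X" using swap_K_iff[OF assms(1) xy(1,2)] assms(2) xy by auto
  then show ?thesis
  proof
    assume x: "x \<notin> P X"
    have "y \<notin> P Y"
    proof
      assume "y \<in> P Y"
      then obtain q where q: "q \<in> E - Y" "swap Y y q \<in> \<B>" unfolding P_def by auto
      have s: "swap Y y q = swap X x q" using xy unfolding swap_def by auto
      have "q \<noteq> x" using q s xy K_notin[OF assms(1)] unfolding swap_def by (auto simp: insert_absorb)
      then show False using x q s xy unfolding P_def swap_def by auto
    qed
    moreover have "P Y \<subseteq> Y" unfolding P_def by auto
    ultimately have "P Y \<subseteq> X" using xy unfolding swap_def by auto
    then show ?thesis using ne assms K_lvl unfolding tok_cover_def tok_circ_def by auto
  next
    assume y: "y \<notin> Q X"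
    have "x \<notin> Q Y"
    proof
      assume "x \<in> Q Y"
      then obtain p where p: "p \<in> Y" "swap Y p x \<in> \<B>" unfolding Q_def by auto
      have "p \<noteq> y"
      proof
        assume "p = y"
        then have "swap Y p x = X" using xy unfolding swap_def by auto
        then show False using p K_notin[OF assms(1)] by auto
      qed
      then have "p \<in> X" using p xy unfolding swap_def by auto
      moreover have "swap Y p x = swap X p y" using p xy \<open>p \<noteq> y\<close> unfolding swap_def by auto
      ultimately show False using y p xy unfolding Q_def by auto
    qed
    moreover have "Q Y \<inter> Y = {}" unfolding Q_def by auto
    ultimately have "Q Y \<inter> X = {}" using xy unfolding swap_def by auto
    moreover have "Q Y \<noteq> {}" using ne P_empty_iff by auto
    ultimately show ?thesis using assms K_lvl unfolding tok_cover_def tok_coc_def by auto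
  qed
qed

definition rate :: "'a set \<Rightarrow> nat" where
  "rate X = card {t \<in> tokens. X \<in> tok_cover t}"

lemma card_basis_nbrs:
  assumes "X \<in> K"
  shows "card {Y \<in> \<B>. adj X Y} = card (P X) * card (Q X)"
proof -
  have "{Y \<in> \<B>. adj X Y} = (\<lambda>(x,y). swap X x y) ` (P X \<times> Q X)"
  proof (intro equalityI subsetI)
    fix Y assume Y: "Y \<in> {Y \<in> \<B>. adj X Y}"
    then obtain x y where xy: "x \<in> X" "y \<in> E - X" "Y = swap X x y"
      using adj_lvlE[OF _ K_lvl[OF assms] basis_lvl] by blast
    then show "Y \<in> (\<lambda>(x,y). swap X x y) ` (P X \<times> Q X)" using Y unfolding P_def Q_def by auto
  next
    fix Y assume "Y \<in> (\<lambda>(x,y). swap X x y) ` (P X \<times> Q X)"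
    then obtain x y where "x \<in> P X" "y \<in> Q X" "Y = swap X x y" by auto
    moreover from this have "swap X x y \<in> \<B>" using rectangle[OF assms] by blast
    moreover have "x \<in> X" "y \<notin> X" using calculation unfolding P_def Q_def by auto
    ultimately show "Y \<in> {Y \<in> \<B>. adj X Y}" using adjI[of x X y] by simp
  qed
  moreover have "inj_on (\<lambda>(x,y). swap X x y) (P X \<times> Q X)"
  proof (rule inj_onI, clarify)
    fix x y x' y' assume "x \<in> P X" "y \<in> Q X" "x' \<in> P X" "y' \<in> Q X" and e: "swap X x y = swap X x' y'"
    then have a: "x \<in> X" "x' \<in> X" "y \<notin> X" "y' \<notin> X" unfolding P_def Q_def by auto
    show "x = x' \<and> y = y'" by (rule swap_inj[OF a e])
  qed
  ultimately show ?thesis by (simp add: card_image card_cartesian_product)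
qed

lemma card_nbrs:
  assumes "X \<in> lvl E r"
  shows "card {Y \<in> lvl E r. adj X Y} = r * (card E - r)"
proof -
  have "{Y \<in> lvl E r. adj X Y} = (\<lambda>(x,y). swap X x y) ` (X \<times> (E - X))"
  proof (intro equalityI subsetI)
    fix Y assume Y: "Y \<in> {Y \<in> lvl E r. adj X Y}"
    then obtain x y where xy: "x \<in> X" "y \<in> E - X" "Y = swap X x y"
      using adj_lvlE[OF _ assms] by blast
    then show "Y \<in> (\<lambda>(x,y). swap X x y) ` (X \<times> (E - X))" by auto
  next
    fix Y assume "Y \<in> (\<lambda>(x,y). swap X x y) ` (X \<times> (E - X))"
    then obtain x y where "x \<in> X" "y \<in> E - X" "Y = swap X x y" by auto
    then show "Y \<in> {Y \<in> lvl E r. adj X Y}" using swap_in_lvl[OF assms] adjI[of x X y] by auto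
  qed
  moreover have "inj_on (\<lambda>(x,y). swap X x y) (X \<times> (E - X))"
  proof (rule inj_onI, clarify)
    fix x y x' y' assume a: "x \<in> X" "y \<in> E" "y \<notin> X" "x' \<in> X" "y' \<in> E" "y' \<notin> X" and e: "swap X x y = swap X x' y'"
    show "x = x' \<and> y = y'" by (rule swap_inj[OF a(1,4,3,6) e])
  qed
  ultimately show ?thesis using card_lvl_sub[OF assms]
    by (simp add: card_image card_cartesian_product card_Diff_subset)
qed

lemma card_K_nbrs_le_rate:
  assumes "X \<in> K"
  shows "card {Y \<in> K. adj X Y} \<le> rate X"
  unfolding rate_def
  by (intro card_mono) (use fin_tokens nbr_covers[OF assms] K_lvl in \<open>auto simp: tokens_def\<close>)

text \<open>Of the \<open>r * (card E - r)\<close> neighbours, the bases number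
  \<open>card (P X) * card (Q X)\<close> and the nonbases number at most
  \<open>rate X\<close>.\<close>

lemma low_rate_PQ:
  assumes "X \<in> K" "rate X < \<rho>"
  shows "r * (card E - r) < card (P X) * card (Q X) + \<rho>"
proof -
  have "{Y \<in> lvl E r. adj X Y} = {Y \<in> \<B>. adj X Y} \<union> {Y \<in> K. adj X Y}"
    using basis_lvl unfolding K_def by auto
  moreover have "card ({Y \<in> \<B>. adj X Y} \<union> {Y \<in> K. adj X Y}) \<le> card {Y \<in> \<B>. adj X Y} + card {Y \<in> K. adj X Y}"
    by (rule card_Un_le)
  ultimately show ?thesis
    using card_nbrs[OF K_lvl[OF assms(1)]] card_basis_nbrs[OF assms(1)] card_K_nbrs_le_rate[OF assms(1)] assms(2)
    by simp
qed

text \<open>If all cocircuits that meet \<open>X\<close> in \<open>x\<close> only were large, many spanning \<open>(r + 1)\<close>-sets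
  \<open>X - {x} \<union> {u, v}\<close> would have their circuit inside \<open>X\<close>, and the rate of \<open>X\<close> would be high.\<close>

lemma small_coc:
  assumes X: "X \<in> K" "rate X < \<rho>" "x \<in> X - P X" "P X \<noteq> {}" "2 * \<rho> \<le> card (Q X) * \<delta>"
  shows "\<exists>I. coc I \<inter> X = {x} \<and> card (coc I) \<le> \<delta>"
proof (rule ccontr)
  assume no: "\<not> ?thesis"
  obtain p where p: "p \<in> P X" using X by auto
  have px: "p \<in> X" "p \<noteq> x" "x \<in> X" using p X unfolding P_def by auto
  \<comment> \<open>As \<open>x\<close> is outside \<open>P X\<close>, no \<open>X - x + u\<close>
    is a basis, so \<open>p\<close> is not in the cocircuit of \<open>X - x - p + u\<close>; that
    cocircuit therefore meets \<open>X\<close> in \<open>x\<close> alone.\<close>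
  define I where "I = (\<lambda>u. insert u (X - {x,p}))"
  have QE: "u \<in> E - X" if "u \<in> Q X" for u using that unfolding Q_def by auto
  have notP: "swap X x v \<notin> \<B>" if "v \<in> E - X" for v using X(3) that unfolding P_def by auto
  have cI: "coc (I u) \<inter> X = {x}" if u: "u \<in> Q X" for u
  proof -
    have b: "swap X p u \<in> \<B>" using rectangle[OF X(1) p u] .
    have "swap X p u = insert x (I u)" using px QE[OF u] unfolding I_def swap_def by auto
    then have "x \<in> coc (I u)" using b px QE[OF u] K_sub[OF X(1)] unfolding coc_def I_def by auto
    moreover have "insert p (I u) = swap X x u" using px QE[OF u] unfolding I_def swap_def by auto
    then have "p \<notin> coc (I u)" using notP[OF QE[OF u]] unfolding coc_def by auto
    ultimately show ?thesis using px unfolding coc_def I_def by auto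
  qed
  \<comment> \<open>Each pair gives the token \<open>J = X - x + u + v\<close>. It is spanning, as
    \<open>J - p\<close> is a basis, and neither \<open>u\<close> nor \<open>v\<close> lies in its
    circuit, which is thus contained in \<open>X\<close>.\<close>
  define A where "A = Sigma (Q X) (\<lambda>u. coc (I u) - {x})"
  have finQ: "finite (Q X)" using finE unfolding Q_def by auto
  have fincoc: "finite (coc I)" for I using finE unfolding coc_def by auto
  have big: "\<delta> \<le> card (coc (I u) - {x})" if "u \<in> Q X" for u
  proof -
    have "card (coc (I u)) > \<delta>" using no cI[OF that] by (meson not_le)
    moreover have "x \<in> coc (I u)" using cI[OF that] by auto
    ultimately show ?thesis using fincoc by (simp add: card_Diff_singleton)
  qed
  have finA: "finite A" unfolding A_def using finQ fincoc by auto
  have "card A = (\<Sum>u\<in>Q X. card (coc (I u) - {x}))" unfolding A_def using finQ fincoc by (intro card_SigmaI) auto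
  also have "\<dots> \<ge> (\<Sum>u\<in>Q X. \<delta>)" using big by (intro sum_mono) auto
  finally have cA: "2 * \<rho> \<le> card A" using X(5) by simp
  have A: "u \<in> E - X" "v \<in> E - X" "u \<noteq> v" "insert v (I u) \<in> \<B>" "u \<in> Q X" if "(u,v) \<in> A" for u v
  proof -
    have u: "u \<in> Q X" and v: "v \<in> coc (I u)" "v \<noteq> x" using that unfolding A_def by auto
    show "u \<in> E - X" "u \<in> Q X" using QE[OF u] u by auto
    show "insert v (I u) \<in> \<B>" "v \<in> E - X" using v cI[OF u] unfolding coc_def by auto
    show "u \<noteq> v" using v unfolding coc_def I_def by auto
  qed
  have "card A \<le> 2 * card ((\<lambda>(u,v). (\<lambda>z. z) ({u,v} \<union> (X - {x}))) ` A)"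
    by (rule two_to_one[OF finA]) (use A in auto)
  also have "card ((\<lambda>(u,v). (\<lambda>z. z) ({u,v} \<union> (X - {x}))) ` A) \<le> rate X"
    unfolding rate_def
  proof (rule card_mono)
    show "finite {t \<in> tokens. X \<in> tok_cover t}" using fin_tokens by auto
    show "(\<lambda>(u,v). (\<lambda>z. z) ({u,v} \<union> (X - {x}))) ` A \<subseteq> {t \<in> tokens. X \<in> tok_cover t}"
    proof
      fix J assume "J \<in> (\<lambda>(u,v). (\<lambda>z. z) ({u,v} \<union> (X - {x}))) ` A"
      then obtain u v where uv: "(u,v) \<in> A" and J: "J = {u,v} \<union> (X - {x})" by auto
      note a = A[OF uv]
      have "J - {p} = insert v (I u)" using J a px unfolding I_def by auto
      then have pc: "p \<in> circ J" using a(4) J px unfolding circ_def by auto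
      have cJ: "card J = Suc r" using circ_card[OF pc] .
      have "u \<notin> circ J"
      proof
        assume "u \<in> circ J"
        moreover have "J - {u} = swap X x v" using J a unfolding swap_def by auto
        ultimately show False using notP[OF a(2)] unfolding circ_def by auto
      qed
      moreover have "v \<notin> circ J"
      proof
        assume "v \<in> circ J"
        moreover have "J - {v} = swap X x u" using J a unfolding swap_def by auto
        ultimately show False using notP[OF a(1)] unfolding circ_def by auto
      qed
      ultimately have "circ J \<subseteq> X" using J unfolding circ_def by auto
      moreover have "J \<notin> K" using cJ K_card by auto
      ultimately have "X \<in> tok_cover J" using pc K_lvl[OF X(1)] unfolding tok_cover_def tok_circ_def by auto
      moreover have "J \<in> tokens" using cJ J a K_sub[OF X(1)] unfolding tokens_def lvl_def by auto
      ultimately show "J \<in> {t \<in> tokens. X \<in> tok_cover t}" by auto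
    qed
  qed
  finally show False using cA X(2) by auto
qed

text \<open>Dual to \<open>small_coc\<close>: here the tokens are the independent
  \<open>(r - 1)\<close>-sets \<open>X + y - u - v\<close>. Their cocircuits contain neither
  \<open>u\<close> nor \<open>v\<close>, so they are disjoint from \<open>X\<close>.\<close>

lemma small_circ:
  assumes X: "X \<in> K" "rate X < \<rho>" "y \<in> E - X - Q X" "P X \<noteq> {}" "2 * \<rho> \<le> card (P X) * \<delta>"
  shows "\<exists>J. circ J - X = {y} \<and> card (circ J) \<le> \<delta>"
proof (rule ccontr)
  assume no: "\<not> ?thesis"
  obtain q where q: "q \<in> Q X" using X P_empty_iff by auto
  have qx: "q \<notin> X" "q \<in> E" "q \<noteq> y" "y \<notin> X" "y \<in> E" using q X unfolding Q_def by auto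
  define J where "J = (\<lambda>u. {y,q} \<union> (X - {u}))"
  have PE: "u \<in> X" if "u \<in> P X" for u using that unfolding P_def by auto
  have notQ: "swap X v y \<notin> \<B>" if "v \<in> X" for v using X(3) that unfolding Q_def by auto
  have cJ: "circ (J u) - X = {y}" if u: "u \<in> P X" for u
  proof -
    have b: "swap X u q \<in> \<B>" using rectangle[OF X(1) u q] .
    have "swap X u q = J u - {y}" using qx PE[OF u] unfolding J_def swap_def by auto
    then have "y \<in> circ (J u)" using b unfolding circ_def J_def by auto
    moreover have "J u - {q} = swap X u y" using qx PE[OF u] unfolding J_def swap_def by auto
    then have "q \<notin> circ (J u)" using notQ[OF PE[OF u]] unfolding circ_def by auto
    ultimately show ?thesis using qx unfolding circ_def J_def by auto
  qed
  define A where "A = Sigma (P X) (\<lambda>u. circ (J u) - {y})"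
  have finX: "finite X" using K_fin[OF X(1)] .
  have finP: "finite (P X)" using finX unfolding P_def by auto
  have fincirc: "finite (circ (J u))" for u using finX unfolding J_def circ_def by auto
  have big: "\<delta> \<le> card (circ (J u) - {y})" if "u \<in> P X" for u
  proof -
    have "card (circ (J u)) > \<delta>" using no cJ[OF that] by (meson not_le)
    moreover have "y \<in> circ (J u)" using cJ[OF that] by auto
    ultimately show ?thesis using fincirc by (simp add: card_Diff_singleton)
  qed
  have finA: "finite A" unfolding A_def using finP fincirc by auto
  have "card A = (\<Sum>u\<in>P X. card (circ (J u) - {y}))" unfolding A_def using finP fincirc by (intro card_SigmaI) auto
  also have "\<dots> \<ge> (\<Sum>u\<in>P X. \<delta>)" using big by (intro sum_mono) auto
  finally have cA: "2 * \<rho> \<le> card A" using X(5) by simp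
  have A: "u \<in> X" "v \<in> X" "u \<noteq> v" "J u - {v} \<in> \<B>" "u \<in> P X" if "(u,v) \<in> A" for u v
  proof -
    have u: "u \<in> P X" and v: "v \<in> circ (J u)" "v \<noteq> y" using that unfolding A_def by auto
    show "u \<in> X" "u \<in> P X" using PE[OF u] u by auto
    show "J u - {v} \<in> \<B>" "v \<in> X" using v cJ[OF u] unfolding circ_def by auto
    show "u \<noteq> v" using v cJ[OF u] PE[OF u] qx unfolding circ_def J_def by auto
  qed
  have "card A \<le> 2 * card ((\<lambda>(u,v). (\<lambda>z. insert y X - z) ({u,v} \<union> {})) ` A)"
  proof (rule two_to_one[OF finA])
    show "inj_on (\<lambda>z. insert y X - z) ((\<lambda>(u, v). {u, v} \<union> {}) ` A)"
    proof (rule inj_onI)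
      have sX: "S \<subseteq> X" if S: "S \<in> (\<lambda>(u, v). {u, v} \<union> {}) ` A" for S
      proof -
        obtain u v where uv: "(u,v) \<in> A" "S = {u,v}" using S by auto
        show ?thesis using A(1,2)[OF uv(1)] uv(2) by simp
      qed
      fix S T assume S: "S \<in> (\<lambda>(u, v). {u, v} \<union> {}) ` A" and T: "T \<in> (\<lambda>(u, v). {u, v} \<union> {}) ` A"
        and eq: "insert y X - S = insert y X - T"
      have "S = insert y X - (insert y X - S)" "T = insert y X - (insert y X - T)" using sX[OF S] sX[OF T] by auto
      then show "S = T" using eq by simp
    qed
  qed auto
  also have "card ((\<lambda>(u,v). (\<lambda>z. insert y X - z) ({u,v} \<union> {})) ` A) \<le> rate X"
    unfolding rate_def
  proof (rule card_mono)
    show "finite {t \<in> tokens. X \<in> tok_cover t}" using fin_tokens by auto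
    show "(\<lambda>(u,v). (\<lambda>z. insert y X - z) ({u,v} \<union> {})) ` A \<subseteq> {t \<in> tokens. X \<in> tok_cover t}"
    proof
      fix I assume "I \<in> (\<lambda>(u,v). (\<lambda>z. insert y X - z) ({u,v} \<union> {})) ` A"
      then obtain u v where uv: "(u,v) \<in> A" and I: "I = insert y X - {u,v}" by auto
      note a = A[OF uv]
      have "insert q I = J u - {v}" using I a qx unfolding J_def by auto
      then have pc: "q \<in> coc I" using a(4) I qx unfolding coc_def by auto
      have cI: "Suc (card I) = r" using coc_card[OF pc] .
      have "u \<notin> coc I"
      proof
        assume "u \<in> coc I"
        moreover have "insert u I = swap X v y" using I a qx unfolding swap_def by auto
        ultimately show False using notQ[OF a(2)] unfolding coc_def by auto
      qed
      moreover have "v \<notin> coc I"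
      proof
        assume "v \<in> coc I"
        moreover have "insert v I = swap X u y" using I a qx unfolding swap_def by auto
        ultimately show False using notQ[OF a(1)] unfolding coc_def by auto
      qed
      ultimately have "coc I \<inter> X = {}" using I unfolding coc_def by auto
      moreover have "I \<notin> K" using cI K_card[of I] by linarith
      ultimately have "X \<in> tok_cover I" using pc K_lvl[OF X(1)] unfolding tok_cover_def tok_coc_def by auto
      moreover have "I \<in> tokens" using cI I qx K_sub[OF X(1)] unfolding tokens_def lvl_def by auto
      ultimately show "I \<in> {t \<in> tokens. X \<in> tok_cover t}" by auto
    qed
  qed
  finally show False using cA X(2) by auto
qed

end

section \<open>Linked nonbases\<close>

text \<open>The decoder knows no basis system, so the information of the chosen tokens is expressed
  by bare families: circuits in \<open>Z1\<close>, cocircuits in \<open>Z2\<close>, and in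
  \<open>Z3\<close> centres of balls consisting of nonbases.\<close>

definition cover :: "'a set \<Rightarrow> nat \<Rightarrow> 'a set set \<Rightarrow> 'a set set \<Rightarrow> 'a set set \<Rightarrow> 'a set set" where
  "cover E r Z1 Z2 Z3 = {X \<in> lvl E r. (\<exists>C\<in>Z1. C \<subseteq> X) \<or> (\<exists>D\<in>Z2. D \<inter> X = {}) \<or> (\<exists>t\<in>Z3. X = t \<or> adj t X)}"

text \<open>\<open>\<C>\<close> and \<open>\<D>\<close> stand for the small circuits and the small cocircuits. Linked sets are
  both bases or both nonbases, so the nonbases among the unblocked sets form a union of components of
  \<open>linked\<close> and can be described by one representative of each component.\<close>

definition unblocked :: "'a set \<Rightarrow> nat \<Rightarrow> 'a set set \<Rightarrow> 'a set set \<Rightarrow> 'a set set" where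
  "unblocked E r \<C> \<D> = {X \<in> lvl E r. (\<forall>C\<in>\<C>. \<not> C \<subseteq> X) \<and> (\<forall>D\<in>\<D>. D \<inter> X \<noteq> {})}"

definition linked :: "'a set \<Rightarrow> nat \<Rightarrow> 'a set set \<Rightarrow> 'a set set \<Rightarrow> ('a set \<times> 'a set) set" where
  "linked E r \<C> \<D> = {(X, Y). X \<in> unblocked E r \<C> \<D> \<and> Y \<in> unblocked E r \<C> \<D> \<and>
     (\<exists>x\<in>X. \<exists>y\<in>E - X. Y = swap X x y \<and> ((\<exists>C\<in>\<C>. C - X = {y}) \<or> (\<exists>D\<in>\<D>. D \<inter> X = {x})))}"

text \<open>Blocked members of \<open>V\<close> are ignored. They can be added or altered freely as
  far as stability permits, which is the source of the multiplicity in
  \<open>encode_circ_covered\<close>.\<close>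

definition decode :: "'a set \<Rightarrow> nat \<Rightarrow> 'a set set \<times> 'a set set \<times> 'a set set \<times> 'a set set \<times> 'a set set \<Rightarrow> 'a set set \<Rightarrow> 'a set set" where
  "decode E r = (\<lambda>(Z1, Z2, Z3, \<C>, \<D>) V. cover E r Z1 Z2 Z3 \<union> (lvl E r - unblocked E r \<C> \<D>) \<union>
     (linked E r \<C> \<D>)\<^sup>* `` (V \<inter> unblocked E r \<C> \<D>))"

text \<open>Both ends being unblocked is what reverses a link: a circuit that leaves
  \<open>X\<close> only at \<open>y\<close> is not contained in \<open>Y\<close>, so it must leave
  \<open>Y\<close> at \<open>x\<close>, and likewise for cocircuits.\<close>

lemma sym_linked: "sym (linked E r \<C> \<D>)"
proof (rule symI)
  fix X Y assume "(X, Y) \<in> linked E r \<C> \<D>"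
  then obtain x y where XY: "X \<in> unblocked E r \<C> \<D>" "Y \<in> unblocked E r \<C> \<D>" and x: "x \<in> X" and y: "y \<in> E - X"
    and Y: "Y = swap X x y" and c: "(\<exists>C\<in>\<C>. C - X = {y}) \<or> (\<exists>D\<in>\<D>. D \<inter> X = {x})"
    unfolding linked_def by auto
  have XE: "X \<subseteq> E" using XY unfolding unblocked_def lvl_def by auto
  have y': "y \<in> Y" "x \<in> E - Y" "X = swap Y y x" using x y Y XE unfolding swap_def by auto
  have "(\<exists>C\<in>\<C>. C - Y = {x}) \<or> (\<exists>D\<in>\<D>. D \<inter> Y = {y})"
    using c
  proof (elim disjE bexE)
    fix C assume C: "C \<in> \<C>" "C - X = {y}"
    have "\<not> C \<subseteq> Y" using C XY unfolding unblocked_def by auto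
    then have "C - Y = {x}" using C(2) Y unfolding swap_def by auto
    then show ?thesis using C by auto
  next
    fix D assume D: "D \<in> \<D>" "D \<inter> X = {x}"
    have "D \<inter> Y \<noteq> {}" using D XY unfolding unblocked_def by auto
    then have "D \<inter> Y = {y}" using D(2) Y unfolding swap_def by auto
    then show ?thesis using D by auto
  qed
  then show "(Y, X) \<in> linked E r \<C> \<D>" using XY y' unfolding linked_def by blast
qed

lemma sym_linkeds: "(X, Y) \<in> (linked E r \<C> \<D>)\<^sup>* \<Longrightarrow> (Y, X) \<in> (linked E r \<C> \<D>)\<^sup>*"
  using sym_rtrancl[OF sym_linked] by (rule symD)

text \<open>By double counting, some token covers a proportion of at least
  \<open>\<rho> / card T\<close> of what is still uncovered; iterate using
  \<open>1 - s \<le> exp (- s)\<close>.\<close>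

lemma greedy_cover:
  fixes \<rho> :: real and m :: nat
  assumes "finite T" "finite A" "0 \<le> \<rho>" "\<And>a. a \<in> A \<Longrightarrow> \<rho> \<le> card {t \<in> T. a \<in> cov t}"
  shows "\<exists>Z\<subseteq>T. card Z \<le> m \<and> card (A - \<Union>(cov ` Z)) \<le> card A * exp (- \<rho> * m / card T)"
proof (induction m)
  case 0
  then show ?case by (intro exI[of _ "{}"]) auto
next
  case (Suc m)
  then obtain Z where Z: "Z \<subseteq> T" "card Z \<le> m" "card (A - \<Union>(cov ` Z)) \<le> card A * exp (- \<rho> * m / card T)" by auto
  define R where "R = A - \<Union>(cov ` Z)"
  have finR: "finite R" using assms unfolding R_def by auto
  show ?case
  proof (cases "T = {}")
    case True
    then show ?thesis using Z by (intro exI[of _ Z]) auto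
  next
    case T: False
    then have T0: "card T > 0" using assms by auto
    have "\<rho> * card R = (\<Sum>a\<in>R. \<rho>)" by simp
    also have "\<dots> \<le> (\<Sum>a\<in>R. real (card {t \<in> T. a \<in> cov t}))" using assms(4) unfolding R_def by (intro sum_mono) auto
    also have "\<dots> = (\<Sum>a\<in>R. \<Sum>t\<in>T. if a \<in> cov t then 1 else 0)"
      using assms(1) by (intro sum.cong refl) (simp add: sum.If_cases Int_def)
    also have "\<dots> = (\<Sum>t\<in>T. \<Sum>a\<in>R. if a \<in> cov t then 1 else 0)" by (rule sum.swap)
    also have "\<dots> = (\<Sum>t\<in>T. real (card (R \<inter> cov t)))"
      using finR by (intro sum.cong refl) (simp add: sum.If_cases Int_def)
    finally have *: "\<rho> * card R \<le> (\<Sum>t\<in>T. real (card (R \<inter> cov t)))" .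
    have "\<exists>t\<in>T. \<rho> * card R / card T \<le> card (R \<inter> cov t)"
    proof (rule ccontr)
      assume "\<not> ?thesis"
      then have "(\<Sum>t\<in>T. real (card (R \<inter> cov t))) < (\<Sum>t\<in>T. \<rho> * card R / card T)"
        using T assms(1) by (intro sum_strict_mono) auto
      then show False using * T0 by simp
    qed
    then obtain t where t: "t \<in> T" "\<rho> * card R / card T \<le> card (R \<inter> cov t)" by auto
    have "A - \<Union>(cov ` insert t Z) = R - (R \<inter> cov t)" unfolding R_def by auto
    then have "real (card (A - \<Union>(cov ` insert t Z))) = real (card R) - card (R \<inter> cov t)"
      using finR by (simp add: card_Diff_subset card_mono of_nat_diff)
    also have "\<dots> \<le> card R - \<rho> * card R / card T" using t by simp
    also have "\<dots> = card R * (1 + (- \<rho> / card T))" by (simp add: algebra_simps)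
    also have "\<dots> \<le> card R * exp (- \<rho> / card T)" by (intro mult_left_mono exp_ge_add_one_self) auto
    also have "\<dots> \<le> card A * exp (- \<rho> * m / card T) * exp (- \<rho> / card T)"
      using Z(3) unfolding R_def by (intro mult_right_mono) auto
    also have "\<dots> = card A * exp (- \<rho> * Suc m / card T)"
      by (simp add: mult.assoc exp_add[symmetric] add_divide_distrib[symmetric] algebra_simps)
    finally have "card (A - \<Union>(cov ` insert t Z)) \<le> card A * exp (- \<rho> * Suc m / card T)" .
    moreover have "card (insert t Z) \<le> Suc m" using Z(2) card_insert_le_m1[of "Suc m" Z t] by auto
    ultimately show ?thesis using Z t by (intro exI[of _ "insert t Z"]) auto
  qed
qed

text \<open>What the greedy steps leave over is covered with one token per element.\<close>

lemma full_cover: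
  fixes \<rho> :: real and m :: nat
  assumes "finite T" "finite A" "0 \<le> \<rho>" "\<And>a. a \<in> A \<Longrightarrow> \<rho> \<le> card {t \<in> T. a \<in> cov t}" "0 < \<rho>"
  shows "\<exists>Z\<subseteq>T. card Z \<le> m + card A * exp (- \<rho> * m / card T) \<and> A \<subseteq> \<Union>(cov ` Z)"
proof -
  obtain Z where Z: "Z \<subseteq> T" "card Z \<le> m" "card (A - \<Union>(cov ` Z)) \<le> card A * exp (- \<rho> * m / card T)"
  proof -
    have "\<exists>Z\<subseteq>T. card Z \<le> m \<and> card (A - \<Union>(cov ` Z)) \<le> card A * exp (- \<rho> * m / card T)"
      by (rule greedy_cover[OF assms(1-4)])
    then show ?thesis using that by auto
  qed
  have "\<exists>t\<in>T. a \<in> cov t" if "a \<in> A" for a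
  proof (rule ccontr)
    assume "\<not> ?thesis"
    then have e: "{t \<in> T. a \<in> cov t} = {}" by blast
    have "card {t \<in> T. a \<in> cov t} = 0" unfolding e by simp
    then show False using assms(4)[OF that] assms(5) by linarith
  qed
  then obtain f where f: "\<And>a. a \<in> A \<Longrightarrow> f a \<in> T \<and> a \<in> cov (f a)" by metis
  define Z' where "Z' = Z \<union> f ` (A - \<Union>(cov ` Z))"
  have "card Z' \<le> card Z + card (f ` (A - \<Union>(cov ` Z)))" unfolding Z'_def by (rule card_Un_le)
  also have "\<dots> \<le> m + card (A - \<Union>(cov ` Z))"
    by (intro add_mono Z card_image_le) (use assms in auto)
  finally have "real (card Z') \<le> m + card A * exp (- \<rho> * m / card T)" using Z(3) by linarith
  moreover have "A \<subseteq> \<Union>(cov ` Z')" using f unfolding Z'_def by blast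
  moreover have "Z' \<subseteq> T" using Z f unfolding Z'_def by auto
  ultimately show ?thesis by blast
qed

section \<open>Small circuits, small cocircuits and the side information of a basis system\<close>

context basis_system
begin

definition smallC :: "nat \<Rightarrow> 'a set set" where
  "smallC \<delta> = {C. (\<exists>J. C = circ J) \<and> C \<subseteq> E \<and> C \<noteq> {} \<and> card C \<le> \<delta>}"

definition smallD :: "nat \<Rightarrow> 'a set set" where
  "smallD \<delta> = {D. (\<exists>I. D = coc I) \<and> D \<subseteq> E \<and> D \<noteq> {} \<and> card D \<le> \<delta>}"

abbreviation "unblockedB \<delta> \<equiv> unblocked E r (smallC \<delta>) (smallD \<delta>)"
abbreviation "linkedB \<delta> \<equiv> linked E r (smallC \<delta>) (smallD \<delta>)"

definition circ_covered :: "nat \<Rightarrow> 'a \<Rightarrow> 'a set set" where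
  "circ_covered \<delta> e = {X \<in> lvl E r. \<exists>C\<in>smallC \<delta>. e \<in> C \<and> C \<subseteq> X}"

definition coc_covered :: "nat \<Rightarrow> 'a \<Rightarrow> 'a set set" where
  "coc_covered \<delta> f = {X \<in> lvl E r. \<exists>D\<in>smallD \<delta>. f \<in> D \<and> D \<inter> X = {}}"

lemma circ_covered_unblocked: "circ_covered \<delta> e \<inter> unblockedB \<delta> = {}"
  unfolding circ_covered_def unblocked_def by auto

lemma K_compl_unblocked: "lvl E r - unblockedB \<delta> \<subseteq> K"
proof
  fix X assume X: "X \<in> lvl E r - unblockedB \<delta>"
  then consider C where "C \<in> smallC \<delta>" "C \<subseteq> X" | D where "D \<in> smallD \<delta>" "D \<inter> X = {}"
    unfolding unblocked_def by auto
  then have "X \<notin> \<B>"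
  proof cases
    case 1
    then show ?thesis using no_basis_circ[of X] unfolding smallC_def by blast
  next
    case 2
    then show ?thesis using basis_meets_coc[of X] unfolding smallD_def by blast
  qed
  then show "X \<in> K" using X unfolding K_def by auto
qed

text \<open>If \<open>Y\<close> were a basis, the exchange along the linking circuit or cocircuit
  would make \<open>X\<close> a basis too.\<close>

lemma linked_closed:
  assumes "X \<in> K" "(X, Y) \<in> linkedB \<delta>"
  shows "Y \<in> K"
proof (rule ccontr)
  assume "Y \<notin> K"
  have YX: "(Y, X) \<in> linkedB \<delta>" using symD[OF sym_linked assms(2)] .
  then obtain x y where XY: "X \<in> unblockedB \<delta>" "Y \<in> unblockedB \<delta>" and y: "y \<in> Y" and x: "x \<in> E - Y"
    and X: "X = swap Y y x" and c: "(\<exists>C\<in>smallC \<delta>. C - Y = {x}) \<or> (\<exists>D\<in>smallD \<delta>. D \<inter> Y = {y})"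
    unfolding linked_def by auto
  have Y: "Y \<in> \<B>" using \<open>Y \<notin> K\<close> XY unfolding K_def unblocked_def by auto
  have "swap Y y x \<in> \<B>"
    using c
  proof (elim disjE bexE)
    fix C assume C: "C \<in> smallC \<delta>" "C - Y = {x}"
    have "\<not> C \<subseteq> X" using C XY unfolding unblocked_def by auto
    then have "y \<in> C" using C(2) X unfolding swap_def by auto
    moreover obtain J where "C = circ J" using C unfolding smallC_def by auto
    ultimately show ?thesis using circ_swap_basis[OF Y, of J x y] C(2) y x by auto
  next
    fix D assume D: "D \<in> smallD \<delta>" "D \<inter> Y = {y}"
    have "D \<inter> X \<noteq> {}" using D XY unfolding unblocked_def by auto
    then have "x \<in> D" using D(2) X unfolding swap_def by auto
    moreover obtain I where "D = coc I" using D unfolding smallD_def by auto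
    ultimately show ?thesis using coc_swap_basis[OF Y, of I y x] D(2) by (auto simp: Int_commute)
  qed
  then show False using X assms(1) K_notin by auto
qed

lemma linkeds_closed:
  assumes "(X, Y) \<in> (linkedB \<delta>)\<^sup>*" "X \<in> K"
  shows "Y \<in> K"
  using assms by (induction rule: rtrancl_induct) (auto intro: linked_closed)

lemma exists_code:
  fixes \<rho> k m :: nat
  assumes k: "m + card K * exp (- real \<rho> * m / card tokens) \<le> k" and "0 < \<rho>"
  shows "\<exists>Z1 Z2 Z3. Z1 \<subseteq> Pow E \<and> Z2 \<subseteq> Pow E \<and> Z3 \<subseteq> Pow E \<and> card Z1 \<le> k \<and> card Z2 \<le> k \<and> card Z3 \<le> k \<and>
     cover E r Z1 Z2 Z3 \<subseteq> K \<and> (\<forall>X\<in>K - cover E r Z1 Z2 Z3. rate X < \<rho>)"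
proof -
  obtain Z where Z: "Z \<subseteq> tokens" "card Z \<le> m + card {X \<in> K. \<rho> \<le> rate X} * exp (- real \<rho> * m / card tokens)"
    "{X \<in> K. \<rho> \<le> rate X} \<subseteq> \<Union>(tok_cover ` Z)"
    using full_cover[OF fin_tokens, of "{X \<in> K. \<rho> \<le> rate X}" "real \<rho>" tok_cover m] finK assms(2)
    unfolding rate_def by auto
  have finZ: "finite Z" using Z(1) fin_tokens finite_subset by auto
  have "card {X \<in> K. \<rho> \<le> rate X} \<le> card K" using finK by (intro card_mono) auto
  then have "real (card {X \<in> K. \<rho> \<le> rate X}) * exp (- real \<rho> * m / card tokens) \<le> card K * exp (- real \<rho> * m / card tokens)"
    by (intro mult_right_mono) auto
  then have Zk: "card Z \<le> k" using Z(2) k by linarith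
  \<comment> \<open>The empty set marks a token that reveals no circuit or cocircuit. It must be
    dropped, since in \<open>cover\<close> it would cover the whole level.\<close>
  define Z1 where "Z1 = tok_circ ` Z - {{}}"
  define Z2 where "Z2 = tok_coc ` Z - {{}}"
  define Z3 where "Z3 = {t \<in> Z. t \<in> K \<and> P t = {}}"
  have eq: "cover E r Z1 Z2 Z3 = \<Union>(tok_cover ` Z)"
    unfolding cover_def Z1_def Z2_def Z3_def tok_cover_def by blast
  have "card Z1 \<le> k" "card Z2 \<le> k" "card Z3 \<le> k"
  proof -
    have "card Z1 \<le> card (tok_circ ` Z)" "card Z2 \<le> card (tok_coc ` Z)" "card Z3 \<le> card Z"
      unfolding Z1_def Z2_def Z3_def using finZ by (auto intro!: card_mono)
    then show "card Z1 \<le> k" "card Z2 \<le> k" "card Z3 \<le> k"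
      using card_image_le[OF finZ, of tok_circ] card_image_le[OF finZ, of tok_coc] Zk by linarith+
  qed
  moreover have tE: "t \<subseteq> E" if "t \<in> Z" for t using that Z(1) unfolding tokens_def lvl_def by auto
  then have "Z1 \<subseteq> Pow E" "Z2 \<subseteq> Pow E" "Z3 \<subseteq> Pow E"
    unfolding Z1_def Z2_def Z3_def tok_circ_def tok_coc_def circ_def coc_def P_def Q_def by (auto split: if_splits)
  moreover have "cover E r Z1 Z2 Z3 \<subseteq> K" using eq tok_cover_K by auto
  moreover have "\<forall>X\<in>K - cover E r Z1 Z2 Z3. rate X < \<rho>" using eq Z(3) by (auto simp: not_le[symmetric])
  ultimately show ?thesis by blast
qed

end

text \<open>For middle ranks \<open>r * (n - r)\<close> is at least \<open>2 n^2 / 9\<close>, so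
  \<open>50 * \<rho> \<le> n^2\<close> leaves more than \<open>n^2 / 5\<close> basis neighbours;
  \<open>8 * \<rho> \<le> \<delta> * n\<close> feeds \<open>small_coc\<close> and
  \<open>small_circ\<close> with sets \<open>P X\<close>, \<open>Q X\<close> of size at least
  \<open>n / 4\<close>; and \<open>8 * \<delta> < n\<close> makes two small circuits together
  smaller than \<open>P X\<close>.\<close>

locale coded_system = basis_system +
  fixes \<rho> \<delta> :: nat and Z1 Z2 Z3 :: "'a set set"
  assumes cover_K: "cover E r Z1 Z2 Z3 \<subseteq> K"
    and low_rate: "X \<in> K - cover E r Z1 Z2 Z3 \<Longrightarrow> rate X < \<rho>"
    and mid: "card E \<le> 3 * r" "3 * r \<le> 2 * card E"
    and rho: "50 * \<rho> \<le> card E ^ 2" "8 * \<rho> \<le> \<delta> * card E" "8 * \<delta> < card E"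
begin

text \<open>These are the nonbases that neither the tokens nor the small circuits and cocircuits
  account for, so the stable set has to represent them.\<close>

definition U :: "'a set set" where "U = (K - cover E r Z1 Z2 Z3) \<inter> unblockedB \<delta>"

lemma UK: "X \<in> U \<Longrightarrow> X \<in> K" and UO: "X \<in> U \<Longrightarrow> X \<in> unblockedB \<delta>"
  unfolding U_def by auto

lemma U_PQ:
  assumes "X \<in> U"
  shows "card E \<le> 4 * card (P X)" "card E \<le> 4 * card (Q X)" "card E ^ 2 \<le> 5 * (card (P X) * card (Q X))"
proof -
  have X: "X \<in> K" "rate X < \<rho>" using assms low_rate unfolding U_def by auto
  define n p q where "n = int (card E)" and "p = int (card (P X))" and "q = int (card (Q X))"
  have rn: "r \<le> card E" using mid by auto
  have "int (r * (card E - r)) < int (card (P X) * card (Q X) + \<rho>)"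
    using low_rate_PQ[OF X] by linarith
  then have 1: "int r * (n - int r) < p * q + int \<rho>"
    unfolding n_def p_def q_def using rn by (simp add: of_nat_diff)
  have "P X \<subseteq> X" "Q X \<subseteq> E - X" unfolding P_def Q_def by auto
  then have "card (P X) \<le> card X" "card (Q X) \<le> card (E - X)"
    using K_fin[OF X(1)] finE by (auto intro: card_mono)
  moreover have "card (E - X) = card E - r"
    using K_fin[OF X(1)] K_sub[OF X(1)] K_card[OF X(1)] by (simp add: card_Diff_subset)
  ultimately have 2: "p \<le> int r" "q \<le> n - int r" "0 \<le> p" "0 \<le> q"
    unfolding p_def q_def n_def using K_card[OF X(1)] rn by auto
  have 3: "n \<le> 3 * int r" "3 * int r \<le> 2 * n" unfolding n_def using mid by auto
  have 4: "50 * int \<rho> \<le> n ^ 2" unfolding n_def using rho(1) by (simp flip: of_nat_power)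
  \<comment> \<open>The product expands to \<open>9 r (n - r) - 2 n^2\<close>. The final margin is
    \<open>2/9 - 1/50 = 91/450\<close>, just above \<open>1/5\<close>.\<close>
  have "(3 * int r - n) * (2 * n - 3 * int r) \<ge> 0" using 3 by auto
  then have 5: "9 * (int r * (n - int r)) \<ge> 2 * n ^ 2" by (simp add: algebra_simps power2_eq_square)
  have pq: "450 * (p * q) \<ge> 91 * n ^ 2" using 1 4 5 by linarith
  then have "n ^ 2 \<le> 5 * (p * q)" by (smt (verit) zero_le_power2)
  then show "card E ^ 2 \<le> 5 * (card (P X) * card (Q X))"
    unfolding n_def p_def q_def by (simp flip: of_nat_power of_nat_mult)
  have n0: "0 < n" unfolding n_def using rho by auto
  have "3 * (p * q) \<le> p * (2 * n)" using 2 3 mult_left_mono[of "3 * q" "2 * n" p] by (simp add: algebra_simps)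
  then have "91 * n * n \<le> 300 * p * n" using pq by (simp add: power2_eq_square algebra_simps)
  then have "91 * n \<le> 300 * p" using n0 by (metis mult_le_cancel_right_pos)
  then show "card E \<le> 4 * card (P X)" using n0 unfolding n_def p_def by linarith
  have "3 * (p * q) \<le> (2 * n) * q" using 2 3 mult_right_mono[of "3 * p" "2 * n" q] by (simp add: algebra_simps)
  then have "91 * n * n \<le> 300 * q * n" using pq by (simp add: power2_eq_square algebra_simps)
  then have "91 * n \<le> 300 * q" using n0 by (metis mult_le_cancel_right_pos)
  then show "card E \<le> 4 * card (Q X)" using n0 unfolding n_def q_def by linarith
qed

text \<open>By \<open>rectangle\<close>, \<open>x\<close> is outside \<open>P X\<close> or
  \<open>y\<close> outside \<open>Q X\<close>, and the low rate then supplies a small cocircuit or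
  circuit realising the exchange. Only \<open>X\<close> is required to be in \<open>U\<close>; this
  asymmetry allows arbitrary unblocked nonbases in \<open>encode_many\<close> and
  \<open>movable\<close>.\<close>

lemma U_adj_linked:
  assumes X: "X \<in> U" and Y: "Y \<in> K" "Y \<in> unblockedB \<delta>" "adj X Y"
  shows "(X, Y) \<in> linkedB \<delta>"
proof -
  have XK: "X \<in> K" "rate X < \<rho>" using X low_rate unfolding U_def by auto
  obtain x y where xy: "x \<in> X" "y \<in> E - X" "Y = swap X x y"
    using adj_lvlE[OF Y(3) K_lvl[OF XK(1)] K_lvl[OF Y(1)]] .
  note pq = U_PQ[OF X]
  have n0: "0 < card E" using rho by auto
  have ne: "P X \<noteq> {}" using pq n0 by (metis card.empty mult_0_right not_le)
  have d: "2 * \<rho> \<le> c * \<delta>" if "card E \<le> 4 * c" for c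
  proof -
    have "8 * \<rho> \<le> \<delta> * (4 * c)" using rho(2) mult_le_mono2[OF that, of \<delta>] by linarith
    then show ?thesis by (simp add: mult.commute)
  qed
  have "x \<notin> P X \<or> y \<notin> Q X" using swap_K_iff[OF XK(1) xy(1,2)] Y xy by auto
  then have "(\<exists>C\<in>smallC \<delta>. C - X = {y}) \<or> (\<exists>D\<in>smallD \<delta>. D \<inter> X = {x})"
  proof
    assume "x \<notin> P X"
    then obtain I where "coc I \<inter> X = {x}" "card (coc I) \<le> \<delta>"
      using small_coc[OF XK _ ne d[OF pq(2)]] xy by auto
    then have "coc I \<in> smallD \<delta>" unfolding smallD_def coc_def by auto
    then show ?thesis using \<open>coc I \<inter> X = {x}\<close> by auto
  next
    assume "y \<notin> Q X"
    then obtain J where J: "circ J - X = {y}" "card (circ J) \<le> \<delta>"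
      using small_circ[OF XK _ ne d[OF pq(1)]] xy by auto
    then have "circ J \<subseteq> insert y X" by auto
    then have "circ J \<in> smallC \<delta>" using J xy K_sub[OF XK(1)] unfolding smallC_def by auto
    then show ?thesis using J by auto
  qed
  then show ?thesis using xy UO[OF X] Y(2) unfolding linked_def by blast
qed

text \<open>The two circuits have fewer than \<open>card (P X)\<close> elements together, so some
  \<open>p\<close> in \<open>P X\<close> avoids both. Both are then the fundamental circuit of
  \<open>c\<close> with respect to the basis \<open>X - p + q\<close>.\<close>

lemma unique_small_circ:
  assumes X: "X \<in> U" and c: "c \<notin> X" and C: "C \<in> smallC \<delta>" "C \<subseteq> insert c X" and C': "C' \<in> smallC \<delta>" "C' \<subseteq> insert c X"
  shows "C = C'"
proof -
  have cC: "c \<in> C" "c \<in> C'" using UO[OF X] C C' unfolding unblocked_def by auto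
  have "card (C \<union> C') \<le> card C + card C'" by (rule card_Un_le)
  also have "\<dots> \<le> 2 * \<delta>" using C C' unfolding smallC_def by auto
  also have "\<dots> < card (P X)" using U_PQ(1)[OF X] rho(3) by linarith
  finally have lt: "card (C \<union> C') < card (P X)" .
  have fin: "finite (C \<union> C')" using C C' finE unfolding smallC_def by (auto intro: finite_subset)
  obtain p where p: "p \<in> P X" "p \<notin> C \<union> C'" using lt card_mono[OF fin, of "P X"] by (meson not_le subsetI)
  obtain q where q: "q \<in> Q X" using p P_empty_iff by auto
  have B: "swap X p q \<in> \<B>" using rectangle[OF UK[OF X] p(1) q] .
  have pX: "p \<in> X" using p unfolding P_def by auto
  obtain J J' where J: "C = circ J" "C' = circ J'" using C C' unfolding smallC_def by auto
  have "q \<noteq> c"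
  proof
    assume "q = c"
    then have "C \<subseteq> swap X p q" using C p unfolding swap_def by auto
    then show False using no_basis_circ[OF B] cC J by auto
  qed
  then have c': "c \<notin> swap X p q" using c unfolding swap_def by auto
  have "circ J - swap X p q = {c}" "circ J' - swap X p q = {c}"
    using C C' J p cC c' unfolding swap_def by auto
  then show ?thesis using circ_eq[OF B c'] J by metis
qed

text \<open>The element omitted from \<open>insert c X\<close> can be moved along \<open>C\<close>
  without leaving the component. The new set contains no small circuit because \<open>C\<close> is
  the only one in \<open>insert c X\<close>, and a small cocircuit missing it would meet
  \<open>C\<close> in \<open>d\<close> alone, contradicting \<open>orthogonality\<close>.\<close>

lemma small_circ_move:
  assumes X: "X \<in> U" and C: "C \<in> smallC \<delta>" "C \<subseteq> insert c X" "c \<notin> X" and d: "d \<in> C"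
  shows "insert c X - {d} \<in> K" "insert c X - {d} \<in> unblockedB \<delta>" "(X, insert c X - {d}) \<in> (linkedB \<delta>)\<^sup>*"
proof -
  have cC: "c \<in> C" using UO[OF X] C unfolding unblocked_def by auto
  have CX: "C - X = {c}" using C cC by auto
  define Y where "Y = insert c X - {d}"
  have cE: "c \<in> E" using C cC unfolding smallC_def by auto
  have "Y \<in> K \<and> Y \<in> unblockedB \<delta> \<and> (X, Y) \<in> (linkedB \<delta>)\<^sup>*"
  proof (cases "d = c")
    case True
    then have "Y = X" unfolding Y_def using C by auto
    then show ?thesis using UK[OF X] UO[OF X] by auto
  next
    case False
    then have dX: "d \<in> X" using d C by auto
    have Ysw: "Y = swap X d c" unfolding Y_def swap_def using False by auto
    have Yl: "Y \<in> lvl E r" unfolding Ysw by (rule swap_in_lvl[OF K_lvl[OF UK[OF X]] dX]) (use C cE in auto)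
    have "\<not> C' \<subseteq> Y" if "C' \<in> smallC \<delta>" for C'
    proof
      assume s: "C' \<subseteq> Y"
      then have "C' = C" using unique_small_circ[OF X C(3) that _ C(1,2)] unfolding Y_def by auto
      then show False using s d unfolding Y_def by auto
    qed
    moreover have "D \<inter> Y \<noteq> {}" if D: "D \<in> smallD \<delta>" for D
    proof
      assume e: "D \<inter> Y = {}"
      have "D \<inter> X \<noteq> {}" using UO[OF X] D unfolding unblocked_def by auto
      then have "D \<inter> insert c X = {d}" using e False unfolding Y_def by auto
      then have "C \<inter> D = {d}" using C d by auto
      moreover obtain I J where "D = coc I" "C = circ J" using C D unfolding smallC_def smallD_def by auto
      ultimately show False using orthogonality by auto
    qed
    ultimately have YO: "Y \<in> unblockedB \<delta>" using Yl unfolding unblocked_def by auto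
    have "(X, Y) \<in> linkedB \<delta>" using UO[OF X] YO dX Ysw CX C cE unfolding linked_def by blast
    then show ?thesis using YO linked_closed[OF UK[OF X]] by auto
  qed
  then show "insert c X - {d} \<in> K" "insert c X - {d} \<in> unblockedB \<delta>" "(X, insert c X - {d}) \<in> (linkedB \<delta>)\<^sup>*"
    unfolding Y_def by auto
qed

text \<open>A set in \<open>circ_covered \<delta> e\<close> can only be adjacent to a representative through a set in
  \<open>movable e\<close>. Preferring such representatives makes a blocked set arise from its blocker by
  exchanging a single element \<open>y\<close> for \<open>e\<close>, which is what \<open>decodeM\<close> with \<open>Some (e, y)\<close> undoes.\<close>

definition movable :: "'a \<Rightarrow> 'a set set" where
  "movable e = {A \<in> lvl E r. e \<notin> A \<and> (\<exists>C\<in>smallC \<delta>. e \<in> C \<and> C \<subseteq> insert e A \<and> (\<exists>c\<in>C. insert e A - {c} \<in> U))}"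

lemma movableE:
  assumes "A \<in> movable e"
  obtains C c X where "e \<notin> A" "C \<in> smallC \<delta>" "e \<in> C" "C \<subseteq> insert e A" "c \<in> C" "X = insert e A - {c}" "X \<in> U"
    "insert c X = insert e A" "c \<notin> X" "A \<in> lvl E r"
    "\<And>d. d \<in> C \<Longrightarrow> insert e A - {d} \<in> K \<and> insert e A - {d} \<in> unblockedB \<delta> \<and> (X, insert e A - {d}) \<in> (linkedB \<delta>)\<^sup>*"
proof -
  obtain C c where C: "e \<notin> A" "C \<in> smallC \<delta>" "e \<in> C" "C \<subseteq> insert e A" "c \<in> C" "insert e A - {c} \<in> U" "A \<in> lvl E r"
    using assms unfolding movable_def by auto
  define X where "X = insert e A - {c}"
  have i: "insert c X = insert e A" "c \<notin> X" unfolding X_def using C by auto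
  show ?thesis
  proof (rule that[OF C(1-5) X_def _ i C(7)])
    show "X \<in> U" using C X_def by simp
    fix d assume d: "d \<in> C"
    show "insert e A - {d} \<in> K \<and> insert e A - {d} \<in> unblockedB \<delta> \<and> (X, insert e A - {d}) \<in> (linkedB \<delta>)\<^sup>*"
      using small_circ_move[OF \<open>X \<in> U\<close> C(2) _ i(2) d] C(4) i(1) by simp
  qed
qed

lemma movable_props:
  assumes "A \<in> movable e"
  shows "A \<in> K" "A \<in> unblockedB \<delta>" "\<exists>X\<in>U. (X, A) \<in> (linkedB \<delta>)\<^sup>*"
proof -
  obtain C c X where *: "e \<notin> A" "e \<in> C" "X \<in> U"
    "\<And>d. d \<in> C \<Longrightarrow> insert e A - {d} \<in> K \<and> insert e A - {d} \<in> unblockedB \<delta> \<and> (X, insert e A - {d}) \<in> (linkedB \<delta>)\<^sup>*"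
    by (rule movableE[OF assms]) blast
  have "insert e A - {e} = A" using * by auto
  then show "A \<in> K" "A \<in> unblockedB \<delta>" "\<exists>X\<in>U. (X, A) \<in> (linkedB \<delta>)\<^sup>*" using *(4)[OF *(2)] *(3) by auto
qed

text \<open>Since \<open>C'\<close> avoids the new element \<open>z\<close>, it also lies in
  \<open>insert e A\<close>, so \<open>C = C'\<close> by uniqueness. Moving both sets to omit the
  same \<open>c\<close> keeps them adjacent and puts one of them into \<open>U\<close>, where
  adjacency is a link.\<close>

lemma movable_adj_aux:
  assumes A: "A \<in> movable e" and A': "A' \<in> movable e" and A'sw: "A' = swap A x z" "x \<in> A" "z \<notin> A"
    and C: "C \<in> smallC \<delta>" "e \<in> C" "C \<subseteq> insert e A" "c \<in> C" "insert e A - {c} \<in> U"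
    and C': "C' \<in> smallC \<delta>" "e \<in> C'" "C' \<subseteq> insert e A'" "c' \<in> C'" "insert e A' - {c'} \<in> U"
    and z: "z \<notin> C'"
  shows "(A, A') \<in> (linkedB \<delta>)\<^sup>*"
proof -
  have eA: "e \<notin> A" "e \<notin> A'" using A A' unfolding movable_def by auto
  have ze: "z \<noteq> e" "x \<noteq> e" using eA A'sw unfolding swap_def by auto
  define X where "X = insert e A - {c}"
  define X' where "X' = insert e A' - {c'}"
  have X: "X \<in> U" "insert c X = insert e A" "c \<notin> X" unfolding X_def using C by auto
  have X': "X' \<in> U" "insert c' X' = insert e A'" "c' \<notin> X'" unfolding X'_def using C' by auto
  have "C' \<subseteq> insert e A" using C' z A'sw unfolding swap_def by auto
  then have CC: "C = C'" using unique_small_circ[OF X(1,3) C(1) _ C'(1)] X(2) C(3) by simp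
  have "x \<notin> C'" using C'(3) A'sw ze unfolding swap_def by auto
  then have xc: "x \<noteq> c" "z \<noteq> c" using C CC z by auto
  have "c \<in> C'" using CC C by simp
  define Y where "Y = insert e A' - {c}"
  have Y: "Y \<in> K" "Y \<in> unblockedB \<delta>" "(X', Y) \<in> (linkedB \<delta>)\<^sup>*"
    using small_circ_move[OF X'(1) C'(1) _ X'(3) \<open>c \<in> C'\<close>] C'(3) X'(2) unfolding Y_def by simp_all
  have "Y = swap X x z" unfolding Y_def X_def A'sw(1) swap_def using ze xc A'sw by auto
  moreover have "x \<in> X" "z \<notin> X" unfolding X_def using A'sw xc ze by auto
  ultimately have "adj X Y" using adjI by metis
  then have "(X, Y) \<in> linkedB \<delta>" using U_adj_linked[OF X(1) Y(1,2)] by simp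
  moreover have "(X, A) \<in> (linkedB \<delta>)\<^sup>*"
    using small_circ_move(3)[OF X(1) C(1) _ X(3) C(2)] C(3) X(2) eA by simp
  moreover have "(X', A') \<in> (linkedB \<delta>)\<^sup>*"
    using small_circ_move(3)[OF X'(1) C'(1) _ X'(3) C'(2)] C'(3) X'(2) eA by simp
  ultimately show ?thesis using Y(3) sym_linkeds by (meson r_into_rtrancl rtrancl_trans)
qed

lemma movable_adj:
  assumes A: "A \<in> movable e" and A': "A' \<in> movable e" and "adj A A'"
  shows "(A, A') \<in> (linkedB \<delta>)\<^sup>*"
proof -
  obtain C c X where C: "e \<notin> A" "C \<in> smallC \<delta>" "e \<in> C" "C \<subseteq> insert e A" "c \<in> C" "X = insert e A - {c}" "X \<in> U"
    "insert c X = insert e A" "c \<notin> X" "A \<in> lvl E r"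
    "\<And>d. d \<in> C \<Longrightarrow> insert e A - {d} \<in> K \<and> insert e A - {d} \<in> unblockedB \<delta> \<and> (X, insert e A - {d}) \<in> (linkedB \<delta>)\<^sup>*"
    by (rule movableE[OF A]) blast
  obtain C' c' X' where C': "e \<notin> A'" "C' \<in> smallC \<delta>" "e \<in> C'" "C' \<subseteq> insert e A'" "c' \<in> C'" "X' = insert e A' - {c'}" "X' \<in> U"
    "insert c' X' = insert e A'" "c' \<notin> X'" "A' \<in> lvl E r"
    "\<And>d. d \<in> C' \<Longrightarrow> insert e A' - {d} \<in> K \<and> insert e A' - {d} \<in> unblockedB \<delta> \<and> (X', insert e A' - {d}) \<in> (linkedB \<delta>)\<^sup>*"
    by (rule movableE[OF A']) blast
  obtain x z where xz: "x \<in> A" "z \<notin> A" "A' = swap A x z" using assms(3) unfolding adj_def by auto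
  have inv: "A = swap A' z x" "z \<in> A'" "x \<notin> A'" using xz unfolding swap_def by auto
  consider "z \<notin> C'" | "x \<notin> C" | "z \<in> C'" "x \<in> C" by auto
  then show ?thesis
  proof cases
    case 1
    show ?thesis by (rule movable_adj_aux[OF A A' xz(3,1,2) C(2-5) _ C'(2-5) _ 1]) (use C C' in auto)
  next
    case 2
    have "(A', A) \<in> (linkedB \<delta>)\<^sup>*" by (rule movable_adj_aux[OF A' A inv C'(2-5) _ C(2-5) _ 2]) (use C C' in auto)
    then show ?thesis by (rule sym_linkeds)
  \<comment> \<open>Here the two circuits allow \<open>x\<close> to be omitted on one side and
    \<open>z\<close> on the other, and both moves lead to the same set.\<close>
  next
    case 3
    have "x \<noteq> e" "z \<noteq> e" using xz(1) inv(2) C(1) C'(1) by auto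
    then have "insert e A - {x} = insert e A' - {z}" unfolding xz(3) swap_def using xz(1,2) by auto
    then have "(X, insert e A - {x}) \<in> (linkedB \<delta>)\<^sup>*" "(X', insert e A - {x}) \<in> (linkedB \<delta>)\<^sup>*"
      using C(11)[OF 3(2)] C'(11)[OF 3(1)] by auto
    moreover have "(X, A) \<in> (linkedB \<delta>)\<^sup>*" "(X', A') \<in> (linkedB \<delta>)\<^sup>*"
      using C(11)[OF C(3)] C'(11)[OF C'(3)] C(1) C'(1) by auto
    ultimately show ?thesis using sym_linkeds by (meson rtrancl_trans)
  qed
qed

end

section \<open>Encoding by stable sets\<close>

definition stable_sets :: "'a set \<Rightarrow> nat \<Rightarrow> 'a set set set" where
  "stable_sets E r = {V. V \<subseteq> lvl E r \<and> stable V}"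

definition decodeM :: "'a set \<Rightarrow> nat \<Rightarrow> 'a set set \<times> 'a set set \<times> 'a set set \<times> 'a set set \<times> 'a set set \<Rightarrow>
    ('a \<times> 'a) option \<Rightarrow> 'a set set \<Rightarrow> 'a set set" where
  "decodeM E r = (\<lambda>(Z1, Z2, Z3, \<C>, \<D>) m V. decode E r (Z1, Z2, Z3, \<C>, \<D>)
     (case m of None \<Rightarrow> V
      | Some (e, y) \<Rightarrow> (V \<inter> unblocked E r \<C> \<D>) \<union> (\<lambda>X. swap X e y) ` (V - unblocked E r \<C> \<D>)))"

text \<open>The choice \<open>f X\<close> depends only on the class of \<open>X\<close>, and it lies
  in \<open>W1\<close> whenever the class meets \<open>W1\<close>. The last clause records this
  preference.\<close>

lemma exists_reps:
  assumes "sym R" "refl R" "trans R" "W1 \<subseteq> W"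
  shows "\<exists>Rep\<subseteq>W. (\<forall>X\<in>W. \<exists>v\<in>Rep. (v, X) \<in> R) \<and> (\<forall>v\<in>Rep. \<forall>w\<in>Rep. (v, w) \<in> R \<longrightarrow> v = w) \<and>
    (\<forall>v\<in>Rep - W1. \<forall>w\<in>W1. (v, w) \<notin> R)"
proof -
  define g where "g = (\<lambda>X. if R `` {X} \<inter> W1 \<noteq> {} then R `` {X} \<inter> W1 else R `` {X} \<inter> W)"
  define f where "f = (\<lambda>X. SOME v. v \<in> g X)"
  have ne: "f X \<in> g X" if "X \<in> W" for X
  proof -
    have "X \<in> R `` {X} \<inter> W" using that assms(2) unfolding refl_on_def by auto
    then have "g X \<noteq> {}" unfolding g_def by auto
    then show ?thesis unfolding f_def by (simp add: some_in_eq)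
  qed
  have gW: "g X \<subseteq> R `` {X} \<inter> W" for X unfolding g_def using assms(4) by auto
  have fR: "(X, f X) \<in> R" "f X \<in> W" if "X \<in> W" for X using ne[OF that] gW[of X] by auto
  have eqR: "R `` {X} = R `` {Y}" if "(X, Y) \<in> R" for X Y
    using that assms(1,3) unfolding sym_def trans_def by blast
  have eqf: "f X = f Y" if "(X, Y) \<in> R" for X Y unfolding f_def g_def eqR[OF that] ..
  have symR: "(Y, X) \<in> R" if "(X, Y) \<in> R" for X Y using that assms(1) unfolding sym_def by auto
  show ?thesis
  proof (intro exI[of _ "f ` W"] conjI ballI impI)
    show "f ` W \<subseteq> W" using fR by auto
    fix X assume "X \<in> W"
    then show "\<exists>v\<in>f ` W. (v, X) \<in> R" using fR symR by blast
  next
    fix v w assume "v \<in> f ` W" "w \<in> f ` W" and vw: "(v, w) \<in> R"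
    then obtain X Y where XY: "X \<in> W" "v = f X" "Y \<in> W" "w = f Y" by auto
    have "f X = f (f X)" "f Y = f (f Y)" using eqf fR XY by auto
    then show "v = w" using eqf[OF vw] XY by simp
  next
    fix v w assume "v \<in> f ` W - W1" and w: "w \<in> W1"
    then obtain X where X: "X \<in> W" "v = f X" "v \<notin> W1" by auto
    show "(v, w) \<notin> R"
    proof
      assume "(v, w) \<in> R"
      then have "w \<in> R `` {X}" using eqR[OF fR(1)[OF X(1)]] X by auto
      then have "g X \<subseteq> W1" using w unfolding g_def by auto
      then show False using ne[OF X(1)] X by auto
    qed
  qed
qed

lemma pigeonhole_mult:
  assumes "finite I" "finite A" "\<And>a. a \<in> A \<Longrightarrow> h a \<in> I" "I \<noteq> {}"
  shows "\<exists>i\<in>I. card A \<le> card I * card {a \<in> A. h a = i}"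
proof (rule ccontr)
  assume "\<not> ?thesis"
  then have lt: "card I * card {a \<in> A. h a = i} < card A" if "i \<in> I" for i using that by (meson not_le)
  have "card A = (\<Sum>i\<in>I. card {a \<in> A. h a = i})"
  proof -
    have "A = (\<Union>i\<in>I. {a \<in> A. h a = i})" using assms(3) by auto
    then have "card A = card (\<Union>i\<in>I. {a \<in> A. h a = i})" by simp
    also have "\<dots> = (\<Sum>i\<in>I. card {a \<in> A. h a = i})" using assms by (intro card_UN_disjoint) auto
    finally show ?thesis .
  qed
  then have "card I * card A = (\<Sum>i\<in>I. card I * card {a \<in> A. h a = i})" by (simp add: sum_distrib_left)
  also have "\<dots> < (\<Sum>i\<in>I. card A)" using lt assms by (intro sum_strict_mono) auto
  finally show False by simp
qed

lemma stable_subset: "stable V \<Longrightarrow> W \<subseteq> V \<Longrightarrow> stable W"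
  unfolding stable_def by auto

lemma adj_irrefl: "\<not> adj X X"
  unfolding adj_def swap_def by auto

text \<open>Two distinct neighbours of \<open>B\<close> that lose the same element of
  \<open>B\<close> are adjacent to each other, so the lost element determines the neighbour within a
  stable set.\<close>

lemma stable_nbrs:
  assumes "stable V" "finite B"
  shows "card {v \<in> V. adj B v} \<le> card B"
proof -
  have "\<exists>x y. x \<in> B \<and> y \<notin> B \<and> v = swap B x y" if "adj B v" for v using that unfolding adj_def by auto
  then obtain f g where fg: "\<And>v. adj B v \<Longrightarrow> f v \<in> B \<and> g v \<notin> B \<and> v = swap B (f v) (g v)" by metis
  have "inj_on f {v \<in> V. adj B v}"
  proof (rule inj_onI, rule ccontr)
    fix v w assume v: "v \<in> {v \<in> V. adj B v}" and w: "w \<in> {v \<in> V. adj B v}" and e: "f v = f w" and ne: "v \<noteq> w"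
    have fv: "f v \<in> B" "g v \<notin> B" "v = swap B (f v) (g v)" and fw: "g w \<notin> B" "w = swap B (f v) (g w)"
      using fg[of v] fg[of w] v w e by auto
    have "g v \<noteq> g w" using ne fv fw by auto
    then have "adj (swap B (f v) (g v)) (swap B (f v) (g w))"
      using fv(1,2) fw(1) adjI[of "g v" "swap B (f v) (g v)" "g w"] unfolding swap_def by (auto simp: insert_absorb)
    then have "adj v w" using fv(3) fw(2) by simp
    then show False using assms(1) v w unfolding stable_def by blast
  qed
  then show ?thesis by (rule card_inj_on_le) (use fg assms in auto)
qed

section \<open>Stable sets that decode to a given matroid\<close>

context coded_system
begin

abbreviation "code \<equiv> (Z1, Z2, Z3, smallC \<delta>, smallD \<delta>)"
abbreviation "R \<equiv> (linkedB \<delta>)\<^sup>*"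

lemma equivR: "sym R" "refl R" "trans R"
  using sym_rtrancl[OF sym_linked] refl_rtrancl trans_rtrancl by auto

lemma finU: "finite U" using finK unfolding U_def by auto

lemma decode_eq:
  assumes "V \<inter> unblockedB \<delta> \<subseteq> K" "\<And>X. X \<in> U \<Longrightarrow> \<exists>v\<in>V \<inter> unblockedB \<delta>. (v, X) \<in> R"
  shows "decode E r code V = K"
proof
  show "decode E r code V \<subseteq> K"
    unfolding decode_def using cover_K K_compl_unblocked linkeds_closed assms(1) by auto
  show "K \<subseteq> decode E r code V"
  proof
    fix X assume X: "X \<in> K"
    then show "X \<in> decode E r code V"
    proof (cases "X \<in> U")
      case True
      then show ?thesis using assms(2) unfolding decode_def by auto
    next
      case False
      then show ?thesis using X K_lvl[OF X] unfolding decode_def U_def by auto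
    qed
  qed
qed

text \<open>Count adjacent pairs of a member of \<open>V\<close> and a basis: each \<open>v\<close>
  has at least \<open>n^2 / 5\<close> basis neighbours, and by \<open>stable_nbrs\<close> each basis
  has at most \<open>n\<close> neighbours in \<open>V\<close>.\<close>

lemma card_stable_U:
  assumes "V \<subseteq> U" "stable V"
  shows "card V * card E \<le> 5 * card \<B>"
proof -
  have finV: "finite V" using assms finU finite_subset by auto
  have "card V * card E ^ 2 = (\<Sum>v\<in>V. card E ^ 2)" by simp
  also have "\<dots> \<le> (\<Sum>v\<in>V. 5 * card {B \<in> \<B>. adj v B})"
    using U_PQ(3) assms(1) card_basis_nbrs UK by (intro sum_mono) auto
  also have "\<dots> = 5 * (\<Sum>v\<in>V. \<Sum>B\<in>\<B>. if adj v B then 1 else 0)"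
    using finK by (simp add: sum_distrib_left[symmetric] sum.If_cases Int_def)
  also have "\<dots> = 5 * (\<Sum>B\<in>\<B>. \<Sum>v\<in>V. if adj v B then 1 else 0)" by (subst sum.swap) simp
  also have "\<dots> = 5 * (\<Sum>B\<in>\<B>. card {v \<in> V. adj v B})"
    using finV by (simp add: sum.If_cases Int_def)
  also have "\<dots> \<le> 5 * (\<Sum>B\<in>\<B>. card E)"
  proof (intro mult_le_mono2 sum_mono)
    fix B assume B: "B \<in> \<B>"
    have "{v \<in> V. adj v B} = {v \<in> V. adj B v}" using adj_sym by blast
    then have "card {v \<in> V. adj v B} \<le> card B" using stable_nbrs[OF assms(2) basis_fin[OF B]] by simp
    also have "\<dots> \<le> card E" using basis_sub[OF B] finE by (intro card_mono) auto
    finally show "card {v \<in> V. adj v B} \<le> card E" .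
  qed
  finally have "card V * card E * card E \<le> 5 * card \<B> * card E" by (simp add: power2_eq_square mult.assoc)
  moreover have "0 < card E" using rho by auto
  ultimately show ?thesis by simp
qed

lemma reps_stable:
  assumes "Rep \<subseteq> U \<union> movable e" "\<forall>v\<in>Rep. \<forall>w\<in>Rep. (v, w) \<in> R \<longrightarrow> v = w"
  shows "stable Rep"
  unfolding stable_def
proof (intro ballI notI)
  fix v w assume v: "v \<in> Rep" and w: "w \<in> Rep" and a: "adj v w"
  have KO: "v \<in> K" "v \<in> unblockedB \<delta>" "w \<in> K" "w \<in> unblockedB \<delta>" using assms(1) v w UK UO movable_props by auto
  consider "v \<in> U" | "w \<in> U" | "v \<in> movable e" "w \<in> movable e" using v w assms(1) by auto
  then have "(v, w) \<in> R"
  proof cases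
    case 1 then show ?thesis using U_adj_linked[OF 1 KO(3,4) a] by auto
  next
    case 2
    have "(w, v) \<in> R" using U_adj_linked[OF 2 KO(1,2) adj_sym[OF a]] by (rule r_into_rtrancl)
    then show ?thesis by (rule sym_linkeds)
  next
    case 3 then show ?thesis using movable_adj a by blast
  qed
  then have "v = w" using assms(2) v w by auto
  then show False using a adj_irrefl by auto
qed

lemma U_reps: "\<exists>Rep\<subseteq>U. (\<forall>X\<in>U. \<exists>v\<in>Rep. (v, X) \<in> R) \<and> (\<forall>v\<in>Rep. \<forall>w\<in>Rep. (v, w) \<in> R \<longrightarrow> v = w) \<and> stable Rep"
proof -
  obtain Rep where "Rep \<subseteq> U" "\<forall>X\<in>U. \<exists>v\<in>Rep. (v, X) \<in> R" "\<forall>v\<in>Rep. \<forall>w\<in>Rep. (v, w) \<in> R \<longrightarrow> v = w"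
    using exists_reps[OF equivR, of "{}" U] by auto
  moreover from this have "stable Rep" by (intro reps_stable[of Rep undefined]) auto
  ultimately show ?thesis by blast
qed

lemma encode_small: "\<exists>V\<in>stable_sets E r. card V * card E \<le> 5 * card \<B> \<and> decode E r code V = K"
proof -
  obtain Rep where Rep: "Rep \<subseteq> U" "\<forall>X\<in>U. \<exists>v\<in>Rep. (v, X) \<in> R" "stable Rep" using U_reps by blast
  have "Rep \<in> stable_sets E r" using Rep UK K_lvl unfolding stable_sets_def by auto
  moreover have "decode E r code Rep = K" using Rep UK UO by (intro decode_eq) blast+
  ultimately show ?thesis using card_stable_U Rep by auto
qed

text \<open>Any set \<open>S\<close> of unblocked nonbases within one colour class, completed by the representatives of
  the components that \<open>S\<close> misses, is again stable and decodes to the same matroid.\<close>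

lemma encode_many:
  assumes g: "g * card E ^ 2 + 5 * card \<B> \<le> card (K \<inter> unblockedB \<delta>) * card E"
    and col: "\<And>X. X \<in> lvl E r \<Longrightarrow> col X < card E" "\<And>X Y. X \<in> lvl E r \<Longrightarrow> Y \<in> lvl E r \<Longrightarrow> adj X Y \<Longrightarrow> col X \<noteq> col Y"
  shows "\<exists>\<F>\<subseteq>stable_sets E r. 2 ^ g \<le> card \<F> \<and> (\<forall>V\<in>\<F>. decode E r code V = K)"
proof -
  obtain Rep where Rep: "Rep \<subseteq> U" "\<forall>X\<in>U. \<exists>v\<in>Rep. (v, X) \<in> R" "\<forall>v\<in>Rep. \<forall>w\<in>Rep. (v, w) \<in> R \<longrightarrow> v = w" "stable Rep"
    using U_reps by blast
  have finR: "finite Rep" by (rule finite_subset[OF Rep(1) finU])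
  have n0: "0 < card E" using rho(3) by linarith
  define A where "A = K \<inter> unblockedB \<delta> - Rep"
  have "\<exists>i\<in>{..<card E}. card A \<le> card {..<card E} * card {a \<in> A. col a = i}"
  proof (rule pigeonhole_mult)
    show "finite A" unfolding A_def using finK by auto
  qed (use n0 col(1) K_lvl in \<open>auto simp: A_def\<close>)
  then obtain i where i: "card A \<le> card E * card {a \<in> A. col a = i}" by auto
  define T where "T = {X \<in> lvl E r. col X = i}"
  have T: "stable T" unfolding T_def stable_def using col(2) by blast
  define S0 where "S0 = {a \<in> A. col a = i}"
  have S0T: "S0 \<subseteq> T" "S0 \<subseteq> K \<inter> unblockedB \<delta>" "S0 \<inter> Rep = {}" unfolding S0_def T_def A_def using K_lvl by auto
  \<comment> \<open>The set \<open>S\<close> must be disjoint from \<open>Rep\<close> to be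
    recoverable from \<open>F S\<close>. Removing \<open>Rep\<close> costs little by
    \<open>card_stable_U\<close>, whence the term \<open>5 * card \<B>\<close> in the
    hypothesis.\<close>
  have "card (K \<inter> unblockedB \<delta>) - card Rep \<le> card A" unfolding A_def using finR by (rule diff_card_le_card_Diff)
  then have "card (K \<inter> unblockedB \<delta>) \<le> card E * card S0 + card Rep" using i unfolding S0_def by linarith
  then have "card (K \<inter> unblockedB \<delta>) * card E \<le> (card E * card S0 + card Rep) * card E" by (rule mult_le_mono1)
  then have "g * card E ^ 2 \<le> card S0 * card E ^ 2"
  proof -
    assume h: "card (K \<inter> unblockedB \<delta>) * card E \<le> (card E * card S0 + card Rep) * card E"
    have "(card E * card S0 + card Rep) * card E = card S0 * card E ^ 2 + card Rep * card E"
      by (simp add: power2_eq_square algebra_simps)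
    then show ?thesis using h g card_stable_U[OF Rep(1,4)] by linarith
  qed
  moreover have "0 < card E ^ 2" using n0 by simp
  ultimately have gS: "g \<le> card S0" by simp
  define F where "F = (\<lambda>S. S \<union> {v \<in> Rep. \<forall>s\<in>S. (s, v) \<notin> R})"
  have inj: "inj_on F (Pow S0)"
  proof (rule inj_onI)
    fix S S' assume "S \<in> Pow S0" "S' \<in> Pow S0" and e: "F S = F S'"
    then have "S = F S - Rep" "S' = F S' - Rep" using S0T(3) unfolding F_def by auto
    then show "S = S'" using e by simp
  qed
  have finS0: "finite S0" using finite_subset[OF S0T(2)] finK by auto
  have "card (F ` Pow S0) = 2 ^ card S0" using card_image[OF inj] card_Pow[OF finS0] by simp
  then have c: "2 ^ g \<le> card (F ` Pow S0)" using gS by simp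
  have "F S \<in> stable_sets E r \<and> decode E r code (F S) = K" if S: "S \<subseteq> S0" for S
  proof
    have SK: "S \<subseteq> K \<inter> unblockedB \<delta>" "S \<subseteq> T" using S S0T by auto
    have FK: "F S \<subseteq> K \<inter> unblockedB \<delta>" using SK Rep UK UO unfolding F_def by auto
    have sv: "\<not> adj s v" if "s \<in> S" "v \<in> Rep" "(s, v) \<notin> R" for s v
    proof
      assume "adj s v"
      then have "(v, s) \<in> linkedB \<delta>" using U_adj_linked[of v s] SK Rep that adj_sym by blast
      then have "(s, v) \<in> R" by (rule sym_linkeds[OF r_into_rtrancl])
      then show False using that by blast
    qed
    have sv': "\<not> adj v s" if "s \<in> S" "v \<in> Rep" "(s, v) \<notin> R" for s v using sv[OF that] adj_sym by auto
    have "stable (F S)"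
      unfolding stable_def F_def using sv sv' Rep(4) stable_subset[OF T SK(2)] unfolding stable_def by blast
    then show "F S \<in> stable_sets E r" using FK K_lvl unfolding stable_sets_def by auto
    show "decode E r code (F S) = K"
    proof (rule decode_eq)
      show "F S \<inter> unblockedB \<delta> \<subseteq> K" using FK by auto
      fix X assume "X \<in> U"
      then obtain v where v: "v \<in> Rep" "(v, X) \<in> R" using Rep by auto
      show "\<exists>v\<in>F S \<inter> unblockedB \<delta>. (v, X) \<in> R"
      proof (cases "\<exists>s\<in>S. (s, v) \<in> R")
        case True
        then obtain s where s: "s \<in> S" "(s, v) \<in> R" by auto
        then have "(s, X) \<in> R" using v by (meson rtrancl_trans)
        then show ?thesis using s SK unfolding F_def by auto
      next
        case False
        then have "v \<in> F S" using v unfolding F_def by auto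
        then show ?thesis using v FK by auto
      qed
    qed
  qed
  then show ?thesis using c by (intro exI[of _ "F ` Pow S0"]) auto
qed

text \<open>Either half of these blocked sets have no neighbour in \<open>Rep\<close>; then any
  subset of one of their colour classes may be added, to be ignored by \<open>decode\<close>. Or
  half have a neighbour in \<open>Rep\<close> and arise from it by exchanging some \<open>y\<close>
  for \<open>e\<close>; for the most frequent \<open>y\<close>, any subset of the representatives
  concerned may be replaced by its images, which are recognisable because they are blocked.\<close>

lemma encode_circ_covered:
  assumes g: "2 * card E * g \<le> card (circ_covered \<delta> e)" and e: "e \<in> E"
    and col: "\<And>X. X \<in> lvl E r \<Longrightarrow> col X < card E" "\<And>X Y. X \<in> lvl E r \<Longrightarrow> Y \<in> lvl E r \<Longrightarrow> adj X Y \<Longrightarrow> col X \<noteq> col Y"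
  shows "\<exists>m \<F>. (m = None \<or> m \<in> Some ` (E \<times> E)) \<and> \<F> \<subseteq> stable_sets E r \<and> 2 ^ g \<le> card \<F> \<and> (\<forall>V\<in>\<F>. decodeM E r code m V = K)"
proof -
  obtain Rep where Rep: "Rep \<subseteq> U \<union> movable e" "\<forall>X\<in>U \<union> movable e. \<exists>v\<in>Rep. (v, X) \<in> R"
    "\<forall>v\<in>Rep. \<forall>w\<in>Rep. (v, w) \<in> R \<longrightarrow> v = w" "\<forall>v\<in>Rep - movable e. \<forall>w\<in>movable e. (v, w) \<notin> R"
    using exists_reps[OF equivR, of "movable e" "U \<union> movable e"] by auto
  have stab: "stable Rep" using reps_stable[OF Rep(1,3)] .
  have RK: "Rep \<subseteq> K" "Rep \<subseteq> unblockedB \<delta>" using Rep(1) UK UO movable_props by auto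
  have finRe: "finite (circ_covered \<delta> e)" unfolding circ_covered_def using finite_lvl[OF finE] by auto
  have n0: "0 < card E" using rho by auto
  have dec: "decode E r code V = K" if "V \<inter> unblockedB \<delta> = Rep" for V
    using Rep RK that by (intro decode_eq) auto
  \<comment> \<open>If the exchange removed another element \<open>c\<close> than \<open>e\<close>,
    then \<open>c\<close> lies in \<open>C\<close>, and \<open>v + c - e\<close> would be a movable
    set in the class of \<open>v\<close>. The class would then be represented in
    \<open>movable e\<close>, but \<open>v\<close> contains \<open>e\<close>.\<close>
  have blocked: "e \<notin> v \<and> (\<exists>z\<in>E - X. v = swap X e z)" if X: "X \<in> circ_covered \<delta> e" and v: "v \<in> Rep" and a: "adj X v" for X v
  proof -
    obtain C where C: "C \<in> smallC \<delta>" "e \<in> C" "C \<subseteq> X" and Xl: "X \<in> lvl E r" using X unfolding circ_covered_def by auto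
    have vl: "v \<in> lvl E r" using RK v K_lvl by auto
    obtain c z where cz: "c \<in> X" "z \<in> E - X" "v = swap X c z" using adj_lvlE[OF a Xl vl] .
    have "\<not> C \<subseteq> v" using RK v C unfolding unblocked_def by auto
    then have cC: "c \<in> C" using C cz unfolding swap_def by auto
    show ?thesis
    proof (cases "c = e")
      case True
      then show ?thesis using cz unfolding swap_def by auto
    next
      case False
      have "e \<in> v" using C False cz unfolding swap_def by auto
      then have "v \<notin> movable e" unfolding movable_def by auto
      then have vU: "v \<in> U" using v Rep by auto
      define A where "A = insert c v - {e}"
      have iA: "insert e A = insert c v" "insert e A - {c} = v" unfolding A_def using \<open>e \<in> v\<close> cz False unfolding swap_def by auto
      have cv: "c \<notin> v" using cz unfolding swap_def by auto
      have Cv: "C \<subseteq> insert c v" using C cz unfolding swap_def by auto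
      have A: "A \<in> K" "(v, A) \<in> R" using small_circ_move[OF vU C(1) Cv cv C(2)] unfolding A_def by auto
      have "insert e A - {c} \<in> U" using iA vU by simp
      moreover have "C \<subseteq> insert e A" using iA(1) Cv by simp
      moreover have "e \<notin> A" unfolding A_def by simp
      ultimately have "A \<in> movable e" unfolding movable_def using K_lvl[OF A(1)] C(1,2) cC by blast
      then show ?thesis using Rep(4) v \<open>v \<notin> movable e\<close> A(2) by blast
    qed
  qed
  define Fr where "Fr = {X \<in> circ_covered \<delta> e. \<forall>v\<in>Rep. \<not> adj X v}"
  have "circ_covered \<delta> e = Fr \<union> (circ_covered \<delta> e - Fr)" unfolding Fr_def by auto
  then have "card (circ_covered \<delta> e) \<le> card Fr + card (circ_covered \<delta> e - Fr)" by (metis card_Un_le)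
  then consider "card E * g \<le> card Fr" | "card E * g \<le> card (circ_covered \<delta> e - Fr)" using g by linarith
  then show ?thesis
  proof cases
    case 1
    have "\<exists>i\<in>{..<card E}. card Fr \<le> card {..<card E} * card {a \<in> Fr. col a = i}"
    proof (rule pigeonhole_mult)
      show "finite Fr" unfolding Fr_def using finRe by simp
    qed (use n0 col(1) in \<open>auto simp: Fr_def circ_covered_def\<close>)
    then obtain i where i: "card Fr \<le> card E * card {a \<in> Fr. col a = i}" by auto
    define S0 where "S0 = {a \<in> Fr. col a = i}"
    have "card E * g \<le> card E * card S0" using i 1 unfolding S0_def by linarith
    then have gS: "g \<le> card S0" using n0 by simp
    have S0: "S0 \<subseteq> circ_covered \<delta> e" "S0 \<subseteq> Fr" unfolding S0_def Fr_def by auto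
    have finS0: "finite S0" using S0 finRe finite_subset by auto
    have "S0 \<subseteq> lvl E r" using S0(1) unfolding circ_covered_def by auto
    then have stS: "stable S0" unfolding stable_def using col(2) unfolding S0_def by blast
    have disj: "S0 \<inter> Rep = {}" using S0 RK circ_covered_unblocked by blast
    have inj: "inj_on (\<lambda>S. S \<union> Rep) (Pow S0)" using disj by (intro inj_onI) blast
    have "card ((\<lambda>S. S \<union> Rep) ` Pow S0) = 2 ^ card S0" using card_image[OF inj] card_Pow[OF finS0] by simp
    then have c: "2 ^ g \<le> card ((\<lambda>S. S \<union> Rep) ` Pow S0)" using gS by simp
    have "S \<union> Rep \<in> stable_sets E r \<and> decodeM E r code None (S \<union> Rep) = K" if S: "S \<subseteq> S0" for S
    proof
      have na: "\<not> adj s v" "\<not> adj v s" if "s \<in> S" "v \<in> Rep" for s v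
        using that S S0(2) adj_sym unfolding Fr_def by blast+
      have "stable (S \<union> Rep)" using stab stable_subset[OF stS S] na unfolding stable_def by blast
      moreover have "S \<union> Rep \<subseteq> lvl E r" using S S0(1) RK K_lvl unfolding circ_covered_def by auto
      ultimately show "S \<union> Rep \<in> stable_sets E r" unfolding stable_sets_def by auto
      have "(S \<union> Rep) \<inter> unblockedB \<delta> = Rep" using S S0(1) circ_covered_unblocked RK by blast
      then show "decodeM E r code None (S \<union> Rep) = K" unfolding decodeM_def using dec by simp
    qed
    then show ?thesis using c by (intro exI[of _ None] exI[of _ "(\<lambda>S. S \<union> Rep) ` Pow S0"]) auto
  next
    case 2
    define M where "M = (\<lambda>y. {v \<in> Rep. e \<notin> v \<and> y \<in> v \<and> swap v y e \<in> circ_covered \<delta> e})"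
    have finM: "finite (M y)" for y by (rule finite_subset[OF _ finK(1)]) (use RK in \<open>auto simp: M_def\<close>)
    have "circ_covered \<delta> e - Fr \<subseteq> (\<Union>y\<in>E. (\<lambda>v. swap v y e) ` M y)"
    proof
      fix X assume X: "X \<in> circ_covered \<delta> e - Fr"
      then obtain v where v: "v \<in> Rep" "adj X v" unfolding Fr_def by auto
      then obtain z where z: "e \<notin> v" "z \<in> E - X" "v = swap X e z" using blocked X by blast
      have "e \<in> X" using X unfolding circ_covered_def by auto
      then have Xe: "X = swap v z e" using z unfolding swap_def by auto
      have "z \<in> v" using z(3) unfolding swap_def by simp
      then have "v \<in> M z" unfolding M_def using v(1) z(1) X Xe by simp
      then show "X \<in> (\<Union>y\<in>E. (\<lambda>v. swap v y e) ` M y)" using Xe z(2) by blast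
    qed
    then have "card (circ_covered \<delta> e - Fr) \<le> card (\<Union>y\<in>E. (\<lambda>v. swap v y e) ` M y)" using finE finM by (intro card_mono) auto
    also have "\<dots> \<le> (\<Sum>y\<in>E. card ((\<lambda>v. swap v y e) ` M y))" using finE by (rule card_UN_le)
    also have "\<dots> \<le> (\<Sum>y\<in>E. card (M y))" using finM by (intro sum_mono card_image_le)
    finally have le: "card E * g \<le> (\<Sum>y\<in>E. card (M y))" using 2 by linarith
    have "\<exists>y\<in>E. g \<le> card (M y)"
    proof (rule ccontr)
      assume "\<not> ?thesis"
      then have "(\<Sum>y\<in>E. card (M y)) < (\<Sum>y\<in>E. g)" using finE e by (intro sum_strict_mono) auto
      then show False using le by simp
    qed
    then obtain y where y: "y \<in> E" "g \<le> card (M y)" by auto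
    define F where "F = (\<lambda>\<X>. (\<lambda>v. swap v y e) ` \<X> \<union> (Rep - \<X>))"
    have inv: "swap (swap v y e) e y = v" if "v \<in> M y" for v using that unfolding M_def by (intro swap_inv) auto
    have out: "F \<X> - unblockedB \<delta> = (\<lambda>v. swap v y e) ` \<X>" "F \<X> \<inter> unblockedB \<delta> = Rep - \<X>" if "\<X> \<subseteq> M y" for \<X>
      using that RK circ_covered_unblocked[of \<delta> e] unfolding F_def M_def by blast+
    have undo: "(\<lambda>X. swap X e y) ` (F \<X> - unblockedB \<delta>) = \<X>" if s: "\<X> \<subseteq> M y" for \<X>
    proof -
      have "(\<lambda>X. swap X e y) ` (F \<X> - unblockedB \<delta>) = (\<lambda>v. swap (swap v y e) e y) ` \<X>" unfolding out(1)[OF s] by (simp add: image_image)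
      also have "\<dots> = (\<lambda>v. v) ` \<X>" using s inv by (intro image_cong) auto
      finally show ?thesis by simp
    qed
    have inj: "inj_on F (Pow (M y))" using undo by (intro inj_onI) (metis PowD)
    have "card (F ` Pow (M y)) = 2 ^ card (M y)" using card_image[OF inj] card_Pow[OF finM] by simp
    then have c: "2 ^ g \<le> card (F ` Pow (M y))" using y by simp
    have "F \<X> \<in> stable_sets E r \<and> decodeM E r code (Some (e, y)) (F \<X>) = K" if s: "\<X> \<subseteq> M y" for \<X>
    proof
      have XR: "\<X> \<subseteq> Rep" using s unfolding M_def by auto
      have mv: "swap v y e \<in> circ_covered \<delta> e" "e \<notin> v" "y \<in> v" if "v \<in> \<X>" for v using that s unfolding M_def by auto
      \<comment> \<open>By \<open>blocked\<close>, such a neighbour arises by removing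
        \<open>e\<close> again, so it has the form \<open>v - y + z\<close> and would be adjacent to
        the representative \<open>v\<close> itself.\<close>
      have na: "\<not> adj (swap v y e) w" if v: "v \<in> \<X>" and w: "w \<in> Rep - \<X>" for v w
      proof
        assume a: "adj (swap v y e) w"
        obtain z where z: "e \<notin> w" "z \<in> E - swap v y e" "w = swap (swap v y e) e z"
          using blocked[OF mv(1)[OF v] _ a] w by auto
        have ws: "w = swap v y z" using z mv[OF v] unfolding swap_def by auto
        have "z \<noteq> y"
        proof
          assume "z = y"
          then have "w = v" using ws mv[OF v] unfolding swap_def by auto
          then show False using v w by auto
        qed
        then have "z \<notin> v" using z unfolding swap_def by auto
        then have "adj v w" using ws adjI mv[OF v] by metis
        then show False using stab XR v w unfolding stable_def by auto
      qed
      have nb: "\<not> adj (swap v y e) (swap w y e)" if v: "v \<in> \<X>" and w: "w \<in> \<X>" for v w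
      proof
        assume "adj (swap v y e) (swap w y e)"
        then obtain a b where ab: "a \<in> swap v y e" "b \<notin> swap v y e" "swap w y e = swap (swap v y e) a b"
          unfolding adj_def by auto
        have ey: "e \<noteq> y" using mv[OF v] by auto
        have "e \<in> swap w y e" unfolding swap_def by auto
        then have ae: "a \<noteq> e" using ab unfolding swap_def by auto
        have "y \<notin> swap w y e" using ey unfolding swap_def by auto
        then have by': "b \<noteq> y" using ab unfolding swap_def by auto
        have "w = swap (swap w y e) e y" using mv[OF w] by (metis swap_inv)
        also have "\<dots> = swap (swap (swap v y e) a b) e y" using ab by simp
        also have "\<dots> = swap v a b" using ab ae by' ey mv[OF v] unfolding swap_def by auto
        finally have "w = swap v a b" .
        moreover have "a \<in> v" "b \<notin> v" using ab ae by' unfolding swap_def by auto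
        ultimately have "adj v w" using adjI by metis
        then show False using stab XR v w unfolding stable_def by auto
      qed
      have "stable (F \<X>)" unfolding stable_def F_def
        using na nb adj_sym stab unfolding stable_def by blast
      moreover have "F \<X> \<subseteq> lvl E r" using mv RK K_lvl unfolding F_def circ_covered_def by auto
      ultimately show "F \<X> \<in> stable_sets E r" unfolding stable_sets_def by auto
      have "(F \<X> \<inter> unblockedB \<delta>) \<union> (\<lambda>X. swap X e y) ` (F \<X> - unblockedB \<delta>) = Rep" using out(2)[OF s] undo[OF s] XR by auto
      then show "decodeM E r code (Some (e, y)) (F \<X>) = K" unfolding decodeM_def using dec[of Rep] RK by (simp add: Int_absorb2)
    qed
    then show ?thesis using c y e by (intro exI[of _ "Some (e, y)"] exI[of _ "F ` Pow (M y)"]) auto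
  qed
qed

end

section \<open>Counting basis systems\<close>

definition basis_systems :: "'a set \<Rightarrow> nat \<Rightarrow> 'a set set set" where
  "basis_systems E r = {\<B>. basis_system E r \<B>}"

lemma finite_basis_systems: "finite E \<Longrightarrow> finite (basis_systems E r)"
proof -
  assume E: "finite E"
  have "basis_systems E r \<subseteq> Pow (lvl E r)" unfolding basis_systems_def using basis_system.basis_lvl by auto
  then show ?thesis using finite_lvl[OF E] by (meson finite_Pow_iff finite_subset)
qed

lemma finite_stable_sets: "finite E \<Longrightarrow> finite (stable_sets E r)"
  unfolding stable_sets_def by (rule finite_subset[of _ "Pow (lvl E r)"]) (auto simp: finite_lvl)

definition smallfam :: "'a set \<Rightarrow> nat \<Rightarrow> 'a set set" where
  "smallfam A k = {Z. Z \<subseteq> A \<and> card Z \<le> k}"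

text \<open>The revealed circuits, cocircuits and balls are recorded as unordered families of subsets of
  \<open>E\<close>. As \<open>k\<close> is about \<open>2 ^ card E\<close> divided by a polynomial, such a family costs only \<open>O(k log (card E))\<close>
  bits, not \<open>k * card E\<close>.\<close>

definition Codes :: "'a set \<Rightarrow> nat \<Rightarrow> nat \<Rightarrow> ('a set set \<times> 'a set set \<times> 'a set set \<times> 'a set set \<times> 'a set set) set" where
  "Codes E k \<delta> = smallfam (Pow E) k \<times> smallfam (Pow E) k \<times> smallfam (Pow E) k \<times>
     Pow (smallfam E \<delta>) \<times> Pow (smallfam E \<delta>)"

definition codeN :: "'a set \<Rightarrow> nat \<Rightarrow> nat \<Rightarrow> nat" where
  "codeN E k \<delta> = card (smallfam (Pow E) k) ^ 3 * (2 ^ card (smallfam E \<delta>)) ^ 2"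

lemma finite_smallfam: "finite A \<Longrightarrow> finite (smallfam A k)"
  unfolding smallfam_def by auto

lemma finite_Codes: "finite E \<Longrightarrow> finite (Codes E k \<delta>)"
  unfolding Codes_def by (intro finite_SigmaI) (auto intro: finite_smallfam)

lemma card_Codes: "finite E \<Longrightarrow> card (Codes E k \<delta>) = codeN E k \<delta>"
  unfolding Codes_def codeN_def
  by (simp add: card_cartesian_product card_Pow finite_smallfam power2_eq_square power3_eq_cube)

text \<open>A code word together with one stable set determines the basis system. All
  \<open>g\<close> stable sets of a system use the same code word, so the pairs obtained are
  distinct.\<close>

lemma encode_count:
  assumes fin: "finite CM" "finite St" "\<AA> \<subseteq> basis_systems E r" "finite E"
    and enc: "\<And>\<B>. \<B> \<in> \<AA> \<Longrightarrow> \<exists>c\<in>CM. \<exists>\<F>\<subseteq>St. g \<le> card \<F> \<and> (\<forall>V\<in>\<F>. dec c V = lvl E r - \<B>)"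
  shows "card \<AA> * g \<le> card CM * card St"
proof -
  from enc obtain c \<F> where c: "\<And>\<B>. \<B> \<in> \<AA> \<Longrightarrow> c \<B> \<in> CM \<and> \<F> \<B> \<subseteq> St \<and> g \<le> card (\<F> \<B>) \<and> (\<forall>V\<in>\<F> \<B>. dec (c \<B>) V = lvl E r - \<B>)"
    by metis
  have finA: "finite \<AA>" using fin finite_basis_systems finite_subset by blast
  have finF: "finite (\<F> \<B>)" if "\<B> \<in> \<AA>" for \<B> using c[OF that] fin(2) finite_subset by blast
  have "card \<AA> * g = (\<Sum>\<B>\<in>\<AA>. g)" by simp
  also have "\<dots> \<le> (\<Sum>\<B>\<in>\<AA>. card (\<F> \<B>))" using c by (intro sum_mono) auto
  also have "\<dots> = card (Sigma \<AA> \<F>)" using finA finF by (simp add: card_SigmaI)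
  also have "\<dots> \<le> card (CM \<times> St)"
  proof (rule card_inj_on_le)
    show "inj_on (\<lambda>(\<B>, V). (c \<B>, V)) (Sigma \<AA> \<F>)"
    proof (rule inj_onI)
      fix p p' assume p: "p \<in> Sigma \<AA> \<F>" "p' \<in> Sigma \<AA> \<F>" and e: "(\<lambda>(\<B>, V). (c \<B>, V)) p = (\<lambda>(\<B>, V). (c \<B>, V)) p'"
      obtain \<B> V \<B>' where pp: "p = (\<B>, V)" "p' = (\<B>', V)" and a: "\<B> \<in> \<AA>" "V \<in> \<F> \<B>" "\<B>' \<in> \<AA>" "V \<in> \<F> \<B>'" "c \<B> = c \<B>'"
        using p e by auto
      have "lvl E r - \<B> = dec (c \<B>) V" "lvl E r - \<B>' = dec (c \<B>') V" using c[OF a(1)] c[OF a(3)] a(2,4) by auto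
      then have "lvl E r - \<B> = lvl E r - \<B>'" using a(5) by simp
      moreover have "\<B> \<subseteq> lvl E r" "\<B>' \<subseteq> lvl E r"
        using a(1,3) fin(3) basis_system.basis_lvl unfolding basis_systems_def by blast+
      ultimately have "\<B> = \<B>'" by blast
      then show "p = p'" using pp by simp
    qed
    show "(\<lambda>(\<B>, V). (c \<B>, V)) ` Sigma \<AA> \<F> \<subseteq> CM \<times> St" using c by auto
    show "finite (CM \<times> St)" using fin by auto
  qed
  also have "\<dots> = card CM * card St" by (rule card_cartesian_product)
  finally show ?thesis .
qed

locale code_params =
  fixes E :: "'a set" and r \<rho> \<delta> m k :: nat
  assumes finite_E: "finite E"
    and midr: "card E \<le> 3 * r" "3 * r \<le> 2 * card E"
    and rhos: "0 < \<rho>" "50 * \<rho> \<le> card E ^ 2" "8 * \<rho> \<le> \<delta> * card E" "8 * \<delta> < card E"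
    and kbound: "m + (card E choose r) * exp (- real \<rho> * m / (3 * (card E choose (card E div 2)))) \<le> k"
begin

lemma get_code:
  assumes "\<B> \<in> basis_systems E r"
  shows "\<exists>Z1 Z2 Z3. coded_system E r \<B> \<rho> \<delta> Z1 Z2 Z3 \<and>
    (Z1, Z2, Z3, basis_system.smallC E \<B> \<delta>, basis_system.smallD E \<B> \<delta>) \<in> Codes E k \<delta>"
proof -
  interpret basis_system E r \<B> using assms unfolding basis_systems_def by auto
  let ?N = "card E choose (card E div 2)"
  have "card tokens \<le> card (lvl E (r-1)) + card (lvl E r) + card (lvl E (Suc r))"
    unfolding tokens_def by (meson card_Un_le add_le_mono order_refl order_trans)
  also have "\<dots> \<le> ?N + ?N + ?N" unfolding card_lvl[OF finE] by (intro add_mono binomial_maximum)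
  finally have t3: "card tokens \<le> 3 * ?N" by simp
  have "lvl E r \<noteq> {}" using nonempty basis_lvl by auto
  then have "tokens \<noteq> {}" unfolding tokens_def by auto
  then have t0: "0 < card tokens" using fin_tokens by auto
  have "K \<subseteq> lvl E r" unfolding K_def by auto
  then have "card K \<le> card E choose r" using card_mono[OF finite_lvl[OF finE]] card_lvl[OF finE] by metis
  moreover have "exp (- real \<rho> * m / card tokens) \<le> exp (- real \<rho> * m / (3 * ?N))"
  proof -
    have "real \<rho> * m / (3 * ?N) \<le> real \<rho> * m / card tokens"
      by (rule frac_le) (use t3 t0 in \<open>simp, simp, simp, linarith\<close>)
    then show ?thesis by (simp only: exp_le_cancel_iff mult_minus_left minus_divide_left[symmetric] neg_le_iff_le)
  qed
  ultimately have "card K * exp (- real \<rho> * m / card tokens) \<le> (card E choose r) * exp (- real \<rho> * m / (3 * ?N))"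
    by (intro mult_mono) auto
  then have "m + card K * exp (- real \<rho> * m / card tokens) \<le> k" using kbound by linarith
  from exists_code[OF this rhos(1)] obtain Z1 Z2 Z3 where Z: "Z1 \<subseteq> Pow E" "Z2 \<subseteq> Pow E" "Z3 \<subseteq> Pow E" "card Z1 \<le> k" "card Z2 \<le> k" "card Z3 \<le> k"
     "cover E r Z1 Z2 Z3 \<subseteq> K" "\<forall>X\<in>K - cover E r Z1 Z2 Z3. rate X < \<rho>"
    by (elim exE conjE)
  have "coded_system E r \<B> \<rho> \<delta> Z1 Z2 Z3"   proof (rule coded_system.intro[OF basis_system_axioms], rule coded_system_axioms.intro)
    show "rate X < \<rho>" if "X \<in> K - cover E r Z1 Z2 Z3" for X using Z(8) that by (rule bspec)
  qed (fact Z(7) midr rhos)+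
  moreover have "(Z1, Z2, Z3, smallC \<delta>, smallD \<delta>) \<in> Codes E k \<delta>"
    using Z unfolding Codes_def smallfam_def smallC_def smallD_def by auto
  ultimately show ?thesis by blast
qed

text \<open>By \<open>encode_small\<close>, the encoding stable set can be chosen with at most
  \<open>q\<close> members, and sets that small are much rarer than stable sets in general.\<close>

lemma count_few_bases:
  "card {\<B> \<in> basis_systems E r. 5 * card \<B> \<le> q * card E} \<le> codeN E k \<delta> * card (smallfam (lvl E r) q)"
proof -
  have n0: "0 < card E" using rhos by linarith
  have "card {\<B> \<in> basis_systems E r. 5 * card \<B> \<le> q * card E} * 1 \<le> card (Codes E k \<delta>) * card (smallfam (lvl E r) q)"
  proof (rule encode_count[where dec = "decode E r"])
    fix \<B> assume "\<B> \<in> {\<B> \<in> basis_systems E r. 5 * card \<B> \<le> q * card E}"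
    then have B: "\<B> \<in> basis_systems E r" "5 * card \<B> \<le> q * card E" by auto
    obtain Z1 Z2 Z3 where Z: "coded_system E r \<B> \<rho> \<delta> Z1 Z2 Z3"
      "(Z1, Z2, Z3, basis_system.smallC E \<B> \<delta>, basis_system.smallD E \<B> \<delta>) \<in> Codes E k \<delta>"
      using get_code[OF B(1)] by auto
    interpret coded_system E r \<B> \<rho> \<delta> Z1 Z2 Z3 by (rule Z(1))
    obtain V where V: "V \<in> stable_sets E r" "card V * card E \<le> 5 * card \<B>" "decode E r code V = K" using encode_small by auto
    have "card V * card E \<le> q * card E" using V(2) B(2) by linarith
    then have "card V \<le> q" using n0 by simp
    then have "V \<in> smallfam (lvl E r) q" using V(1) unfolding smallfam_def stable_sets_def by auto
    then have "{V} \<subseteq> smallfam (lvl E r) q \<and> 1 \<le> card {V} \<and> (\<forall>W\<in>{V}. decode E r code W = lvl E r - \<B>)"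
      using V(3) unfolding K_def by auto
    then show "\<exists>c\<in>Codes E k \<delta>. \<exists>\<F>\<subseteq>smallfam (lvl E r) q. 1 \<le> card \<F> \<and> (\<forall>V\<in>\<F>. decode E r c V = lvl E r - \<B>)"
      using Z(2) by blast
  next
    show "finite (smallfam (lvl E r) q)" by (intro finite_smallfam finite_lvl finite_E)
  qed (use finite_E finite_Codes in auto)
  then show ?thesis using card_Codes[OF finite_E] by simp
qed

lemma count_all: "card (basis_systems E r) \<le> codeN E k \<delta> * card (stable_sets E r)"
proof -
  have "card (basis_systems E r) * 1 \<le> card (Codes E k \<delta>) * card (stable_sets E r)"
  proof (rule encode_count[where dec = "decode E r"])
    fix \<B> assume B: "\<B> \<in> basis_systems E r"
    obtain Z1 Z2 Z3 where Z: "coded_system E r \<B> \<rho> \<delta> Z1 Z2 Z3"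
      "(Z1, Z2, Z3, basis_system.smallC E \<B> \<delta>, basis_system.smallD E \<B> \<delta>) \<in> Codes E k \<delta>"
      using get_code[OF B] by auto
    interpret coded_system E r \<B> \<rho> \<delta> Z1 Z2 Z3 by (rule Z(1))
    obtain V where V: "V \<in> stable_sets E r" "decode E r code V = K" using encode_small by auto
    then have "{V} \<subseteq> stable_sets E r \<and> 1 \<le> card {V} \<and> (\<forall>W\<in>{V}. decode E r code W = lvl E r - \<B>)"
      unfolding K_def by auto
    then show "\<exists>c\<in>Codes E k \<delta>. \<exists>\<F>\<subseteq>stable_sets E r. 1 \<le> card \<F> \<and> (\<forall>V\<in>\<F>. decode E r c V = lvl E r - \<B>)"
      using Z(2) by blast
  qed (use finite_E finite_Codes finite_stable_sets in auto)
  then show ?thesis using card_Codes[OF finite_E] by simp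
qed

end

locale colored_params = code_params +
  fixes col :: "'a set \<Rightarrow> nat"
  assumes col: "X \<in> lvl E r \<Longrightarrow> col X < card E"
    "X \<in> lvl E r \<Longrightarrow> Y \<in> lvl E r \<Longrightarrow> adj X Y \<Longrightarrow> col X \<noteq> col Y"
begin

lemma count_many_free:
  "card {\<B> \<in> basis_systems E r. g * card E ^ 2 + 5 * card \<B> \<le>
      card (basis_system.K E r \<B> \<inter> unblocked E r (basis_system.smallC E \<B> \<delta>) (basis_system.smallD E \<B> \<delta>)) * card E} * 2 ^ g
   \<le> codeN E k \<delta> * card (stable_sets E r)" (is "card ?A * _ \<le> _")
proof -
  have "card ?A * 2 ^ g \<le> card (Codes E k \<delta>) * card (stable_sets E r)"
  proof (rule encode_count[where dec = "decode E r"])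
    fix \<B> assume "\<B> \<in> ?A"
    then have B: "\<B> \<in> basis_systems E r" by auto
    obtain Z1 Z2 Z3 where Z: "coded_system E r \<B> \<rho> \<delta> Z1 Z2 Z3"
      "(Z1, Z2, Z3, basis_system.smallC E \<B> \<delta>, basis_system.smallD E \<B> \<delta>) \<in> Codes E k \<delta>"
      using get_code[OF B] by auto
    interpret coded_system E r \<B> \<rho> \<delta> Z1 Z2 Z3 by (rule Z(1))
    have "g * card E ^ 2 + 5 * card \<B> \<le> card (K \<inter> unblockedB \<delta>) * card E" using \<open>\<B> \<in> ?A\<close> by auto
    from encode_many[where col = col, OF this col] obtain \<F> where "\<F> \<subseteq> stable_sets E r" "2 ^ g \<le> card \<F>" "\<forall>V\<in>\<F>. decode E r code V = K"
      by auto
    then show "\<exists>c\<in>Codes E k \<delta>. \<exists>\<F>\<subseteq>stable_sets E r. 2 ^ g \<le> card \<F> \<and> (\<forall>V\<in>\<F>. decode E r c V = lvl E r - \<B>)"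
      using Z(2) unfolding K_def by blast
  qed (use finite_E finite_Codes finite_stable_sets in auto)
  then show ?thesis using card_Codes[OF finite_E] by simp
qed

lemma count_many_small_circ:
  "card {\<B> \<in> basis_systems E r. \<exists>e\<in>E. 2 * card E * g \<le> card (basis_system.circ_covered E r \<B> \<delta> e)} * 2 ^ g
   \<le> codeN E k \<delta> * (card E ^ 2 + 1) * card (stable_sets E r)" (is "card ?A * _ \<le> _")
proof -
  define Modes where "Modes = insert None (Some ` (E \<times> E))"
  have fM: "finite Modes" unfolding Modes_def using finite_E by auto
  have "card Modes \<le> Suc (card (Some ` (E \<times> E)))" unfolding Modes_def using finite_E by (simp add: card_insert_if)
  also have "card (Some ` (E \<times> E)) = card E ^ 2" by (simp add: card_image card_cartesian_product power2_eq_square)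
  finally have cM: "card Modes \<le> card E ^ 2 + 1" by simp
  have "card ?A * 2 ^ g \<le> card (Codes E k \<delta> \<times> Modes) * card (stable_sets E r)"
  proof (rule encode_count[where dec = "\<lambda>(c, m). decodeM E r c m"])
    fix \<B> assume "\<B> \<in> ?A"
    then obtain e where B: "\<B> \<in> basis_systems E r" and e: "e \<in> E" "2 * card E * g \<le> card (basis_system.circ_covered E r \<B> \<delta> e)" by auto
    obtain Z1 Z2 Z3 where Z: "coded_system E r \<B> \<rho> \<delta> Z1 Z2 Z3"
      "(Z1, Z2, Z3, basis_system.smallC E \<B> \<delta>, basis_system.smallD E \<B> \<delta>) \<in> Codes E k \<delta>"
      using get_code[OF B] by auto
    interpret coded_system E r \<B> \<rho> \<delta> Z1 Z2 Z3 by (rule Z(1))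
    obtain m \<F> where m: "m = None \<or> m \<in> Some ` (E \<times> E)" "\<F> \<subseteq> stable_sets E r" "2 ^ g \<le> card \<F>"
      "\<forall>V\<in>\<F>. decodeM E r code m V = K"
    proof -
      have "\<exists>m \<F>. (m = None \<or> m \<in> Some ` (E \<times> E)) \<and> \<F> \<subseteq> stable_sets E r \<and> 2 ^ g \<le> card \<F> \<and> (\<forall>V\<in>\<F>. decodeM E r code m V = K)"
        by (rule encode_circ_covered[OF e(2,1) col])
      then show ?thesis using that by (elim exE conjE)
    qed
    have "m \<in> Modes" using m(1) unfolding Modes_def by blast
    then have "(code, m) \<in> Codes E k \<delta> \<times> Modes" using Z(2) by (intro SigmaI)
    moreover have "\<forall>V\<in>\<F>. (\<lambda>(c, m). decodeM E r c m) (code, m) V = lvl E r - \<B>"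
      using m(4) unfolding K_def split_conv by blast
    ultimately show "\<exists>c\<in>Codes E k \<delta> \<times> Modes. \<exists>\<F>\<subseteq>stable_sets E r. 2 ^ g \<le> card \<F> \<and>
        (\<forall>V\<in>\<F>. (\<lambda>(c, m). decodeM E r c m) c V = lvl E r - \<B>)"
      using m(2,3) by blast
  qed (use finite_E finite_Codes finite_stable_sets fM in auto)
  also have "\<dots> \<le> codeN E k \<delta> * (card E ^ 2 + 1) * card (stable_sets E r)"
    unfolding card_cartesian_product card_Codes[OF finite_E] by (intro mult_le_mono cM order_refl)
  finally show ?thesis .
qed

end

section \<open>Duality and the double counting of basis exchanges\<close>

context basis_system
begin

abbreviation "dual \<equiv> (\<lambda>B. E - B) ` \<B>"

lemma dual_mem: "X \<subseteq> E \<Longrightarrow> X \<in> dual \<longleftrightarrow> E - X \<in> \<B>"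
  using basis_sub by (metis (no_types, lifting) double_diff image_iff subset_refl)

lemma dual_system: "basis_system E (card E - r) dual"
proof
  show "finite E" by (rule finE)
  show "dual \<noteq> {}" using nonempty by auto
  fix A assume A: "A \<in> dual"
  then obtain A' where A': "A = E - A'" "A' \<in> \<B>" by auto
  have Asub: "A' \<subseteq> E" using basis_sub[OF A'(2)] .
  show "A \<in> lvl E (card E - r)"
    unfolding A'(1) lvl_def using basis_card[OF A'(2)] basis_fin[OF A'(2)] Asub by (simp add: card_Diff_subset)
  fix B assume "B \<in> dual"
  then obtain B' where B': "B = E - B'" "B' \<in> \<B>" by auto
  have Bsub: "B' \<subseteq> E" using basis_sub[OF B'(2)] .
  have sw: "swap A x y \<in> dual" if "swap A' y x \<in> \<B>" "x \<in> E - A'" "y \<in> A'" for x y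
  proof -
    have "swap A x y = E - swap A' y x" using that Asub unfolding A'(1) swap_def by auto
    then show ?thesis using that by auto
  qed
  show "\<exists>y\<in>B - A. swap A x y \<in> dual" if "x \<in> A - B" for x
  proof -
    have "x \<in> B' - A'" using that A' B' by auto
    then obtain y where "y \<in> A' - B'" "swap A' y x \<in> \<B>" using coexch[OF A'(2) B'(2)] by auto
    then show ?thesis using sw[of y x] that A' B' Asub by auto
  qed
  show "\<exists>x\<in>A - B. swap A x y \<in> dual" if "y \<in> B - A" for y
  proof -
    have "y \<in> A' - B'" using that A' B' by auto
    then obtain x where "x \<in> B' - A'" "swap A' y x \<in> \<B>" using exch[OF A'(2) B'(2)] by auto
    then show ?thesis using sw[of y x] that A' B' Bsub by auto
  qed
qed

lemma card_coc_covered_dual: "card (coc_covered \<delta> f) \<le> card (basis_system.circ_covered E (card E - r) dual \<delta> f)"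
proof -
  interpret D: basis_system E "card E - r" dual by (rule dual_system)
  have cD: "D \<in> D.smallC \<delta>" if "D \<in> smallD \<delta>" for D
  proof -
    obtain I z where I: "D = coc I" "z \<in> coc I" and D: "D \<subseteq> E" "D \<noteq> {}" "card D \<le> \<delta>"
      using \<open>D \<in> smallD \<delta>\<close> unfolding smallD_def by auto
    have "I \<subseteq> E" using I(2) basis_sub unfolding coc_def by auto
    have "coc I = D.circ (E - I)"
    proof -
      have "E - I - {y} \<in> dual \<longleftrightarrow> insert y I \<in> \<B>" if "y \<in> E - I" for y
      proof -
        have "E - (E - I - {y}) = insert y I" using that \<open>I \<subseteq> E\<close> by auto
        then show ?thesis using dual_mem[of "E - I - {y}"] by auto
      qed
      then show ?thesis unfolding coc_def D.circ_def by auto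
    qed
    then show ?thesis using I D unfolding D.smallC_def by auto
  qed
  have "(\<lambda>X. E - X) ` coc_covered \<delta> f \<subseteq> D.circ_covered \<delta> f"
  proof
    fix Y assume "Y \<in> (\<lambda>X. E - X) ` coc_covered \<delta> f"
    then obtain X D where X: "Y = E - X" "X \<in> lvl E r" "D \<in> smallD \<delta>" "f \<in> D" "D \<inter> X = {}" unfolding coc_covered_def by auto
    have "D \<subseteq> E - X" using X(3,5) unfolding smallD_def by auto
    moreover have "E - X \<in> lvl E (card E - r)"
      using X(2) card_lvl_sub[OF X(2)] unfolding lvl_def by (simp add: card_Diff_subset)
    ultimately show "Y \<in> D.circ_covered \<delta> f" using X cD unfolding D.circ_covered_def by auto
  qed
  moreover have "inj_on (\<lambda>X. E - X) (coc_covered \<delta> f)" unfolding coc_covered_def lvl_def by (intro inj_onI) blast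
  moreover have "finite (D.circ_covered \<delta> f)" unfolding D.circ_covered_def using finite_lvl[OF finE] by auto
  ultimately show ?thesis by (metis card_inj_on_le)
qed

text \<open>Exchanging \<open>f\<close> for \<open>e\<close> in a basis avoiding \<open>e\<close> gives a basis containing \<open>e\<close> or a nonbasis. Every
  nonbasis obtained is unblocked, or contains a small circuit through \<open>e\<close>, or misses a small cocircuit
  through \<open>f\<close>.\<close>

lemma basis_ratio:
  assumes e: "e \<in> E"
  shows "r * card {B \<in> \<B>. e \<notin> B} \<le> (card E - r) * card {B \<in> \<B>. e \<in> B} +
    (card E * card (K \<inter> unblockedB \<delta>) + card E * card (circ_covered \<delta> e) + (\<Sum>f\<in>E. card (coc_covered \<delta> f)))"
proof -
  define A where "A = Sigma {B \<in> \<B>. e \<notin> B} (\<lambda>B. B)"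
  define A1 where "A1 = {(B, f) \<in> A. swap B f e \<in> \<B>}"
  define A2 where "A2 = {(B, f) \<in> A. swap B f e \<in> K}"
  have finA: "finite A" unfolding A_def using finK basis_fin by auto
  have cA: "card A = r * card {B \<in> \<B>. e \<notin> B}"
  proof -
    have "card A = (\<Sum>B\<in>{B \<in> \<B>. e \<notin> B}. card B)" unfolding A_def using finK basis_fin by (intro card_SigmaI) auto
    also have "\<dots> = (\<Sum>B\<in>{B \<in> \<B>. e \<notin> B}. r)" by (intro sum.cong) (use basis_card in auto)
    finally show ?thesis by simp
  qed
  have sl: "swap B f e \<in> lvl E r" if "B \<in> \<B>" "e \<notin> B" "f \<in> B" for B f
    using swap_in_lvl[OF basis_lvl[OF that(1)] that(3)] that e by auto
  have "A = A1 \<union> A2" unfolding A1_def A2_def K_def using sl unfolding A_def by auto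
  then have le: "card A \<le> card A1 + card A2" by (metis card_Un_le)
  \<comment> \<open>Remembering \<open>f\<close> makes the map injective. When the new set is a
    basis it contains \<open>e\<close> and misses \<open>f\<close>, which leaves
    \<open>card E - r\<close> choices for \<open>f\<close>.\<close>
  define h where "h = (\<lambda>(B, f). (swap B f e, f))"
  have injh: "inj_on h A"
  proof (rule inj_onI, clarify)
    fix B f B' f' assume a: "(B, f) \<in> A" "(B', f') \<in> A" "h (B, f) = h (B', f')"
    then have f: "f' = f" "swap B f e = swap B' f e" "e \<notin> B" "e \<notin> B'" "f \<in> B" "f \<in> B'" unfolding h_def A_def by auto
    have "B = swap (swap B f e) e f" "B' = swap (swap B' f e) e f" using f(3-6) by (metis swap_inv)+
    then show "B = B' \<and> f = f'" using f(1,2) by simp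
  qed
  have "card A1 \<le> card (Sigma {B \<in> \<B>. e \<in> B} (\<lambda>B. E - B))"
  proof (rule card_inj_on_le)
    show "inj_on h A1" using injh unfolding A1_def by (rule inj_on_subset) auto
    show "h ` A1 \<subseteq> Sigma {B \<in> \<B>. e \<in> B} (\<lambda>B. E - B)"
      unfolding A1_def A_def h_def swap_def using basis_sub by auto
    show "finite (Sigma {B \<in> \<B>. e \<in> B} (\<lambda>B. E - B))" using finK finE by auto
  qed
  also have "\<dots> = (\<Sum>B\<in>{B \<in> \<B>. e \<in> B}. card (E - B))" using finK finE by (intro card_SigmaI) auto
  also have "\<dots> = (\<Sum>B\<in>{B \<in> \<B>. e \<in> B}. card E - r)"
    by (intro sum.cong refl) (use basis_fin basis_sub basis_card in \<open>auto simp: card_Diff_subset\<close>)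
  also have "\<dots> = (card E - r) * card {B \<in> \<B>. e \<in> B}" by simp
  finally have c1: "card A1 \<le> (card E - r) * card {B \<in> \<B>. e \<in> B}" .
  let ?S = "(K \<inter> unblockedB \<delta>) \<times> E \<union> circ_covered \<delta> e \<times> E \<union> prod.swap ` Sigma E (coc_covered \<delta>)"
  have finRD: "finite (circ_covered \<delta> e)" "finite (coc_covered \<delta> f)" for f unfolding circ_covered_def coc_covered_def using finite_lvl[OF finE] by auto
  have "card A2 \<le> card ?S"
  proof (rule card_inj_on_le)
    show "inj_on h A2" using injh unfolding A2_def by (rule inj_on_subset) auto
    show "finite ?S" using finK finE finRD by auto
    show "h ` A2 \<subseteq> ?S"
    proof
      fix p assume "p \<in> h ` A2"
      then obtain B f where B: "B \<in> \<B>" "e \<notin> B" "f \<in> B" "swap B f e \<in> K" and p: "p = (swap B f e, f)"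
        unfolding A2_def A_def h_def by auto
      have fE: "f \<in> E" using B basis_sub by auto
      have l: "swap B f e \<in> lvl E r" using K_lvl[OF B(4)] .
      show "p \<in> ?S"
      proof (cases "swap B f e \<in> unblockedB \<delta>")
        case True then show ?thesis using p B fE by auto
      next
        case False
        then consider C where "C \<in> smallC \<delta>" "C \<subseteq> swap B f e" | D where "D \<in> smallD \<delta>" "D \<inter> swap B f e = {}"
          using l unfolding unblocked_def by auto
        then show ?thesis
        proof cases
          case 1
          then obtain J z where J: "C = circ J" "z \<in> circ J" unfolding smallC_def by auto
          have "e \<in> C" using no_basis_circ[OF B(1) J(2)] J(1) 1(2) unfolding swap_def by auto
          then show ?thesis using 1 l p fE unfolding circ_covered_def by auto
        next
          case 2
          then obtain I z where I: "D = coc I" "z \<in> coc I" unfolding smallD_def by auto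
          have "B \<inter> D \<noteq> {}" using basis_meets_coc[OF B(1) I(2)] I(1) by auto
          then have "f \<in> D" using 2(2) unfolding swap_def by auto
          then have "swap B f e \<in> coc_covered \<delta> f" using 2 l unfolding coc_covered_def by auto
          then show ?thesis using p fE by (auto simp: image_iff)
        qed
      qed
    qed
  qed
  also have "\<dots> \<le> card ((K \<inter> unblockedB \<delta>) \<times> E) + card (circ_covered \<delta> e \<times> E) + card (prod.swap ` Sigma E (coc_covered \<delta>))"
    by (meson card_Un_le add_le_mono order_refl order_trans)
  also have "card (prod.swap ` Sigma E (coc_covered \<delta>)) = card (Sigma E (coc_covered \<delta>))" by (rule card_image) auto
  also have "card (Sigma E (coc_covered \<delta>)) = (\<Sum>f\<in>E. card (coc_covered \<delta> f))" using finE finRD by (intro card_SigmaI) auto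
  finally have "card A2 \<le> card E * card (K \<inter> unblockedB \<delta>) + card E * card (circ_covered \<delta> e) + (\<Sum>f\<in>E. card (coc_covered \<delta> f))"
    by (simp add: card_cartesian_product mult.commute)
  then show ?thesis using le c1 cA by linarith
qed

end

text \<open>Complementing all bases turns small cocircuits into small circuits. The number of stable
  sets that appears therefore belongs to rank \<open>card E - r\<close>.\<close>

lemma count_many_small_coc:
  assumes "colored_params E (card E - r) \<rho> \<delta> m k col"
  shows "card {\<B> \<in> basis_systems E r. \<exists>f\<in>E. 2 * card E * g \<le> card (basis_system.coc_covered E r \<B> \<delta> f)} * 2 ^ g
   \<le> codeN E k \<delta> * (card E ^ 2 + 1) * card (stable_sets E (card E - r))" (is "card ?A * _ \<le> _")
proof -
  interpret colored_params E "card E - r" \<rho> \<delta> m k col by (rule assms)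
  let ?D = "{\<B> \<in> basis_systems E (card E - r). \<exists>e\<in>E. 2 * card E * g \<le> card (basis_system.circ_covered E (card E - r) \<B> \<delta> e)}"
  have "card ?A \<le> card ?D"
  proof (rule card_inj_on_le)
    show "finite ?D" using finite_basis_systems[OF finite_E] by auto
    show "inj_on (\<lambda>\<B>. (\<lambda>B. E - B) ` \<B>) ?A"
    proof (rule inj_onI)
      fix \<B> \<B>' assume a: "\<B> \<in> ?A" "\<B>' \<in> ?A" and e: "(\<lambda>B. E - B) ` \<B> = (\<lambda>B. E - B) ` \<B>'"
      have s: "(\<lambda>B. E - B) ` (\<lambda>B. E - B) ` \<A> = \<A>" if "\<A> \<in> basis_systems E r" for \<A>
      proof -
        have "B \<subseteq> E" if "B \<in> \<A>" for B using basis_system.basis_sub[of E r \<A>] \<open>\<A> \<in> basis_systems E r\<close> that unfolding basis_systems_def by auto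
        then have "E - (E - B) = B" if "B \<in> \<A>" for B using that by (simp add: double_diff)
        then show ?thesis by (simp add: image_image)
      qed
      have "\<B> = (\<lambda>B. E - B) ` (\<lambda>B. E - B) ` \<B>" using s[of \<B>] a(1) by simp
      also have "\<dots> = (\<lambda>B. E - B) ` (\<lambda>B. E - B) ` \<B>'" unfolding e ..
      also have "\<dots> = \<B>'" using s[of \<B>'] a(2) by simp
      finally show "\<B> = \<B>'" .
    qed
    show "(\<lambda>\<B>. (\<lambda>B. E - B) ` \<B>) ` ?A \<subseteq> ?D"
    proof (rule image_subsetI)
      fix \<B> assume "\<B> \<in> ?A"
      then obtain f where B: "basis_system E r \<B>" and f: "f \<in> E" "2 * card E * g \<le> card (basis_system.coc_covered E r \<B> \<delta> f)"
        unfolding basis_systems_def by auto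
      have "2 * card E * g \<le> card (basis_system.circ_covered E (card E - r) ((\<lambda>B. E - B) ` \<B>) \<delta> f)"
        using f(2) basis_system.card_coc_covered_dual[OF B, of \<delta> f] by linarith
      then show "(\<lambda>B. E - B) ` \<B> \<in> ?D" using basis_system.dual_system[OF B] f(1) unfolding basis_systems_def by auto
    qed
  qed
  then have "card ?A * 2 ^ g \<le> card ?D * 2 ^ g" by (rule mult_le_mono1)
  also have "\<dots> \<le> codeN E k \<delta> * (card E ^ 2 + 1) * card (stable_sets E (card E - r))" by (rule count_many_small_circ)
  finally show ?thesis .
qed

section \<open>Stable sets of the Johnson graph\<close>

definition stable_count :: "'a set set \<Rightarrow> nat" where
  "stable_count A = card {V. V \<subseteq> A \<and> stable V}"

lemma finite_stabs: "finite A \<Longrightarrow> finite {V. V \<subseteq> A \<and> stable V}"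
  by (rule finite_subset[of _ "Pow A"]) auto

lemma stable_count_trivial: "finite A \<Longrightarrow> stable_count A \<le> 2 ^ card A"
  unfolding stable_count_def using card_mono[of "Pow A" "{V. V \<subseteq> A \<and> stable V}"] by (auto simp: card_Pow)

lemma stable_count_step:
  assumes "finite A" "v \<in> A"
  shows "stable_count A \<le> stable_count (A - {v}) + stable_count (A - {v} - {w. adj v w})"
proof -
  let ?S = "\<lambda>A. {V. V \<subseteq> A \<and> stable V}"
  have "?S A \<subseteq> ?S (A - {v}) \<union> insert v ` ?S (A - {v} - {w. adj v w})"
  proof
    fix V assume V: "V \<in> ?S A"
    show "V \<in> ?S (A - {v}) \<union> insert v ` ?S (A - {v} - {w. adj v w})"
    proof (cases "v \<in> V")
      case True
      then have "V = insert v (V - {v})" by auto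
      moreover have "stable (V - {v})" using V stable_subset[of V "V - {v}"] by auto
      moreover have "V - {v} \<subseteq> A - {v} - {w. adj v w}" using V True unfolding stable_def by auto
      ultimately show ?thesis by blast
    qed (use V in auto)
  qed
  then have "card (?S A) \<le> card (?S (A - {v}) \<union> insert v ` ?S (A - {v} - {w. adj v w}))"
    using assms by (intro card_mono finite_UnI finite_imageI finite_stabs) auto
  also have "\<dots> \<le> card (?S (A - {v})) + card (insert v ` ?S (A - {v} - {w. adj v w}))" by (rule card_Un_le)
  also have "card (insert v ` ?S (A - {v} - {w. adj v w})) \<le> card (?S (A - {v} - {w. adj v w}))"
    using assms by (intro card_image_le finite_stabs) auto
  finally show ?thesis unfolding stable_count_def by linarith
qed

text \<open>The Kleitman-Winston recursion: branching on a vertex \<open>v\<close> of degree at least \<open>d\<close> removes either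
  one vertex or \<open>d + 1\<close> vertices, and \<open>(1 + x) ^ (- d) \<le> x\<close> makes the weight \<open>(1 + x) ^ card A\<close>
  absorb both branches.\<close>

lemma stable_count_bound:
  fixes x F a :: real
  assumes "finite A" "0 < x" "1 \<le> x * (1 + x) ^ d" "0 \<le> F"
    and small: "\<And>A'. A' \<subseteq> A \<Longrightarrow> card A' \<le> a \<Longrightarrow> stable_count A' \<le> F"
    and large: "\<And>A'. A' \<subseteq> A \<Longrightarrow> a < card A' \<Longrightarrow> \<exists>v\<in>A'. d \<le> card {w \<in> A'. adj v w}"
  shows "stable_count A \<le> F * (1 + x) ^ card A"
  using assms(1) small large
proof (induction "card A" arbitrary: A rule: less_induct)
  case less
  show ?case
  proof (cases "card A \<le> a")
    case True
    then have "stable_count A \<le> F" using less.prems(2) by auto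
    moreover have "F * 1 \<le> F * (1 + x) ^ card A" using assms(2,4) by (intro mult_left_mono) auto
    ultimately show ?thesis by simp
  next
    case False
    then obtain v where v: "v \<in> A" "d \<le> card {w \<in> A. adj v w}" using less.prems(3)[of A] by auto
    define A1 where "A1 = A - {v}"
    define A2 where "A2 = A - {v} - {w. adj v w}"
    have sub: "A1 \<subseteq> A" "A2 \<subseteq> A1" "A1 \<subset> A" "A2 \<subset> A" using v unfolding A1_def A2_def by auto
    have lt: "card A1 < card A" "card A2 < card A" using sub less.prems(1) by (auto intro: psubset_card_mono)
    have IH: "stable_count A' \<le> F * (1 + x) ^ card A'" if "A' \<subset> A" for A'
    proof (rule less.hyps)
      show "card A' < card A" using that less.prems(1) by (rule psubset_card_mono[rotated])
      show "finite A'" using that less.prems(1) finite_subset by blast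
    qed (use that less.prems(2,3) in \<open>auto dest: psubset_imp_subset\<close>)
    have c1: "card A = Suc (card A1)" unfolding A1_def using v less.prems(1) by (metis card_Suc_Diff1)
    have A2': "A2 = A1 - {w \<in> A. adj v w}" unfolding A2_def A1_def by auto
    have "{w \<in> A. adj v w} \<subseteq> A1" unfolding A1_def using adj_irrefl by auto
    then have "card A2 = card A1 - card {w \<in> A. adj v w}" unfolding A2'
      using less.prems(1) sub(1) by (intro card_Diff_subset) (auto intro: finite_subset)
    moreover have "card {w \<in> A. adj v w} \<le> card A1"
      using \<open>{w \<in> A. adj v w} \<subseteq> A1\<close> less.prems(1) sub(1) by (meson card_mono finite_subset)
    ultimately have c2: "card A2 + d \<le> card A1" using v by linarith
    have "(1 + x) ^ card A2 \<le> x * (1 + x) ^ d * (1 + x) ^ card A2"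
      using assms(2,3) mult_right_mono[OF assms(3), of "(1 + x) ^ card A2"] by simp
    also have "\<dots> = x * (1 + x) ^ (card A2 + d)" by (simp add: power_add)
    also have "\<dots> \<le> x * (1 + x) ^ card A1" using assms(2) c2 by (intro mult_left_mono power_increasing) auto
    finally have p: "(1 + x) ^ card A2 \<le> x * (1 + x) ^ card A1" .
    have "real (stable_count A) \<le> stable_count A1 + stable_count A2"
      using stable_count_step[OF less.prems(1) v(1)] unfolding A1_def A2_def by (simp flip: of_nat_add)
    also have "\<dots> \<le> F * (1 + x) ^ card A1 + F * (1 + x) ^ card A2"
      using IH[OF sub(3)] IH[OF sub(4)] by simp
    also have "\<dots> \<le> F * (1 + x) ^ card A1 + F * (x * (1 + x) ^ card A1)"
      using p assms(4) by (intro add_left_mono mult_left_mono) auto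
    also have "\<dots> = F * (1 + x) ^ card A" unfolding c1 by (simp add: algebra_simps)
    finally show ?thesis .
  qed
qed

text \<open>Summing over the \<open>(r - 1)\<close>-sets and applying Cauchy-Schwarz to the numbers of members of \<open>A\<close>
  above each of them plays the role of the smallest eigenvalue of the Johnson graph.\<close>

lemma high_degree:
  fixes E :: "'a set"
  assumes E: "finite E" and A: "A \<subseteq> lvl E r" "A \<noteq> {}" and r: "1 \<le> r" "r \<le> card E"
  shows "\<exists>v\<in>A. r * ((card E - r + 1) * card A / (card E choose r) - 1) \<le> card {w \<in> A. adj v w}"
proof -
  define L where "L = lvl E (r - 1)"
  have finA: "finite A" using A(1) finite_lvl[OF E] finite_subset by blast
  have finL: "finite L" unfolding L_def using finite_lvl[OF E] .
  define c where "c = (\<lambda>I. card {X \<in> A. I \<subseteq> X})"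
  define a where "a = card A"
  have sub_count: "card {I \<in> L. I \<subseteq> X} = r" if "X \<in> A" for X
  proof -
    have X: "X \<subseteq> E" "card X = r" "finite X" using that A(1) finite_subset[OF _ E, of X] unfolding lvl_def by auto
    have "{I \<in> L. I \<subseteq> X} = {I. I \<subseteq> X \<and> card I = r - 1}" unfolding L_def lvl_def using X(1) by auto
    then have "card {I \<in> L. I \<subseteq> X} = r choose (r - 1)" using n_subsets[OF X(3), of "r - 1"] X(2) by simp
    then show ?thesis using r binomial_symmetric[of "r - 1" r] by simp
  qed
  have cs: "real (c I) = (\<Sum>X\<in>A. if I \<subseteq> X then 1 else 0)" for I
    unfolding c_def using finA by (simp add: sum.If_cases Int_def)
  have "(\<Sum>I\<in>L. real (c I)) = (\<Sum>X\<in>A. \<Sum>I\<in>L. if I \<subseteq> X then 1 else 0)" unfolding cs by (rule sum.swap)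
  also have "\<dots> = (\<Sum>X\<in>A. real (card {I \<in> L. I \<subseteq> X}))" using finL by (intro sum.cong refl) (simp add: sum.If_cases Int_def)
  also have "\<dots> = (\<Sum>X\<in>A. real r)" using sub_count by (intro sum.cong) auto
  finally have s1: "(\<Sum>I\<in>L. real (c I)) = real r * a" unfolding a_def by simp
  \<comment> \<open>Distinct \<open>r\<close>-sets share at most one \<open>(r - 1)\<close>-subset,
    and only if they are adjacent. So the second moment of \<open>c\<close> bounds the number of
    edges inside \<open>A\<close> from below.\<close>
  have pair: "real (card {I \<in> L. I \<subseteq> X \<and> I \<subseteq> Y}) \<le> (if X = Y then real r else 0) + (if adj X Y then 1 else 0)"
    if XY: "X \<in> A" "Y \<in> A" for X Y
  proof (cases "X = Y")
    case True
    then show ?thesis using sub_count[OF XY(1)] by simp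
  next
    case ne: False
    have X: "finite X" "card X = r" and Y: "finite Y" "card Y = r"
      using XY A(1) finite_subset[OF _ E, of X] finite_subset[OF _ E, of Y] unfolding lvl_def by auto
    have eq: "I = X \<inter> Y \<and> adj X Y" if I: "I \<in> L" "I \<subseteq> X" "I \<subseteq> Y" for I
    proof -
      have cI: "card I = r - 1" using I unfolding L_def lvl_def by auto
      have "card (X - I) = 1" "card (Y - I) = 1"
        using I X Y cI r finite_subset[OF I(2) X(1)] by (auto simp: card_Diff_subset)
      then obtain x y where x: "X - I = {x}" and y: "Y - I = {y}" by (metis card_1_singletonE)
      have eqs: "X = insert x I" "Y = insert y I" "x \<notin> I" "y \<notin> I" using x y I by auto
      then have "x \<noteq> y" using ne by auto
      then have "Y = swap X x y" "x \<in> X" "y \<notin> X" "I = X \<inter> Y" using eqs unfolding swap_def by auto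
      then show ?thesis using adjI by metis
    qed
    show ?thesis
    proof (cases "adj X Y")
      case True
      have "{I \<in> L. I \<subseteq> X \<and> I \<subseteq> Y} \<subseteq> {X \<inter> Y}" using eq by auto
      then have "card {I \<in> L. I \<subseteq> X \<and> I \<subseteq> Y} \<le> card {X \<inter> Y}" by (intro card_mono) auto
      then show ?thesis using True ne by simp
    next
      case False
      then have e: "{I \<in> L. I \<subseteq> X \<and> I \<subseteq> Y} = {}" using eq by blast
      show ?thesis unfolding e by simp
    qed
  qed
  have "(\<Sum>I\<in>L. (real (c I))\<^sup>2) = (\<Sum>I\<in>L. \<Sum>X\<in>A. \<Sum>Y\<in>A. if I \<subseteq> X \<and> I \<subseteq> Y then 1 else 0)"
    unfolding cs power2_eq_square sum_product by (intro sum.cong refl) auto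
  also have "\<dots> = (\<Sum>X\<in>A. \<Sum>I\<in>L. \<Sum>Y\<in>A. if I \<subseteq> X \<and> I \<subseteq> Y then 1 else 0)" by (rule sum.swap)
  also have "\<dots> = (\<Sum>X\<in>A. \<Sum>Y\<in>A. \<Sum>I\<in>L. if I \<subseteq> X \<and> I \<subseteq> Y then 1 else 0)" by (intro sum.cong refl sum.swap)
  also have "\<dots> = (\<Sum>X\<in>A. \<Sum>Y\<in>A. real (card {I \<in> L. I \<subseteq> X \<and> I \<subseteq> Y}))"
    using finL by (intro sum.cong refl) (simp add: sum.If_cases Int_def)
  also have "\<dots> \<le> (\<Sum>X\<in>A. \<Sum>Y\<in>A. (if X = Y then real r else 0) + (if adj X Y then 1 else 0))"
    using pair by (intro sum_mono) auto
  also have "\<dots> = (\<Sum>X\<in>A. real r + real (card {w \<in> A. adj X w}))"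
    using finA by (intro sum.cong refl) (simp add: sum.distrib sum.If_cases Int_def)
  also have "\<dots> = real r * a + (\<Sum>X\<in>A. real (card {w \<in> A. adj X w}))" unfolding a_def by (simp add: sum.distrib)
  finally have s2: "(\<Sum>I\<in>L. (real (c I))\<^sup>2) \<le> real r * a + (\<Sum>X\<in>A. real (card {w \<in> A. adj X w}))" .
  have "(real r * a)\<^sup>2 \<le> (\<Sum>I\<in>L. (real (c I))\<^sup>2) * card L"
    unfolding s1[symmetric] by (rule sum_squared_le_sum_of_squares)
  also have "\<dots> \<le> (real r * a + (\<Sum>X\<in>A. real (card {w \<in> A. adj X w}))) * card L"
    using s2 by (intro mult_right_mono) auto
  finally have s3: "(real r * a)\<^sup>2 \<le> (real r * a + (\<Sum>X\<in>A. real (card {w \<in> A. adj X w}))) * card L" .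
  define N where "N = card E choose r"
  have cL: "card L = card E choose (r - 1)" unfolding L_def using card_lvl[OF E] .
  have L0: "card L > 0" unfolding cL using r by (simp add: zero_less_binomial_iff)
  have N0: "N > 0" unfolding N_def using r by (simp add: zero_less_binomial_iff)
  have "r * (card E choose r) = (card E - (r - 1)) * (card E choose (r - 1))"
  proof -
    have "Suc (r - 1) * (card E choose Suc (r - 1)) = (card E - (r - 1)) * (card E choose (r - 1))"
      using r Suc_times_binomial_add[of "r - 1" "card E - r"] binomial_absorb_comp[of "card E" "r - 1"] binomial_absorption[of "r - 1" "card E - 1"]
      by (metis Suc_diff_1 Suc_le_D binomial_absorb_comp binomial_absorption diff_Suc_1 mult.commute)
    then show ?thesis using r by simp
  qed
  then have NL: "real r * N = (real (card E) - r + 1) * card L"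
  proof -
    assume h: "r * (card E choose r) = (card E - (r - 1)) * (card E choose (r - 1))"
    have "real (card E - (r - 1)) = real (card E) - r + 1" using r by (simp add: of_nat_diff)
    then show ?thesis using arg_cong[OF h, of real] unfolding N_def cL of_nat_mult by simp
  qed
  define D where "D = (\<Sum>X\<in>A. real (card {w \<in> A. adj X w}))"
  have a0: "a > 0" unfolding a_def using A finA by auto
  have "(real r * a) * (real r * a) / card L \<le> real r * a + D"
    using s3 L0 unfolding D_def power2_eq_square by (simp add: divide_le_eq)
  moreover have "real r / card L = (real (card E) - r + 1) / N" using NL L0 N0 by (simp add: field_simps)
  then have "(real r * a) * (real r * a) / card L = (real r * a) * a * ((real (card E) - r + 1) / N)"
    by (metis (no_types, opaque_lifting) mult.assoc mult.commute times_divide_eq_right)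
  ultimately have D: "a * (r * ((card E - r + 1) * a / N - 1)) \<le> D"
  proof -
    assume u: "real r * a * (real r * a) / card L \<le> real r * a + D"
      "real r * a * (real r * a) / card L = real r * a * a * ((real (card E) - r + 1) / N)"
    have "real (card E - r + 1) = real (card E) - r + 1" using r by (simp add: of_nat_diff)
    then have e: "real ((card E - r + 1) * a) = (real (card E) - r + 1) * a" by (simp only: of_nat_mult)
    show ?thesis unfolding e using u by (simp add: algebra_simps)
  qed
  show ?thesis
  proof (rule ccontr)
    assume "\<not> ?thesis"
    then have lt: "real (card {w \<in> A. adj v w}) < r * ((card E - r + 1) * a / N - 1)" if "v \<in> A" for v
      using that unfolding a_def N_def by (meson not_le)
    then have "D < (\<Sum>X\<in>A. r * ((card E - r + 1) * a / N - 1))"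
      unfolding D_def using A(2) finA by (intro sum_strict_mono) auto
    also have "\<dots> = a * (r * ((card E - r + 1) * a / N - 1))" unfolding a_def by simp
    finally show False using D by linarith
  qed
qed

text \<open>Two phases make the error terms small. While more than \<open>a1\<close> vertices remain
  the degree is at least \<open>d1\<close>, so a tiny \<open>x1\<close> suffices for the full level.
  Between \<open>a1\<close> and \<open>a0\<close> only the degree \<open>d0\<close> is available,
  and the larger \<open>x0\<close> is multiplied by \<open>a1\<close> instead of the whole binomial.
  The last \<open>a0\<close> vertices are counted by their power set.\<close>

lemma stable_sets_bound:
  fixes E :: "'a set" and a0 a1 x0 x1 :: real
  assumes E: "finite E" and r: "1 \<le> r" "r \<le> card E"
    and a: "0 \<le> a0" "0 \<le> a1"
    and d0: "real d0 \<le> r * ((card E - r + 1) * a0 / (card E choose r) - 1)"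
    and d1: "real d1 \<le> r * ((card E - r + 1) * a1 / (card E choose r) - 1)"
    and x: "0 < x0" "0 < x1" "1 \<le> x0 * (1 + x0) ^ d0" "1 \<le> x1 * (1 + x1) ^ d1"
  shows "card (stable_sets E r) \<le> 2 powr a0 * exp (x0 * a1) * exp (x1 * (card E choose r))"
proof -
  have deg: "\<exists>v\<in>A. d \<le> card {w \<in> A. adj v w}"
    if A: "A \<subseteq> lvl E r" "b < card A" "0 \<le> b" and d: "real d \<le> r * ((card E - r + 1) * b / (card E choose r) - 1)" for A and b :: real and d :: nat
  proof -
    have "A \<noteq> {}" using A by auto
    then obtain v where v: "v \<in> A" "r * ((card E - r + 1) * card A / (card E choose r) - 1) \<le> card {w \<in> A. adj v w}"
      using high_degree[OF E A(1) _ r] by auto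
    have "r * ((card E - r + 1) * b / (card E choose r) - 1) \<le> r * ((card E - r + 1) * card A / (card E choose r) - 1)"
    proof -
      have h: "real (card E - r + 1) * b \<le> real ((card E - r + 1) * card A)"
        unfolding of_nat_mult using A(2) by (intro mult_left_mono) auto
      show ?thesis by (intro mult_left_mono diff_right_mono divide_right_mono h) auto
    qed
    then have "real d \<le> card {w \<in> A. adj v w}" using v d by linarith
    then show ?thesis using v by auto
  qed
  have expb: "(1 + x) ^ k \<le> exp (x * b)" if "0 < x" "real k \<le> b" for x b :: real and k
  proof -
    have "(1 + x) ^ k \<le> exp x ^ k" using that by (intro power_mono) (auto simp: exp_ge_add_one_self)
    also have "\<dots> = exp (x * k)" by (simp add: exp_of_nat_mult[symmetric] mult.commute)
    also have "\<dots> \<le> exp (x * b)" using that by simp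
    finally show ?thesis .
  qed
  have finl: "finite A" if "A \<subseteq> lvl E r" for A using that finite_lvl[OF E] finite_subset by blast
  have phase2: "stable_count A \<le> 2 powr a0 * exp (x0 * a1)" if A: "A \<subseteq> lvl E r" "card A \<le> a1" for A
  proof -
    have "stable_count A \<le> 2 powr a0 * (1 + x0) ^ card A"
    proof (rule stable_count_bound[OF finl[OF A(1)] x(1,3), where a = a0])
      fix A' assume A': "A' \<subseteq> A" "card A' \<le> a0"
      have "finite A'" using A' finl[OF A(1)] finite_subset by blast
      then have "real (stable_count A') \<le> real (2 ^ card A')" using stable_count_trivial[of A'] by (simp only: of_nat_le_iff)
      also have "\<dots> = 2 powr (card A')" by (simp add: powr_realpow)
      also have "\<dots> \<le> 2 powr a0" using A' by (intro powr_mono) auto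
      finally show "stable_count A' \<le> 2 powr a0" .
    next
      fix A' assume "A' \<subseteq> A" "a0 < card A'"
      then show "\<exists>v\<in>A'. d0 \<le> card {w \<in> A'. adj v w}" using deg[of A' a0 d0] A(1) a d0 by auto
    qed auto
    also have "\<dots> \<le> 2 powr a0 * exp (x0 * a1)" using expb[OF x(1) A(2)] by (intro mult_left_mono) auto
    finally show ?thesis .
  qed
  have "stable_count (lvl E r) \<le> (2 powr a0 * exp (x0 * a1)) * (1 + x1) ^ card (lvl E r)"
  proof (rule stable_count_bound[OF finite_lvl[OF E] x(2,4), where a = a1])
    fix A' assume "A' \<subseteq> lvl E r" "a1 < card A'"
    then show "\<exists>v\<in>A'. d1 \<le> card {w \<in> A'. adj v w}" using deg[of A' a1 d1] a d1 by auto
  qed (use phase2 in auto)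
  also have "\<dots> \<le> (2 powr a0 * exp (x0 * a1)) * exp (x1 * (card E choose r))"
    using expb[OF x(2)] card_lvl[OF E] by (intro mult_left_mono) auto
  finally show ?thesis unfolding stable_count_def stable_sets_def by simp
qed

text \<open>Augmentation can fail only at size \<open>r\<close>. If both \<open>insert y X\<close>
  and \<open>insert z X\<close> were excluded, two members of \<open>V\<close> would be adjacent; if
  \<open>y\<close> is the only choice, then \<open>Y = insert y X\<close>, which is not
  excluded.\<close>

lemma sparse_paving_matroid:
  assumes E: "finite E" and V: "V \<in> stable_sets E r" and r: "1 \<le> r"
  shows "matroid E {X. X \<subseteq> E \<and> card X \<le> r \<and> X \<notin> V}" (is "matroid E ?I")
proof
  have Vr: "card X = r" if "X \<in> V" for X using that V unfolding stable_sets_def lvl_def by auto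
  show "finite E" by fact
  show "{} \<in> ?I" using Vr[of "{}"] r by auto
  show "X \<subseteq> E" if "X \<in> ?I" for X using that by auto
  show "Y \<in> ?I" if X: "X \<in> ?I" and YX: "Y \<subseteq> X" for X Y
  proof -
    have finX: "finite X" using X E finite_subset by auto
    have "card Y \<le> card X" using card_mono[OF finX YX] .
    moreover have "Y \<notin> V"
    proof
      assume "Y \<in> V"
      then have "card Y = r" using Vr by auto
      then have "Y = X" using X card_seteq[OF finX YX] by auto
      then show False using X \<open>Y \<in> V\<close> by auto
    qed
    ultimately show ?thesis using X YX by auto
  qed
  show "\<exists>y\<in>Y - X. insert y X \<in> ?I" if X: "X \<in> ?I" and Y: "Y \<in> ?I" and lt: "card X < card Y" for X Y
  proof -
    have fin: "finite X" "finite Y" using X Y E finite_subset by auto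
    have "\<not> Y \<subseteq> X" using lt card_mono[OF fin(1)] by (meson not_le)
    then obtain y where y: "y \<in> Y" "y \<notin> X" by auto
    have ok: "insert z X \<subseteq> E \<and> card (insert z X) \<le> r" if "z \<in> Y - X" for z using that X Y fin lt by auto
    show ?thesis
    proof (cases "insert y X \<in> V")
      case False then show ?thesis using y ok by auto
    next
      case True
      have cX: "Suc (card X) = r" using Vr[OF True] y fin by auto
      show ?thesis
      proof (cases "Y \<subseteq> insert y X")
        case True
        then have "Y = insert y X" using lt fin y card_seteq[of "insert y X" Y] by auto
        then show ?thesis using Y y by auto
      next
        case False
        then obtain z where z: "z \<in> Y" "z \<notin> X" "z \<noteq> y" by auto
        have "insert z X \<notin> V"
        proof
          assume zV: "insert z X \<in> V"
          have "insert z X = swap (insert y X) y z" using y z unfolding swap_def by auto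
          then have "adj (insert y X) (insert z X)" using adjI[of y "insert y X" z] z by auto
          then show False using V zV \<open>insert y X \<in> V\<close> unfolding stable_sets_def stable_def by auto
        qed
        then show ?thesis using ok z by auto
      qed
    qed
  qed
qed

section \<open>Lower bound on the number of matroids\<close>

lemma finite_matroids: "finite E \<Longrightarrow> finite {\<I>. matroid E \<I>}"
  by (rule finite_subset[of _ "Pow (Pow E)"]) (auto dest: matroid.indep_subset)

lemma stable_sets_le_matroids:
  assumes E: "finite E" and r: "1 \<le> r"
  shows "card (stable_sets E r) \<le> card {\<I>. matroid E \<I>}"
proof (rule card_inj_on_le)
  let ?f = "\<lambda>V. {X. X \<subseteq> E \<and> card X \<le> r \<and> X \<notin> V}"
  show "?f ` stable_sets E r \<subseteq> {\<I>. matroid E \<I>}" using sparse_paving_matroid[OF E _ r] by auto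
  show "finite {\<I>. matroid E \<I>}" using finite_matroids[OF E] .
  show "inj_on ?f (stable_sets E r)"
  proof (rule inj_onI)
    fix V W assume V: "V \<in> stable_sets E r" and W: "W \<in> stable_sets E r" and e: "?f V = ?f W"
    have "X \<in> V \<longleftrightarrow> X \<in> W" for X
    proof (cases "X \<in> lvl E r")
      case True
      then have "X \<in> ?f V \<longleftrightarrow> X \<notin> V" "X \<in> ?f W \<longleftrightarrow> X \<notin> W" unfolding lvl_def by auto
      then show ?thesis using e by simp
    next
      case False then show ?thesis using V W unfolding stable_sets_def by auto
    qed
    then show "V = W" by auto
  qed
qed

text \<open>This is the Graham-Sloane colouring: an exchange in \<open>{1..n}\<close> changes the
  sum by a nonzero amount smaller than \<open>n\<close> in absolute value.\<close>

definition sum_color :: "nat \<Rightarrow> nat set \<Rightarrow> nat" where "sum_color n X = \<Sum>X mod n"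

lemma sum_color_adj:
  assumes "X \<in> lvl {1..n} r" "Y \<in> lvl {1..n} r" "adj X Y"
  shows "sum_color n X \<noteq> sum_color n Y"
proof
  assume e: "sum_color n X = sum_color n Y"
  obtain x y where xy: "x \<in> X" "y \<in> {1..n} - X" "Y = swap X x y" using adj_lvlE[OF assms(3,1,2)] .
  have X: "X \<subseteq> {1..n}" using assms(1) unfolding lvl_def by auto
  then have fin: "finite X" using finite_subset by blast
  have "\<Sum>X = x + \<Sum>(X - {x})" using fin xy(1) by (simp add: sum.remove)
  moreover have "\<Sum>Y = y + \<Sum>(X - {x})" unfolding xy(3) swap_def using fin xy(2) by simp
  ultimately have "(x + \<Sum>(X - {x})) mod n = (y + \<Sum>(X - {x})) mod n" using e unfolding sum_color_def by simp
  then have "int (x + \<Sum>(X - {x})) mod int n = int (y + \<Sum>(X - {x})) mod int n" by (metis of_nat_mod)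
  then have "int n dvd int (x + \<Sum>(X - {x})) - int (y + \<Sum>(X - {x}))" by (simp only: mod_eq_dvd_iff)
  then have "int n dvd int x - int y" by simp
  moreover have "x \<in> {1..n}" "y \<in> {1..n}" using xy X by auto
  then have "\<bar>int x - int y\<bar> < int n" by auto
  ultimately have "int x - int y = 0" using dvd_imp_le_int[of "int x - int y" "int n"] by linarith
  then show False using xy by auto
qed

lemma many_stable_sets:
  assumes "1 \<le> n"
  shows "2 powr ((n choose r) / n) \<le> card (stable_sets {1..n} r)"
proof -
  have "\<exists>i\<in>{..<n}. card (lvl {1..n} r) \<le> card {..<n} * card {X \<in> lvl {1..n} r. sum_color n X = i}"
    by (rule pigeonhole_mult) (use assms finite_lvl[of "{1..n}"] in \<open>auto simp: sum_color_def lessThan_empty_iff\<close>)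
  then obtain i where i: "n choose r \<le> n * card {X \<in> lvl {1..n} r. sum_color n X = i}"
    using card_lvl[of "{1..n}" r] by auto
  define T where "T = {X \<in> lvl {1..n} r. sum_color n X = i}"
  have finT: "finite T" unfolding T_def using finite_lvl[of "{1..n}"] by auto
  have "stable T" unfolding stable_def T_def using sum_color_adj by blast
  then have "Pow T \<subseteq> stable_sets {1..n} r" unfolding stable_sets_def using stable_subset unfolding T_def by blast
  then have "card (Pow T) \<le> card (stable_sets {1..n} r)" by (intro card_mono finite_stable_sets) auto
  then have le: "2 ^ card T \<le> card (stable_sets {1..n} r)" using finT by (simp add: card_Pow)
  have "real (n choose r) \<le> real (n * card T)" using i unfolding T_def by (simp only: of_nat_le_iff)
  then have "real (n choose r) \<le> n * card T" by simp
  then have "(n choose r) / n \<le> card T" using assms by (simp add: divide_le_eq mult.commute)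
  then have "2 powr ((n choose r) / n) \<le> 2 powr card T" by (intro powr_mono) auto
  also have "\<dots> = real (2 ^ card T)" by (simp add: powr_realpow)
  also have "\<dots> \<le> card (stable_sets {1..n} r)" using le by (rule of_nat_mono)
  finally show ?thesis .
qed

section \<open>Bases of matroids and the random basis algorithm\<close>

context matroid
begin

lemma fin_indep: "X \<in> \<I> \<Longrightarrow> finite X"
  using indep_subset finite_ground finite_subset by blast

lemma finite_I: "finite \<I>"
  by (rule finite_subset[of _ "Pow E"]) (use indep_subset finite_ground in auto)

lemma extend_indep:
  assumes "X \<in> \<I>" "Y \<in> \<I>" "card X \<le> card Y"
  shows "\<exists>Z\<in>\<I>. X \<subseteq> Z \<and> Z \<subseteq> X \<union> Y \<and> card Z = card Y"
  using assms
proof (induction "card Y - card X" arbitrary: X)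
  case 0
  then show ?case by (intro bexI[of _ X]) auto
next
  case (Suc n)
  then have "card X < card Y" by linarith
  then obtain y where y: "y \<in> Y - X" "insert y X \<in> \<I>" using indep_augment[OF Suc.prems(1,2)] by auto
  have c: "card (insert y X) = Suc (card X)" using y fin_indep[OF Suc.prems(1)] by auto
  have "\<exists>Z\<in>\<I>. insert y X \<subseteq> Z \<and> Z \<subseteq> insert y X \<union> Y \<and> card Z = card Y"
    by (rule Suc.hyps(1)) (use Suc c y in auto)
  then show ?case using y by blast
qed

lemma basis_indep: "B \<in> bases \<I> \<Longrightarrow> B \<in> \<I>"
  unfolding bases_def by auto

lemma indep_le_basis:
  assumes "B \<in> bases \<I>" "X \<in> \<I>"
  shows "card X \<le> card B"
proof (rule ccontr)
  assume "\<not> ?thesis"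
  then obtain y where "y \<in> X - B" "insert y B \<in> \<I>" using indep_augment[OF basis_indep[OF assms(1)] assms(2)] by auto
  then show False using assms(1) unfolding bases_def by blast
qed

lemma max_is_basis:
  assumes "Z \<in> \<I>" "\<And>X. X \<in> \<I> \<Longrightarrow> card X \<le> card Z"
  shows "Z \<in> bases \<I>"
  unfolding bases_def
proof (intro CollectI conjI ballI impI)
  fix X assume X: "X \<in> \<I>" "Z \<subseteq> X"
  then show "X = Z" using card_seteq[OF fin_indep[OF X(1)] X(2)] assms(2)[OF X(1)] by auto
qed fact

lemma extend_to_basis:
  assumes "B \<in> bases \<I>" "X \<in> \<I>"
  shows "\<exists>Z\<in>bases \<I>. X \<subseteq> Z \<and> Z \<subseteq> X \<union> B"
proof -
  obtain Z where Z: "Z \<in> \<I>" "X \<subseteq> Z" "Z \<subseteq> X \<union> B" "card Z = card B"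
    using extend_indep[OF assms(2) basis_indep[OF assms(1)] indep_le_basis[OF assms]] by auto
  have "Z \<in> bases \<I>" using max_is_basis[OF Z(1)] indep_le_basis[OF assms(1)] Z(4) by auto
  then show ?thesis using Z by auto
qed

lemma bases_nonempty: "bases \<I> \<noteq> {}"
proof -
  have "Max (card ` \<I>) \<in> card ` \<I>" using finite_I indep_empty by (intro Max_in) auto
  then obtain Z where Z: "Z \<in> \<I>" "card Z = Max (card ` \<I>)" by auto
  have "Z \<in> bases \<I>" by (rule max_is_basis[OF Z(1)]) (use Z(2) finite_I in auto)
  then show ?thesis by auto
qed

lemma finite_bases: "finite (bases \<I>)"
  unfolding bases_def using finite_I by auto

lemma bases_card_eq: "A \<in> bases \<I> \<Longrightarrow> B \<in> bases \<I> \<Longrightarrow> card A = card B"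
  using indep_le_basis basis_indep by (meson le_antisym)

lemma basis_system_bases: "\<exists>r\<le>card E. basis_system E r (bases \<I>)"
proof -
  obtain B0 where B0: "B0 \<in> bases \<I>" using bases_nonempty by auto
  have sub: "B \<subseteq> E" if "B \<in> bases \<I>" for B using indep_subset[OF basis_indep[OF that]] .
  have "basis_system E (card B0) (bases \<I>)"
  proof
    show "finite E" by (rule finite_ground)
    show "bases \<I> \<noteq> {}" by (rule bases_nonempty)
    show "B \<in> lvl E (card B0)" if "B \<in> bases \<I>" for B
      using sub[OF that] bases_card_eq[OF that B0] unfolding lvl_def by auto
    fix A B assume A: "A \<in> bases \<I>" and B: "B \<in> bases \<I>"
    have fin: "finite A" "finite B" using fin_indep basis_indep A B by auto
    show "\<exists>y\<in>B - A. swap A x y \<in> bases \<I>" if x: "x \<in> A - B" for x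
    proof -
      have I: "A - {x} \<in> \<I>" using indep_hereditary[OF basis_indep[OF A]] by auto
      have c: "Suc (card (A - {x})) = card A" using x fin by (intro card_Suc_Diff1) auto
      then have "card (A - {x}) < card B" using bases_card_eq[OF A B] by linarith
      then obtain y where y: "y \<in> B - (A - {x})" "insert y (A - {x}) \<in> \<I>"
        using indep_augment[OF I basis_indep[OF B]] by auto
      have yA: "y \<in> B - A" using y x by auto
      have "card (insert y (A - {x})) = card A" using c yA fin by auto
      then have "insert y (A - {x}) \<in> bases \<I>"
        using max_is_basis[OF y(2)] indep_le_basis[OF A] by auto
      then show ?thesis using yA unfolding swap_def by auto
    qed
    show "\<exists>x\<in>A - B. swap A x y \<in> bases \<I>" if y: "y \<in> B - A" for y
    proof -
      \<comment> \<open>Extending this set by elements of \<open>A\<close> loses exactly one element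
        of \<open>A\<close>. As \<open>A \<inter> B\<close> is kept, that element lies outside
        \<open>B\<close>.\<close>
      have "insert y (A \<inter> B) \<in> \<I>" using indep_hereditary[OF basis_indep[OF B]] y by auto
      then obtain Z where Z: "Z \<in> bases \<I>" "insert y (A \<inter> B) \<subseteq> Z" "Z \<subseteq> insert y (A \<inter> B) \<union> A"
        using extend_to_basis[OF A] by blast
      have Zs: "Z \<subseteq> insert y A" "y \<in> Z" using Z by auto
      have "card (insert y A - Z) = card (insert y A) - card Z"
        using Zs fin by (intro card_Diff_subset) (auto intro: finite_subset)
      also have "\<dots> = 1" using fin y bases_card_eq[OF Z(1) A] by auto
      finally obtain x where x: "insert y A - Z = {x}" by (metis card_1_singletonE)
      have "x \<in> A - B" using x Z Zs by auto
      moreover have "Z = swap A x y" using x Zs y unfolding swap_def by auto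
      ultimately show ?thesis using Z(1) by auto
    qed
  qed
  moreover have "card B0 \<le> card E" using sub[OF B0] finite_ground by (rule card_mono[rotated])
  ultimately show ?thesis by auto
qed

lemma indep_iff_bases: "X \<in> \<I> \<longleftrightarrow> (\<exists>B\<in>bases \<I>. X \<subseteq> B)"
proof
  assume "X \<in> \<I>"
  then show "\<exists>B\<in>bases \<I>. X \<subseteq> B" using extend_to_basis bases_nonempty by blast
next
  assume "\<exists>B\<in>bases \<I>. X \<subseteq> B"
  then show "X \<in> \<I>" using indep_hereditary basis_indep by blast
qed

lemma RB_feasible: "feasible E \<I> (RB \<I>)"
  unfolding feasible_def
proof (intro ballI allI impI)
  fix D w xs k assume "D \<in> set_pmf (RB \<I>)"
  then obtain B where B: "B \<in> bases \<I>" "D = select_from B"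
    unfolding RB_def using bases_nonempty finite_bases by auto
  show "selected D w (take k xs) \<in> \<I>"
    unfolding B(2) selected_select_from using indep_hereditary[OF basis_indep[OF B(1)]] by auto
qed

lemma RB_value: "alg_value E (RB \<I>) w = (\<Sum>B\<in>bases \<I>. \<Sum>e\<in>B. w e) / card (bases \<I>)"
proof -
  let ?P = "pmf_of_set (permutations_of_set E)"
  let ?Q = "pmf_of_set (bases \<I>)"
  have sp: "set_pmf ?P = permutations_of_set E"
    using finite_ground by (intro set_pmf_of_set) (auto simp: permutations_of_set_empty_iff)
  have sq: "set_pmf ?Q = bases \<I>" using bases_nonempty finite_bases by (rule set_pmf_of_set)
  have "alg_value E (RB \<I>) w = measure_pmf.expectation (pair_pmf ?P ?Q)
      (\<lambda>p. \<Sum>e\<in>snd p \<inter> set (fst p). w e)"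
    unfolding alg_value_def RB_def pair_map_pmf2 integral_map_pmf
    by (intro arg_cong2[where f = "\<lambda>a b. measure_pmf.expectation a b"] refl ext)
      (auto simp: selected_select_from case_prod_unfold)
  also have "\<dots> = measure_pmf.expectation (pair_pmf ?P ?Q) (\<lambda>p. \<Sum>e\<in>snd p. w e)"
  proof (rule integral_cong_AE)
    show "AE p in measure_pmf (pair_pmf ?P ?Q). (\<Sum>e\<in>snd p \<inter> set (fst p). w e) = (\<Sum>e\<in>snd p. w e)"
    proof (rule AE_pmfI)
      fix p assume "p \<in> set_pmf (pair_pmf ?P ?Q)"
      then have "fst p \<in> permutations_of_set E" "snd p \<in> bases \<I>" using sp sq by auto
      then have "snd p \<inter> set (fst p) = snd p"
        using indep_subset[OF basis_indep] permutations_of_setD(1) by blast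
      then show "(\<Sum>e\<in>snd p \<inter> set (fst p). w e) = (\<Sum>e\<in>snd p. w e)" by simp
    qed
  qed auto
  also have "\<dots> = measure_pmf.expectation ?Q (\<lambda>B. \<Sum>e\<in>B. w e)" by (rule expectation_pair_pmf_snd)
  also have "\<dots> = (\<Sum>B\<in>bases \<I>. \<Sum>e\<in>B. w e) / card (bases \<I>)"
    using bases_nonempty finite_bases by (rule integral_pmf_of_set)
  finally show ?thesis .
qed

lemma RB_competitive:
  fixes c :: real
  assumes c: "0 < c" and pi: "\<And>e. e \<in> E \<Longrightarrow> card (bases \<I>) \<le> c * card {B \<in> bases \<I>. e \<in> B}"
  shows "competitive c E \<I> (RB \<I>)"
  unfolding competitive_def
proof (intro conjI allI impI)
  show "feasible E \<I> (RB \<I>)" by (rule RB_feasible)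
  fix w :: "'a \<Rightarrow> real" assume w: "\<forall>e\<in>E. 0 \<le> w e"
  have b0: "0 < card (bases \<I>)" using bases_nonempty finite_bases by (simp add: card_gt_0_iff)
  have "opt \<I> w \<in> (\<lambda>X. \<Sum>e\<in>X. w e) ` \<I>" unfolding opt_def using finite_I indep_empty by (intro Max_in) auto
  then obtain X where X: "X \<in> \<I>" "opt \<I> w = (\<Sum>e\<in>X. w e)" by auto
  have BE: "B \<subseteq> E" if "B \<in> bases \<I>" for B using indep_subset[OF basis_indep[OF that]] .
  have "(\<Sum>B\<in>bases \<I>. \<Sum>e\<in>B. w e) = (\<Sum>B\<in>bases \<I>. \<Sum>e\<in>E. if e \<in> B then w e else 0)"
  proof (rule sum.cong[OF refl])
    fix B assume "B \<in> bases \<I>"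
    then have "E \<inter> B = B" using BE by auto
    then show "(\<Sum>e\<in>B. w e) = (\<Sum>e\<in>E. if e \<in> B then w e else 0)"
      using finite_ground by (simp flip: sum.inter_restrict)
  qed
  also have "\<dots> = (\<Sum>e\<in>E. \<Sum>B\<in>bases \<I>. if e \<in> B then w e else 0)" by (rule sum.swap)
  also have "\<dots> = (\<Sum>e\<in>E. w e * card {B \<in> bases \<I>. e \<in> B})"
    using finite_bases by (intro sum.cong refl) (simp add: sum.If_cases Int_def mult.commute)
  finally have s: "(\<Sum>B\<in>bases \<I>. \<Sum>e\<in>B. w e) = (\<Sum>e\<in>E. w e * card {B \<in> bases \<I>. e \<in> B})" .
  \<comment> \<open>The optimum is bounded by the total weight of \<open>E\<close>. In the range
    considered here \<open>RB\<close> obtains the share \<open>1 / c\<close> even of that.\<close>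
  have "opt \<I> w * card (bases \<I>) \<le> (\<Sum>e\<in>E. w e) * card (bases \<I>)"
    unfolding X(2) using w indep_subset[OF X(1)] finite_ground by (intro mult_right_mono sum_mono2) auto
  also have "\<dots> = (\<Sum>e\<in>E. w e * card (bases \<I>))" by (simp add: sum_distrib_right)
  also have "\<dots> \<le> (\<Sum>e\<in>E. w e * (c * card {B \<in> bases \<I>. e \<in> B}))"
    using w pi by (intro sum_mono mult_left_mono) auto
  also have "\<dots> = c * (\<Sum>B\<in>bases \<I>. \<Sum>e\<in>B. w e)" unfolding s sum_distrib_left by (intro sum.cong) auto
  also have "\<dots> = c * (alg_value E (RB \<I>) w * card (bases \<I>))" unfolding RB_value using b0 by simp
  finally have "opt \<I> w * card (bases \<I>) \<le> c * alg_value E (RB \<I>) w * card (bases \<I>)" by simp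
  then have "opt \<I> w \<le> c * alg_value E (RB \<I>) w" using b0 by simp
  then show "1 / c * opt \<I> w \<le> alg_value E (RB \<I>) w" using c by (simp add: divide_le_eq mult.commute)
qed

end

lemma card_matroids_le:
  assumes "finite E" "\<And>\<I>. matroid E \<I> \<Longrightarrow> Pr \<I> \<Longrightarrow> \<exists>r\<le>card E. bases \<I> \<in> S r" "\<And>r. finite (S r)"
  shows "card {\<I>. matroid E \<I> \<and> Pr \<I>} \<le> (\<Sum>r\<le>card E. card (S r))"
proof -
  have "card {\<I>. matroid E \<I> \<and> Pr \<I>} \<le> card (\<Union>r\<in>{..card E}. S r)"
  proof (rule card_inj_on_le)
    show "inj_on bases {\<I>. matroid E \<I> \<and> Pr \<I>}"
    proof (rule inj_onI)
      fix \<I> \<J> assume a: "\<I> \<in> {\<I>. matroid E \<I> \<and> Pr \<I>}" "\<J> \<in> {\<I>. matroid E \<I> \<and> Pr \<I>}" "bases \<I> = bases \<J>"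
      have "X \<in> \<I> \<longleftrightarrow> X \<in> \<J>" for X
        using a(1,2) matroid.indep_iff_bases[of E \<I> X] matroid.indep_iff_bases[of E \<J> X] unfolding a(3) by simp
      then show "\<I> = \<J>" by auto
    qed
    show "bases ` {\<I>. matroid E \<I> \<and> Pr \<I>} \<subseteq> (\<Union>r\<in>{..card E}. S r)" using assms(2) by auto
    show "finite (\<Union>r\<in>{..card E}. S r)" using assms(3) by auto
  qed
  also have "\<dots> \<le> (\<Sum>r\<le>card E. card (S r))" by (rule card_UN_le) auto
  finally show ?thesis .
qed

section \<open>Asymptotic estimates\<close>

text \<open>Going down from the middle, the ratio of consecutive coefficients is at most
  \<open>1 - (2 i + 1) / (n - r)\<close>, hence at most \<open>exp (- (2 i + 1) / (n - r))\<close>,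
  and the odd numbers add up to the square. Near \<open>r = n / 2\<close> this gives the correct
  Gaussian constant.\<close>

lemma binomial_decay:
  assumes "r \<le> n div 2"
  shows "real (n choose r) \<le> (n choose (n div 2)) * exp (- ((real (n div 2) - r)\<^sup>2 / (real n - r)))"
proof (cases "n = r")
  case True
  then show ?thesis using assms by simp
next
  case False
  define m where "m = n div 2"
  define D where "D = real n - r"
  have rm: "r \<le> m" "2 * m \<le> n" unfolding m_def using assms by auto
  have D0: "D > 0" unfolding D_def using rm False by simp
  have "real (n choose (m - i)) \<le> (n choose m) * exp (- ((real i)\<^sup>2 / D))" if "i \<le> m - r" for i
    using that
  proof (induction i)
    case 0 then show ?case by simp
  next
    case (Suc i)
    define j where "j = m - Suc i"
    have j: "m - i = Suc j" "Suc j \<le> m" unfolding j_def using Suc.prems by auto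
    have "Suc j * (n choose Suc j) = (n - j) * (n choose j)"
      by (metis binomial_absorb_comp binomial_absorption mult.commute diff_Suc_1 Suc_diff_1 not_gr_zero binomial_eq_0_iff mult_is_0 diff_0_eq_0 zero_less_Suc)
    then have "real (Suc j) * real (n choose Suc j) = real (n - j) * real (n choose j)" by (metis of_nat_mult)
    moreover have nj: "real (n - j) = real n - m + i + 1" unfolding j_def using Suc.prems rm by (simp add: of_nat_diff)
    moreover have sj: "real (Suc j) = real m - i" using j Suc.prems by (simp add: of_nat_diff)
    ultimately have "(real m - i) * real (n choose Suc j) = (real n - m + i + 1) * real (n choose j)" by simp
    moreover have den: "0 < real n - m + i + 1" using rm by simp
    ultimately have e: "real (n choose j) = real (n choose Suc j) * ((real m - i) / (real n - m + i + 1))"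
      by (simp add: nonzero_eq_divide_eq mult.commute)
    have "(real m - i) / (real n - m + i + 1) = 1 - (real n - 2 * m + 2 * i + 1) / (real n - m + i + 1)"
      using den by (simp add: field_simps)
    also have "\<dots> \<le> 1 - (2 * i + 1) / (real n - m + i + 1)"
      using den rm by (intro diff_left_mono divide_right_mono) auto
    also have "\<dots> \<le> 1 - (2 * i + 1) / D"
      unfolding D_def using den Suc.prems rm by (intro diff_left_mono divide_left_mono mult_pos_pos) auto
    also have "\<dots> \<le> exp (- ((2 * i + 1) / D))" using exp_ge_add_one_self[of "- ((2 * i + 1) / D)"] by simp
    finally have q: "(real m - i) / (real n - m + i + 1) \<le> exp (- ((2 * i + 1) / D))" .
    have "real (n choose (m - Suc i)) \<le> real (n choose (m - i)) * exp (- ((2 * i + 1) / D))"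
      unfolding j_def[symmetric] j(1) e by (intro mult_left_mono q) auto
    also have "\<dots> \<le> ((n choose m) * exp (- ((real i)\<^sup>2 / D))) * exp (- ((2 * i + 1) / D))"
      using Suc by (intro mult_right_mono) auto
    also have "\<dots> = (n choose m) * exp (- ((real (Suc i))\<^sup>2 / D))"
      by (simp add: mult.assoc exp_add[symmetric] add_divide_distrib[symmetric] diff_divide_distrib[symmetric] power2_eq_square algebra_simps)
    finally show ?case .
  qed
  from this[of "m - r"] show ?thesis using rm unfolding m_def D_def by (simp add: of_nat_diff)
qed

text \<open>With \<open>t = k / card A \<le> 1\<close>, the partial binomial sum times
  \<open>t ^ k\<close> is at most \<open>(1 + t) ^ card A \<le> exp k\<close>.\<close>

lemma card_smallfam:
  assumes "finite A" "1 \<le> k" "k \<le> card A"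
  shows "card (smallfam A k) \<le> exp (k * (1 + ln (card A / k)))"
proof -
  define a where "a = card A"
  have a0: "0 < a" "0 < k" using assms unfolding a_def by auto
  have "smallfam A k = (\<Union>j\<in>{..k}. lvl A j)" unfolding smallfam_def lvl_def by auto
  then have "card (smallfam A k) \<le> (\<Sum>j\<le>k. card (lvl A j))" by (simp add: card_UN_le)
  also have "\<dots> = (\<Sum>j\<le>k. a choose j)" using card_lvl[OF assms(1)] unfolding a_def by simp
  finally have s: "real (card (smallfam A k)) \<le> real (\<Sum>j\<le>k. a choose j)" by (simp only: of_nat_le_iff)
  define t where "t = real k / a"
  have t: "0 < t" "t \<le> 1" unfolding t_def using a0 assms a_def by auto
  have "real (\<Sum>j\<le>k. a choose j) * t ^ k = (\<Sum>j\<le>k. real (a choose j) * t ^ k)" by (simp add: sum_distrib_right)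
  also have "\<dots> \<le> (\<Sum>j\<le>k. real (a choose j) * t ^ j)"
    using t by (intro sum_mono mult_left_mono power_decreasing) auto
  also have "\<dots> \<le> (\<Sum>j\<le>a. real (a choose j) * t ^ j)"
    using t assms(3) unfolding a_def by (intro sum_mono2) auto
  also have "\<dots> = (t + 1) ^ a" by (simp add: binomial_ring)
  also have "\<dots> \<le> exp t ^ a" using t exp_ge_add_one_self[of t] by (intro power_mono) (auto simp: add.commute)
  also have "\<dots> = exp k" unfolding t_def using a0 by (simp add: exp_of_nat_mult[symmetric])
  finally have "real (\<Sum>j\<le>k. a choose j) * t ^ k \<le> exp k" .
  then have "real (\<Sum>j\<le>k. a choose j) \<le> exp k / t ^ k" using t by (simp add: pos_le_divide_eq)
  also have "\<dots> = exp k * (a / k) ^ k" unfolding t_def by (simp add: power_divide)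
  also have "(a / k) ^ k = exp (k * ln (a / k))" using a0 by (simp add: exp_of_nat_mult)
  finally have "real (\<Sum>j\<le>k. a choose j) \<le> exp (k * (1 + ln (a / k)))" by (simp add: exp_add[symmetric] algebra_simps)
  then show ?thesis using s unfolding a_def by linarith
qed

section \<open>Central binomial coefficients and the choice of parameters\<close>

definition central_binom :: "nat \<Rightarrow> real" where "central_binom n = real (n choose (n div 2))"

lemma central_binom_le: "real (n choose r) \<le> central_binom n"
  unfolding central_binom_def using binomial_maximum by simp

lemma central_binom_ge: "2 ^ n / (n + 1) \<le> central_binom n"
proof -
  have "(\<Sum>j\<le>n. real (n choose j)) \<le> (\<Sum>j\<le>n. central_binom n)" by (intro sum_mono central_binom_le)
  moreover have "(\<Sum>j\<le>n. real (n choose j)) = 2 ^ n"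
    using choose_row_sum[of n] by (metis of_nat_numeral of_nat_power of_nat_sum)
  ultimately have "2 ^ n \<le> (n + 1) * central_binom n" by simp
  then show ?thesis by (simp add: pos_divide_le_eq mult.commute add.commute)
qed

lemma central_binom_pos: "0 < central_binom n"
  unfolding central_binom_def by (simp add: zero_less_binomial_iff)

lemma central_binom_le_2: "central_binom n \<le> 2 ^ n"
proof -
  have "n choose (n div 2) \<le> 2 ^ n" using choose_row_sum[of n] member_le_sum[of "n div 2" "{..n}" "\<lambda>k. n choose k"] by simp
  then show ?thesis unfolding central_binom_def by (metis of_nat_le_iff of_nat_numeral of_nat_power)
qed

text \<open>The exponent \<open>1.9\<close> only has to lie between \<open>3/2\<close> and \<open>2\<close>: the code then costs about
  \<open>C(n, n/2) n\<^sup>-\<^sup>1\<^sup>.\<^sup>9 log\<^sup>2 n\<close> bits, less than what a proportion of slightly less than \<open>1 / sqrt n\<close>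
  of unexpected nonbases gains, while small circuits still have sublinear size.\<close>

definition rate_threshold :: "nat \<Rightarrow> nat" where "rate_threshold n = nat \<lceil>real n powr 1.9\<rceil>"
definition small_size :: "nat \<Rightarrow> nat" where "small_size n = nat \<lceil>10 * real n powr 0.9\<rceil>"
definition greedy_steps :: "nat \<Rightarrow> nat" where "greedy_steps n = nat \<lceil>6 * central_binom n * ln n / real n powr 1.9\<rceil>"
definition cover_size :: "nat \<Rightarrow> nat" where "cover_size n = nat \<lceil>6 * central_binom n * ln n / real n powr 1.9 + 1 + central_binom n / n\<^sup>2\<rceil>"

lemma nat_ceil_bounds: "0 \<le> x \<Longrightarrow> x \<le> nat \<lceil>x\<rceil> \<and> real (nat \<lceil>x\<rceil>) \<le> x + 1" for x :: real
  by (simp add: of_nat_nat of_int_ceiling_le_add_one)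

lemma rate_threshold_bounds: "real n powr 1.9 \<le> rate_threshold n" "rate_threshold n \<le> real n powr 1.9 + 1"
  using nat_ceil_bounds[of "real n powr 1.9"] unfolding rate_threshold_def by auto

lemma small_size_bounds: "10 * real n powr 0.9 \<le> small_size n" "small_size n \<le> 10 * real n powr 0.9 + 1"
  using nat_ceil_bounds[of "10 * real n powr 0.9"] unfolding small_size_def by auto

lemma eventually_code_params:
  "\<forall>\<^sub>F n in sequentially. \<forall>r. n \<le> 3 * r \<longrightarrow> 3 * r \<le> 2 * n \<longrightarrow> code_params {1..n} r (rate_threshold n) (small_size n) (greedy_steps n) (cover_size n)"
proof -
  have 1: "\<forall>\<^sub>F n::nat in sequentially. 50 * (real n powr 1.9 + 1) \<le> real n ^ 2" by real_asymp
  have 2: "\<forall>\<^sub>F n::nat in sequentially. 8 * (real n powr 1.9 + 1) \<le> 10 * real n powr 0.9 * real n" by real_asymp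
  have 3: "\<forall>\<^sub>F n::nat in sequentially. 8 * (10 * real n powr 0.9 + 1) < real n" by real_asymp
  show ?thesis using 1 2 3 eventually_ge_at_top[of 2]
  proof eventually_elim
    case (elim n)
    show ?case
    proof (intro allI impI)
      fix r assume r: "n \<le> 3 * r" "3 * r \<le> 2 * n"
      have n0: "0 < real n" using elim by simp
      have "0 < real n powr 1.9" using n0 by simp
      then have rp: "0 < rate_threshold n" using rate_threshold_bounds(1)[of n] by (metis gr0I not_less of_nat_0)
      have "real (50 * rate_threshold n) \<le> real (n ^ 2)" using rate_threshold_bounds(2)[of n] elim(1) by simp
      then have r50: "50 * rate_threshold n \<le> n ^ 2" by (simp only: of_nat_le_iff)
      have "8 * real (rate_threshold n) \<le> 8 * (real n powr 1.9 + 1)" using rate_threshold_bounds(2)[of n] by simp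
      also note elim(2)
      also have "10 * real n powr 0.9 * real n \<le> real (small_size n) * real n" using small_size_bounds(1)[of n] by (intro mult_right_mono) auto
      finally have "real (8 * rate_threshold n) \<le> real (small_size n * n)" by simp
      then have r8: "8 * rate_threshold n \<le> small_size n * n" by (simp only: of_nat_le_iff)
      have "real (8 * small_size n) < real n" using small_size_bounds(2)[of n] elim(3) by simp
      then have d8: "8 * small_size n < n" by (simp only: of_nat_less_iff)
      define z where "z = 6 * central_binom n * ln n / real n powr 1.9"
      have z0: "0 \<le> z" unfolding z_def using central_binom_pos[of n] elim(4) by simp
      have mz: "z \<le> greedy_steps n" "greedy_steps n \<le> z + 1" using nat_ceil_bounds[OF z0] unfolding greedy_steps_def z_def by auto
      have kz: "z + 1 + central_binom n / n\<^sup>2 \<le> cover_size n"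
        using nat_ceil_bounds[of "z + 1 + central_binom n / n\<^sup>2"] z0 central_binom_pos[of n] unfolding cover_size_def z_def by auto
      \<comment> \<open>The factor 6 is 3 for the three levels of tokens times 2: the greedy steps
        then leave at most a proportion \<open>1 / n^2\<close>, which is the last summand of
        \<open>cover_size\<close>.\<close>
      have "6 * central_binom n * ln n = real n powr 1.9 * z" unfolding z_def using n0 by simp
      also have "\<dots> \<le> real (rate_threshold n) * greedy_steps n" using rate_threshold_bounds(1)[of n] mz z0 by (intro mult_mono) auto
      finally have "2 * ln n \<le> real (rate_threshold n) * greedy_steps n / (3 * central_binom n)" using central_binom_pos[of n] by (simp add: pos_le_divide_eq mult.assoc mult.commute mult.left_commute)
      then have "exp (- (real (rate_threshold n) * greedy_steps n / (3 * central_binom n))) \<le> exp (- (2 * ln n))" by simp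
      also have "\<dots> = 1 / n\<^sup>2" using n0 by (simp add: exp_minus ln_realpow[symmetric] inverse_eq_divide flip: ln_powr)
      finally have ex: "exp (- (real (rate_threshold n) * greedy_steps n / (3 * central_binom n))) \<le> 1 / n\<^sup>2" .
      have "greedy_steps n + (n choose r) * exp (- (real (rate_threshold n) * greedy_steps n / (3 * central_binom n))) \<le> (z + 1) + central_binom n * (1 / n\<^sup>2)"
        using mz ex central_binom_le[of n r] by (intro add_mono mult_mono) auto
      also have "\<dots> \<le> cover_size n" using kz by simp
      finally have kb: "greedy_steps n + (n choose r) * exp (- (real (rate_threshold n) * greedy_steps n / (3 * central_binom n))) \<le> cover_size n" .
      show "code_params {1..n} r (rate_threshold n) (small_size n) (greedy_steps n) (cover_size n)"
        by (rule code_params.intro) (use r rp r50 r8 d8 kb in \<open>simp_all add: central_binom_def\<close>)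
    qed
  qed
qed

text \<open>Moving from exponent 1.9 to 1.85 absorbs the factor \<open>log^2 n\<close>; 1.85 must in
  turn exceed the exponent 1.82 of the gain in \<open>eventually_good\<close>. The families of small
  sets cost only \<open>exp (O(n^0.9 log n))\<close> bits.\<close>

lemma eventually_codeN:
  "\<forall>\<^sub>F n in sequentially. codeN {1..n} (cover_size n) (small_size n) \<le> exp (central_binom n * real n powr (-1.85))"
proof -
  have 1: "\<forall>\<^sub>F n::nat in sequentially. 3 * ((6 * ln n * real n powr (-1.9) + 2 / real n ^ 2) * (1 + ln ((real n + 1) * real n ^ 2))) \<le> real n powr (-1.85) / 2"
    by real_asymp
  have 2: "\<forall>\<^sub>F n::nat in sequentially. 2 * exp ((10 * real n powr 0.9 + 1) * (1 + ln n)) \<le> 2 ^ n / (real n + 1) * (real n powr (-1.85) / 2)"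
    by real_asymp
  have 3: "\<forall>\<^sub>F n::nat in sequentially. 2 * real n ^ 2 \<le> 2 ^ n / (real n + 1)" by real_asymp
  have 4: "\<forall>\<^sub>F n::nat in sequentially. 6 * ln n * real n powr (-1.9) + 2 / real n ^ 2 \<le> 1" by real_asymp
  have 5: "\<forall>\<^sub>F n::nat in sequentially. 10 * real n powr 0.9 + 1 \<le> real n" by real_asymp
  show ?thesis using 1 2 3 4 5 eventually_ge_at_top[of 2]
  proof eventually_elim
    case (elim n)
    define N where "N = central_binom n"
    define h where "h = 6 * ln n * real n powr (-1.9) + 2 / real n ^ 2"
    have n0: "0 < real n" "1 \<le> real n" using elim(6) by auto
    have N0: "0 < N" unfolding N_def by (rule central_binom_pos)
    have Nge: "2 ^ n / (real n + 1) \<le> N" unfolding N_def using central_binom_ge[of n] by simp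
    have "2 * real n ^ 2 \<le> N" using elim(3) Nge by linarith
    then have "2 \<le> N / real n ^ 2" using n0 by (simp add: pos_le_divide_eq)
    define z where "z = 6 * N * ln n / real n powr 1.9 + 1 + N / n\<^sup>2"
    have z0: "0 \<le> z" unfolding z_def using N0 n0 by simp
    have kz: "z \<le> cover_size n" "cover_size n \<le> z + 1" using nat_ceil_bounds[OF z0] unfolding cover_size_def z_def N_def by auto
    have "N * h = 6 * N * ln n / real n powr 1.9 + N / real n ^ 2 + N / real n ^ 2"
      unfolding h_def by (simp only: powr_minus divide_inverse distrib_left)
    then have "z + 1 \<le> N * h" unfolding z_def using \<open>2 \<le> N / real n ^ 2\<close> by simp
    then have kN: "cover_size n \<le> N * h" using kz by linarith
    have "real (cover_size n) \<le> N * 1" using kN elim(4) N0 unfolding h_def by (meson mult_left_mono less_imp_le order_trans)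
    also have "\<dots> \<le> 2 ^ n" unfolding N_def using central_binom_le_2 by simp
    finally have "real (cover_size n) \<le> real (2 ^ n)" by simp
    then have k2: "cover_size n \<le> 2 ^ n" by (simp only: of_nat_le_iff)
    have "0 \<le> 6 * N * ln n / real n powr 1.9" using N0 n0 by simp
    moreover have "0 \<le> N / n\<^sup>2" using N0 by simp
    ultimately have "1 \<le> real (cover_size n)" using kz unfolding z_def by linarith
    then have k1: "1 \<le> cover_size n" by simp
    have "card (Pow {1..n}) = 2 ^ n" by (simp add: card_Pow)
    then have s1: "card (smallfam (Pow {1..n}) (cover_size n)) \<le> exp (cover_size n * (1 + ln (2 ^ n / cover_size n)))"
      using card_smallfam[of "Pow {1..n}" "cover_size n"] k1 k2 by simp
    have "N / n\<^sup>2 \<le> cover_size n" using kz \<open>0 \<le> 6 * N * ln n / real n powr 1.9\<close> unfolding z_def by linarith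
    have "2 ^ n \<le> (real n + 1) * N" using Nge n0 by (simp add: pos_divide_le_eq mult.commute)
    also have "\<dots> = (real n + 1) * real n ^ 2 * (N / n\<^sup>2)" using n0 by simp
    also have "\<dots> \<le> (real n + 1) * real n ^ 2 * cover_size n" using \<open>N / n\<^sup>2 \<le> cover_size n\<close> by (intro mult_left_mono) auto
    finally have "2 ^ n / cover_size n \<le> (real n + 1) * real n ^ 2" using k1 by (simp add: pos_divide_le_eq)
    then have l1: "ln (2 ^ n / cover_size n) \<le> ln ((real n + 1) * real n ^ 2)" using k1 n0 by (subst ln_le_cancel_iff) auto
    have lpos: "0 \<le> ln ((real n + 1) * real n ^ 2)" using n0 by (intro ln_ge_zero) (simp add: mult_ge1_I)
    have "cover_size n * (1 + ln (2 ^ n / cover_size n)) \<le> cover_size n * (1 + ln ((real n + 1) * real n ^ 2))" using l1 by (intro mult_left_mono) auto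
    also have "\<dots> \<le> (N * h) * (1 + ln ((real n + 1) * real n ^ 2))" using kN lpos by (intro mult_right_mono) auto
    finally have "exp (cover_size n * (1 + ln (2 ^ n / cover_size n))) \<le> exp (N * (h * (1 + ln ((real n + 1) * real n ^ 2))))" by (simp add: mult.assoc)
    then have s1': "card (smallfam (Pow {1..n}) (cover_size n)) \<le> exp (N * (h * (1 + ln ((real n + 1) * real n ^ 2))))" using s1 by linarith
    have "real (card (smallfam (Pow {1..n}) (cover_size n))) ^ 3 \<le> exp (N * (h * (1 + ln ((real n + 1) * real n ^ 2)))) ^ 3"
      using s1' by (intro power_mono) auto
    also have "\<dots> = exp (N * (3 * (h * (1 + ln ((real n + 1) * real n ^ 2)))))"
      by (simp add: exp_of_nat_mult[symmetric] mult.left_commute)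
    also have "\<dots> \<le> exp (N * (real n powr (-1.85) / 2))"
      using elim(1) N0 unfolding h_def by (subst exp_le_cancel_iff) (intro mult_left_mono, auto)
    finally have p1: "real (card (smallfam (Pow {1..n}) (cover_size n))) ^ 3 \<le> exp (N * (real n powr (-1.85) / 2))" .
    have dn: "small_size n \<le> n" using small_size_bounds(2)[of n] elim(5) by linarith
    have d1: "1 \<le> small_size n"
    proof -
      have "0 < 10 * real n powr 0.9" using n0 by simp
      then have "0 < real (small_size n)" using small_size_bounds(1)[of n] by linarith
      then show ?thesis by simp
    qed
    have "card (smallfam {1..n} (small_size n)) \<le> exp (small_size n * (1 + ln (n / small_size n)))"
      using card_smallfam[of "{1..n}" "small_size n"] dn d1 by simp
    also have "\<dots> \<le> exp ((10 * real n powr 0.9 + 1) * (1 + ln n))"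
    proof -
      have "real n / small_size n \<le> n" using d1 n0 by (simp add: divide_le_eq_1 pos_divide_le_eq)
      then have "ln (n / small_size n) \<le> ln n" using d1 n0 by (subst ln_le_cancel_iff) auto
      moreover have "1 \<le> real n / small_size n" using dn d1 by (simp add: pos_le_divide_eq)
      then have "0 \<le> ln (n / small_size n)" by simp
      ultimately show ?thesis using small_size_bounds(2)[of n] by (subst exp_le_cancel_iff) (intro mult_mono, auto)
    qed
    finally have s2: "card (smallfam {1..n} (small_size n)) \<le> exp ((10 * real n powr 0.9 + 1) * (1 + ln n))" .
    have "real ((2 ^ card (smallfam {1..n} (small_size n))) ^ 2) = 2 powr (2 * card (smallfam {1..n} (small_size n)))"
      by (simp add: powr_realpow[symmetric] power_mult[symmetric] mult.commute flip: powr_realpow of_nat_mult)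
    also have "\<dots> \<le> exp 1 powr (2 * card (smallfam {1..n} (small_size n)))" using exp_ge_add_one_self[of 1] by (intro powr_mono2) auto
    also have "\<dots> = exp (2 * card (smallfam {1..n} (small_size n)))" by (simp add: exp_powr_real)
    also have "\<dots> \<le> exp (2 * exp ((10 * real n powr 0.9 + 1) * (1 + ln n)))" using s2 by simp
    also have "\<dots> \<le> exp (N * (real n powr (-1.85) / 2))"
    proof (subst exp_le_cancel_iff)
      have "2 ^ n / (real n + 1) * (real n powr (-1.85) / 2) \<le> N * (real n powr (-1.85) / 2)"
        by (rule mult_right_mono[OF Nge]) simp
      then show "2 * exp ((10 * real n powr 0.9 + 1) * (1 + ln n)) \<le> N * (real n powr (-1.85) / 2)"
        using elim(2) by (rule order_trans[rotated])
    qed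
    finally have p2: "real ((2 ^ card (smallfam {1..n} (small_size n))) ^ 2) \<le> exp (N * (real n powr (-1.85) / 2))" .
    have "real (codeN {1..n} (cover_size n) (small_size n)) = real (card (smallfam (Pow {1..n}) (cover_size n))) ^ 3 * real ((2 ^ card (smallfam {1..n} (small_size n))) ^ 2)"
      unfolding codeN_def by simp
    also have "\<dots> \<le> exp (N * (real n powr (-1.85) / 2)) * exp (N * (real n powr (-1.85) / 2))"
      using p1 p2 by (intro mult_mono) auto
    also have "\<dots> = exp (N * real n powr (-1.85))" by (simp add: exp_add[symmetric])
    finally show ?case unfolding N_def .
  qed
qed

text \<open>For \<open>x \<le> 1/2\<close> one has \<open>x / 2 \<le> ln (1 + x)\<close>. The growth
  condition of the Kleitman-Winston step thereby becomes one on elementary functions, with the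
  integer degree replaced by a real lower bound.\<close>

lemma pow_cond:
  fixes x y :: real
  assumes "0 < x" "x \<le> 1 / 2" "y \<le> real d" "1 \<le> x * exp (y * x / 2)"
  shows "1 \<le> x * (1 + x) ^ d"
proof -
  have "x\<^sup>2 \<le> x / 2" using assms(1,2) by (simp add: power2_eq_square)
  moreover have "x - x\<^sup>2 \<le> ln (1 + x)" using assms by (intro ln_one_plus_pos_lower_bound) auto
  ultimately have l: "x / 2 \<le> ln (1 + x)" by linarith
  have "y * (x / 2) \<le> d * (x / 2)" using assms by (intro mult_right_mono) auto
  also have "\<dots> \<le> d * ln (1 + x)" using l by (intro mult_left_mono) auto
  finally have "exp (y * x / 2) \<le> exp (d * ln (1 + x))" by simp
  also have "\<dots> = (1 + x) ^ d" using assms(1) by (simp add: exp_of_nat_mult)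
  finally have "x * exp (y * x / 2) \<le> x * (1 + x) ^ d" using assms(1) by (intro mult_left_mono) auto
  then show ?thesis using assms(4) by linarith
qed

lemma nat_floor_bounds: "0 \<le> x \<Longrightarrow> real (nat \<lfloor>x\<rfloor>) \<le> x \<and> x - 1 \<le> nat \<lfloor>x\<rfloor>" for x :: real
  by (simp add: of_nat_nat)

text \<open>At distance \<open>sqrt (2 n ln n)\<close> from the middle,
  \<open>binomial_decay\<close> gives at most the proportion \<open>n^-2\<close> of the central
  coefficient; the summand 1 pays for rounding \<open>n / 2\<close>.\<close>

definition rank_window :: "nat \<Rightarrow> real" where "rank_window n = sqrt (2 * n * ln n) + 1"

text \<open>Taking \<open>a0 = (1 + \<epsilon>) N / (n - r + 1)\<close> makes the bound of
  \<open>high_degree\<close> equal to \<open>\<epsilon> r\<close>, linear in \<open>n\<close>;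
  \<open>a1 = N / sqrt n\<close> yields degree of order \<open>n^1.5\<close>. The values
  \<open>x0 = n^-0.9\<close> and \<open>x1 = n^-1.4\<close> make degree times \<open>x\<close> grow
  like \<open>n^0.1\<close>, as \<open>pow_cond\<close> demands, and each phase then costs
  \<open>N n^-1.4\<close> in the exponent. One factor \<open>1 + \<epsilon>\<close> comes from
  \<open>a0\<close>, the other from replacing \<open>n - r + 1\<close> by
  \<open>n / 2\<close>.\<close>

lemma eventually_stable_sets:
  fixes \<epsilon> :: real
  assumes "0 < \<epsilon>"
  shows "\<forall>\<^sub>F n in sequentially. \<forall>r. \<bar>real r - n / 2\<bar> \<le> rank_window n \<longrightarrow>
    card (stable_sets {1..n} r) \<le> exp (ln 2 * ((1 + \<epsilon>)\<^sup>2 * 2 * (n choose r) / n) + 2 * central_binom n * real n powr (-1.4))"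
proof -
  define \<kappa> where "\<kappa> = 1 / 2 - 1 / (2 * (1 + \<epsilon>))"
  have \<kappa>: "0 < \<kappa>" unfolding \<kappa>_def using assms by (simp add: field_simps)
  have 1: "\<forall>\<^sub>F n::nat in sequentially. sqrt (2 * real n * ln (real n)) + 1 \<le> real n / 6" by real_asymp
  have 2: "\<forall>\<^sub>F n::nat in sequentially. sqrt (2 * real n * ln (real n)) + 1 \<le> \<kappa> * real n" using \<kappa> by real_asymp
  have 3: "\<forall>\<^sub>F n::nat in sequentially. 1 \<le> real n powr (-0.9) * exp ((\<epsilon> * real n / 3 - 1) * real n powr (-0.9) / 2)" using assms by real_asymp
  have 4: "\<forall>\<^sub>F n::nat in sequentially. real n powr 1.5 / 20 \<le> real n / 3 * (real n / 3 * real n powr (-0.5) - 1)" by real_asymp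
  have 5: "\<forall>\<^sub>F n::nat in sequentially. 1 \<le> real n powr (-1.4) * exp ((real n powr 1.5 / 20 - 1) * real n powr (-1.4) / 2)" by real_asymp
  have 6: "\<forall>\<^sub>F n::nat in sequentially. real n powr (-0.9) \<le> 1 / 2" by real_asymp
  have 7: "\<forall>\<^sub>F n::nat in sequentially. real n powr (-1.4) \<le> 1 / 2" by real_asymp
  have 8: "\<forall>\<^sub>F n::nat in sequentially. 0 \<le> real n / 3 * real n powr (-0.5) - 1" by real_asymp
  show ?thesis using 1 2 3 4 5 6 7 8 eventually_ge_at_top[of 6]
  proof eventually_elim
    case (elim n)
    show ?case
    proof (intro allI impI)
      fix r assume r: "\<bar>real r - n / 2\<bar> \<le> rank_window n"
      define x where "x = real n"
      have x0: "0 < x" unfolding x_def using elim(9) by simp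
      have dv: "rank_window n \<le> x / 6" "rank_window n \<le> \<kappa> * x" using elim(1,2) unfolding rank_window_def x_def by auto
      have rb: "x / 3 \<le> r" "r \<le> 2 * x / 3" using r dv unfolding x_def by linarith+
      have rn: "1 \<le> r" "r \<le> n"
      proof -
        have "0 < real r" using rb x0 by linarith
        then show "1 \<le> r" by simp
        have "real r \<le> real n" using rb x0 unfolding x_def by linarith
        then show "r \<le> n" by simp
      qed
      define N where "N = real (n choose r)"
      have N0: "0 < N" unfolding N_def using rn by (simp add: zero_less_binomial_iff)
      define D where "D = real (n - r + 1)"
      have D: "D = x - r + 1" unfolding D_def x_def using rn by (simp add: of_nat_diff)
      have D0: "0 < D" "x / 3 \<le> D" using rb D x0 by linarith+
      have "x / 2 - \<kappa> * x \<le> D" using r dv D unfolding x_def by linarith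
      moreover have "x / 2 - \<kappa> * x = x / (2 * (1 + \<epsilon>))" unfolding \<kappa>_def by (simp add: algebra_simps)
      ultimately have D1: "x / (2 * (1 + \<epsilon>)) \<le> D" by simp
      define a0 where "a0 = (1 + \<epsilon>) * N / D"
      define a1 where "a1 = N * x powr (-0.5)"
      define d0 where "d0 = nat \<lfloor>\<epsilon> * r\<rfloor>"
      define d1 where "d1 = nat \<lfloor>x powr 1.5 / 20\<rfloor>"
      have er: "0 \<le> \<epsilon> * r" using assms by simp
      have d0: "real d0 \<le> \<epsilon> * r" "\<epsilon> * r - 1 \<le> real d0" unfolding d0_def using nat_floor_bounds[OF er] by auto
      have d1: "real d1 \<le> x powr 1.5 / 20" "x powr 1.5 / 20 - 1 \<le> real d1" unfolding d1_def using nat_floor_bounds[of "x powr 1.5 / 20"] by auto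
      have c0: "real d0 \<le> r * (D * a0 / N - 1)" using d0(1) N0 D0 unfolding a0_def by (simp add: mult.commute)
      have c1: "real d1 \<le> r * (D * a1 / N - 1)"
      proof -
        have "real d1 \<le> x / 3 * (x / 3 * x powr (-0.5) - 1)" using d1(1) elim(4) unfolding x_def by (rule order_trans)
        also have "\<dots> \<le> r * (D * x powr (-0.5) - 1)"
          using rb(1) D0 elim(8) x0 unfolding x_def[symmetric] by (intro mult_mono diff_right_mono mult_right_mono) auto
        also have "D * x powr (-0.5) = D * a1 / N" unfolding a1_def using N0 by simp
        finally show ?thesis .
      qed
      have p0: "1 \<le> x powr (-0.9) * (1 + x powr (-0.9)) ^ d0"
      proof (rule pow_cond)
        have "\<epsilon> * (x / 3) \<le> \<epsilon> * r" using rb(1) assms by (intro mult_left_mono) auto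
        then show "\<epsilon> * x / 3 - 1 \<le> real d0" using d0(2) by simp
      qed (use elim(3,6) x0 in \<open>auto simp: x_def\<close>)
      have p1: "1 \<le> x powr (-1.4) * (1 + x powr (-1.4)) ^ d1"
        by (rule pow_cond[OF _ _ d1(2)]) (use elim(5,7) x0 in \<open>auto simp: x_def\<close>)
      have "card (stable_sets {1..n} r) \<le> 2 powr a0 * exp (x powr (-0.9) * a1) * exp (x powr (-1.4) * (card {1..n} choose r))"
      proof (rule stable_sets_bound)
        show "real d0 \<le> r * (real (card {1..n} - r + 1) * a0 / (card {1..n} choose r) - 1)" using c0 unfolding D_def N_def by simp
        show "real d1 \<le> r * (real (card {1..n} - r + 1) * a1 / (card {1..n} choose r) - 1)" using c1 unfolding D_def N_def by simp
        show "0 \<le> a0" "0 \<le> a1" unfolding a0_def a1_def using assms N0 D0 by auto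
      qed (use rn p0 p1 x0 in auto)
      also have "\<dots> = exp (ln 2 * a0 + x powr (-0.9) * a1 + x powr (-1.4) * N)"
        unfolding N_def by (simp add: exp_add powr_def mult.commute)
      also have "\<dots> \<le> exp (ln 2 * ((1 + \<epsilon>)\<^sup>2 * 2 * N / x) + 2 * central_binom n * x powr (-1.4))"
      proof (subst exp_le_cancel_iff)
        have "a0 \<le> (1 + \<epsilon>) * N / (x / (2 * (1 + \<epsilon>)))"
          unfolding a0_def using assms N0 x0 D1 D0 by (intro divide_left_mono mult_pos_pos divide_pos_pos) auto
        also have "\<dots> = (1 + \<epsilon>)\<^sup>2 * 2 * N / x" by (simp add: power2_eq_square)
        finally have "ln 2 * a0 \<le> ln 2 * ((1 + \<epsilon>)\<^sup>2 * 2 * N / x)" by (intro mult_left_mono) auto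
        moreover have "x powr (-0.9) * a1 = N * x powr (-1.4)" unfolding a1_def by (simp add: powr_add[symmetric])
        moreover have "N * x powr (-1.4) \<le> central_binom n * x powr (-1.4)" unfolding N_def using central_binom_le by (intro mult_right_mono) auto
        ultimately show "ln 2 * a0 + x powr (-0.9) * a1 + x powr (-1.4) * N \<le> ln 2 * ((1 + \<epsilon>)\<^sup>2 * 2 * N / x) + 2 * central_binom n * x powr (-1.4)"
          by (simp add: mult.commute)
      qed
      finally show "card (stable_sets {1..n} r) \<le> exp (ln 2 * ((1 + \<epsilon>)\<^sup>2 * 2 * (n choose r) / n) + 2 * central_binom n * real n powr (-1.4))"
        unfolding N_def x_def .
    qed
  qed
qed

section \<open>Ranks with small binomial coefficients\<close>

lemma in_range_low:
  assumes n: "2 \<le> n" and r: "r \<le> n div 2" and big: "central_binom n / n\<^sup>2 < n choose r"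
  shows "\<bar>real r - n / 2\<bar> \<le> rank_window n"
proof -
  define k where "k = real (n div 2) - r"
  have k0: "0 \<le> k" unfolding k_def using r by simp
  have rn: "real r < n" using r n by linarith
  have "central_binom n * (1 / n\<^sup>2) < central_binom n * exp (- (k\<^sup>2 / (real n - r)))"
    using big binomial_decay[OF r] unfolding central_binom_def k_def by simp
  then have "1 / n\<^sup>2 < exp (- (k\<^sup>2 / (real n - r)))" using central_binom_pos[of n] by (rule mult_less_cancel_left_pos[THEN iffD1, rotated])
  then have "ln (1 / n\<^sup>2) < ln (exp (- (k\<^sup>2 / (real n - r))))" using n by (subst ln_less_cancel_iff) auto
  then have "ln (1 / n\<^sup>2) < - (k\<^sup>2 / (real n - r))" by simp
  moreover have "ln (1 / n\<^sup>2) = - (2 * ln n)" using n by (simp add: ln_div ln_realpow)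
  ultimately have "k\<^sup>2 / (real n - r) < 2 * ln n" by simp
  then have "k\<^sup>2 < 2 * ln n * (real n - r)" using rn by (simp add: pos_divide_less_eq)
  also have "\<dots> \<le> 2 * ln n * n" using n by (intro mult_left_mono) auto
  finally have "k\<^sup>2 \<le> 2 * real n * ln n" by (simp add: mult.commute mult.left_commute)
  then have "k \<le> sqrt (2 * real n * ln n)" by (rule real_le_rsqrt)
  moreover have "real (n div 2) \<le> n / 2" "n / 2 \<le> real (n div 2) + 1" by linarith+
  ultimately show ?thesis unfolding rank_window_def k_def using k0 k_def by linarith
qed

lemma in_range:
  assumes n: "2 \<le> n" and r: "r \<le> n" and big: "central_binom n / n\<^sup>2 < n choose r"
  shows "\<bar>real r - n / 2\<bar> \<le> rank_window n"
proof (cases "r \<le> n div 2")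
  case True then show ?thesis using in_range_low assms by auto
next
  case False
  have "central_binom n / n\<^sup>2 < n choose (n - r)" using big binomial_symmetric[OF r] by simp
  then have "\<bar>real (n - r) - n / 2\<bar> \<le> rank_window n" using False n by (intro in_range_low) auto
  moreover have "real (n - r) - n / 2 = - (real r - n / 2)" using r by (simp add: of_nat_diff)
  ultimately show ?thesis by simp
qed

text \<open>The distance to the middle is at least \<open>c sqrt n - 1/2\<close>, while the window
  bounds \<open>n - r\<close> by \<open>n / 2 + o(n)\<close>. So the exponent in
  \<open>binomial_decay\<close> is bounded below by a quantity tending to
  \<open>2 c^2\<close>.\<close>

lemma eventually_low_rank:
  fixes c \<eta> :: real
  assumes c: "0 < c" and \<eta>: "exp (- 2 * c\<^sup>2) < \<eta>"
  shows "\<forall>\<^sub>F n in sequentially. \<forall>r. real r < n / 2 - c * sqrt n \<longrightarrow> \<bar>real r - n / 2\<bar> \<le> rank_window n \<longrightarrow> n choose r \<le> \<eta> * central_binom n"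
proof -
  have \<eta>0: "0 < \<eta>" using \<eta> exp_gt_zero[of "- 2 * c\<^sup>2"] by linarith
  have "((\<lambda>n::nat. (c * sqrt n - 1 / 2)\<^sup>2 / (real n / 2 + sqrt (2 * real n * ln (real n)) + 1)) \<longlongrightarrow> 2 * c\<^sup>2) sequentially"
    using c by real_asymp
  moreover have "- ln \<eta> < 2 * c\<^sup>2" using \<eta> \<eta>0 by (metis exp_less_cancel_iff exp_ln minus_less_iff mult_minus_left)
  ultimately have 1: "\<forall>\<^sub>F n::nat in sequentially. - ln \<eta> < (c * sqrt n - 1 / 2)\<^sup>2 / (real n / 2 + sqrt (2 * real n * ln (real n)) + 1)"
    by (rule order_tendstoD)
  have 2: "\<forall>\<^sub>F n::nat in sequentially. 1 / 2 \<le> c * sqrt n" using c by real_asymp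
  show ?thesis using 1 2 eventually_ge_at_top[of 2]
  proof eventually_elim
    case (elim n)
    show ?case
    proof (intro allI impI)
      fix r assume r: "real r < n / 2 - c * sqrt n" and d: "\<bar>real r - n / 2\<bar> \<le> rank_window n"
      have cs: "0 \<le> c * sqrt n" using c by simp
      have rm: "r \<le> n div 2" using r cs by linarith
      define k where "k = real (n div 2) - r"
      have "c * sqrt n - 1 / 2 \<le> k" unfolding k_def using r by linarith
      then have k2: "(c * sqrt n - 1 / 2)\<^sup>2 \<le> k\<^sup>2" using elim(2) by (intro power_mono) auto
      have rn: "0 < real n - r" using rm elim(3) by linarith
      have nr: "real n - r \<le> real n / 2 + sqrt (2 * real n * ln (real n)) + 1" using d unfolding rank_window_def by linarith
      have "- ln \<eta> \<le> (c * sqrt n - 1 / 2)\<^sup>2 / (real n / 2 + sqrt (2 * real n * ln (real n)) + 1)" using elim(1) by simp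
      also have "\<dots> \<le> k\<^sup>2 / (real n - r)" using k2 rn nr by (intro frac_le) auto
      finally have "exp (- (k\<^sup>2 / (real n - r))) \<le> exp (ln \<eta>)" by simp
      then have e: "exp (- (k\<^sup>2 / (real n - r))) \<le> \<eta>" using \<eta>0 by simp
      have "real (n choose r) \<le> central_binom n * exp (- (k\<^sup>2 / (real n - r)))" using binomial_decay[OF rm] unfolding central_binom_def k_def .
      also have "\<dots> \<le> central_binom n * \<eta>" using e central_binom_pos[of n] by (intro mult_left_mono) auto
      finally show "n choose r \<le> \<eta> * central_binom n" by (simp add: mult.commute)
    qed
  qed
qed

text \<open>Transfers comparisons with the elementary lower bound \<open>2 ^ n / (n + 1)\<close> to
  the central coefficient. For nonnegative \<open>y\<close> the case of negative \<open>h\<close>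
  contradicts the first assumption.\<close>

lemma central_binom_absorb:
  assumes "y \<le> 2 ^ n / (real n + 1) * h" "0 \<le> y"
  shows "y \<le> central_binom n * h"
proof (cases "0 \<le> h")
  case True
  then have "2 ^ n / (real n + 1) * h \<le> central_binom n * h" using central_binom_ge[of n] by (intro mult_right_mono) auto
  then show ?thesis using assms by linarith
next
  case False
  then have "2 ^ n / (real n + 1) * h < 0" by (intro mult_pos_neg) auto
  then show ?thesis using assms by linarith
qed

section \<open>Almost all matroids\<close>

definition matroid_count :: "nat \<Rightarrow> real" where "matroid_count n = card {\<I>. matroid {1..n} \<I>}"

lemma stable_sets_le_matroid_count: "1 \<le> r \<Longrightarrow> card (stable_sets {1..n} r) \<le> matroid_count n"
  unfolding matroid_count_def using stable_sets_le_matroids[of "{1..n}" r] by simp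

lemma matroid_count_ge:
  assumes "2 \<le> n"
  shows "exp (ln 2 * central_binom n / n) \<le> matroid_count n"
proof -
  have "1 \<le> n div 2" using assms by linarith
  have "exp (ln 2 * central_binom n / n) = 2 powr ((n choose (n div 2)) / n)" unfolding central_binom_def by (simp add: powr_def mult.commute)
  also have "\<dots> \<le> card (stable_sets {1..n} (n div 2))" using assms by (intro many_stable_sets) auto
  also have "\<dots> \<le> matroid_count n" by (rule stable_sets_le_matroid_count) fact
  finally show ?thesis .
qed

definition bad_systems :: "real \<Rightarrow> nat \<Rightarrow> nat \<Rightarrow> nat set set set" where
  "bad_systems \<gamma> n r = {\<B> \<in> basis_systems {1..n} r. \<exists>e\<in>{1..n}. (2 + \<gamma> / sqrt n) * card {B \<in> \<B>. e \<in> B} < card \<B>}"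

lemma bad_systems_sub: "bad_systems \<gamma> n r \<subseteq> basis_systems {1..n} r" and finite_bad_systems: "finite (bad_systems \<gamma> n r)"
  using finite_basis_systems[of "{1..n}" r] unfolding bad_systems_def by auto

lemma card_bad_systems_le: "card (bad_systems \<gamma> n r) \<le> card (basis_systems {1..n} r)"
  by (intro card_mono finite_basis_systems bad_systems_sub) auto

lemma eventually_tiny:
  "\<forall>\<^sub>F n in sequentially. \<forall>r. n choose r \<le> central_binom n / n\<^sup>2 \<longrightarrow> card (basis_systems {1..n} r) \<le> exp (- real n) * matroid_count n"
proof -
  have 1: "\<forall>\<^sub>F n::nat in sequentially. real n \<le> 2 ^ n / (real n + 1) * (ln 2 / n - ln 2 / real n ^ 2)" by real_asymp
  show ?thesis using 1 eventually_ge_at_top[of 2]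
  proof eventually_elim
    case (elim n)
    show ?case
    proof (intro allI impI)
      fix r assume r: "n choose r \<le> central_binom n / n\<^sup>2"
      have "basis_systems {1..n} r \<subseteq> Pow (lvl {1..n} r)" unfolding basis_systems_def using basis_system.basis_lvl by auto
      then have "card (basis_systems {1..n} r) \<le> card (Pow (lvl {1..n} r))" by (intro card_mono) (auto simp: finite_lvl)
      also have "\<dots> = 2 ^ (n choose r)" using card_lvl[of "{1..n}" r] by (simp add: card_Pow finite_lvl)
      finally have "real (card (basis_systems {1..n} r)) \<le> real (2 ^ (n choose r))" by (simp only: of_nat_le_iff)
      also have "\<dots> = exp (ln 2 * (n choose r))" by (simp add: exp_of_nat2_mult exp_of_nat_mult mult.commute)
      also have "\<dots> \<le> exp (- real n + ln 2 * central_binom n / n)"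
      proof (subst exp_le_cancel_iff)
        have "real n \<le> central_binom n * (ln 2 / n - ln 2 / real n ^ 2)" by (rule central_binom_absorb[OF elim(1)]) simp
        moreover have "ln 2 * (n choose r) \<le> ln 2 * (central_binom n / n\<^sup>2)" using r by (intro mult_left_mono) auto
        ultimately show "ln 2 * real (n choose r) \<le> - real n + ln 2 * central_binom n / n" by (simp add: algebra_simps)
      qed
      also have "\<dots> = exp (- real n) * exp (ln 2 * central_binom n / n)" by (simp only: exp_add)
      also have "\<dots> \<le> exp (- real n) * matroid_count n" using matroid_count_ge[OF elim(2)] by (intro mult_left_mono) auto
      finally show "card (basis_systems {1..n} r) \<le> exp (- real n) * matroid_count n" .
    qed
  qed
qed

lemma eventually_rank_window_mid:
  "\<forall>\<^sub>F n in sequentially. \<forall>r. \<bar>real r - n / 2\<bar> \<le> rank_window n \<longrightarrow> n \<le> 3 * r \<and> 3 * r \<le> 2 * n"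
proof -
  have 1: "\<forall>\<^sub>F n::nat in sequentially. sqrt (2 * real n * ln (real n)) + 1 \<le> real n / 6" by real_asymp
  show ?thesis using 1
  proof eventually_elim
    case (elim n)
    show ?case
    proof (intro allI impI)
      fix r assume "\<bar>real r - n / 2\<bar> \<le> rank_window n"
      then have "\<bar>real r - n / 2\<bar> \<le> real n / 6" using elim unfolding rank_window_def by linarith
      then have "real n \<le> real (3 * r)" "real (3 * r) \<le> real (2 * n)" unfolding of_nat_mult by linarith+
      then show "n \<le> 3 * r \<and> 3 * r \<le> 2 * n" by (simp only: of_nat_le_iff)
    qed
  qed
qed

lemma eventually_small:
  fixes \<eta> :: real
  assumes \<eta>: "0 < \<eta>" "\<eta> < 1 / 2"
  shows "\<forall>\<^sub>F n in sequentially. \<forall>r. \<bar>real r - n / 2\<bar> \<le> rank_window n \<longrightarrow> n choose r \<le> \<eta> * central_binom n \<longrightarrow>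
    card (basis_systems {1..n} r) \<le> exp (- real n) * matroid_count n"
proof -
  \<comment> \<open>The choice makes \<open>(1 + \<epsilon>)^2 * 2 \<eta> < 1\<close>: by
    \<open>(1 + \<epsilon>)^2 \<le> 1 + 3 \<epsilon>\<close> the product is at most
    \<open>2 \<eta> + (1 - 2 \<eta>) \<eta>\<close>. The gap \<tau> then beats all lower-order
    terms.\<close>
  define \<epsilon> where "\<epsilon> = (1 - 2 * \<eta>) / 6"
  have \<epsilon>: "0 < \<epsilon>" "\<epsilon> \<le> 1" unfolding \<epsilon>_def using \<eta> by auto
  define \<theta> where "\<theta> = (1 + \<epsilon>)\<^sup>2 * 2 * \<eta>"
  define \<tau> where "\<tau> = 1 - \<theta>"
  have "(1 + \<epsilon>)\<^sup>2 \<le> 1 + 3 * \<epsilon>" using \<epsilon> by (simp add: power2_eq_square algebra_simps)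
  then have "\<theta> \<le> (1 + 3 * \<epsilon>) * (2 * \<eta>)" unfolding \<theta>_def using \<eta> by simp
  also have "\<dots> = 2 * \<eta> + (1 - 2 * \<eta>) * \<eta>" unfolding \<epsilon>_def by (simp add: field_simps)
  also have "\<dots> < 2 * \<eta> + (1 - 2 * \<eta>) * 1" using \<eta> by (intro add_strict_left_mono mult_strict_left_mono) auto
  finally have \<tau>: "0 < \<tau>" unfolding \<tau>_def by simp
  have 1: "\<forall>\<^sub>F n::nat in sequentially. real n \<le> 2 ^ n / (real n + 1) * (ln 2 * \<tau> / n - real n powr (-1.85) - 2 * real n powr (-1.4))"
    using \<tau> by real_asymp
  show ?thesis using 1 eventually_stable_sets[OF \<epsilon>(1)] eventually_codeN eventually_code_params eventually_rank_window_mid eventually_ge_at_top[of 2]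
  proof eventually_elim
    case (elim n)
    show ?case
    proof (intro allI impI)
      fix r assume d: "\<bar>real r - n / 2\<bar> \<le> rank_window n" and r: "n choose r \<le> \<eta> * central_binom n"
      have mid: "n \<le> 3 * r" "3 * r \<le> 2 * n" using elim(5) d by auto
      interpret code_params "{1..n}" r "rate_threshold n" "small_size n" "greedy_steps n" "cover_size n" using elim(4) mid by auto
      have "real (card (basis_systems {1..n} r)) \<le> real (codeN {1..n} (cover_size n) (small_size n) * card (stable_sets {1..n} r))"
        using count_all by (simp only: of_nat_le_iff)
      also have "\<dots> = real (codeN {1..n} (cover_size n) (small_size n)) * card (stable_sets {1..n} r)" by simp
      also have "\<dots> \<le> exp (central_binom n * real n powr (-1.85)) *
          exp (ln 2 * ((1 + \<epsilon>)\<^sup>2 * 2 * (n choose r) / n) + 2 * central_binom n * real n powr (-1.4))"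
        using elim(3) elim(2) d by (intro mult_mono) auto
      also have "\<dots> \<le> exp (- real n + ln 2 * central_binom n / n)"
        unfolding exp_add[symmetric]
      proof (subst exp_le_cancel_iff)
        have "real n \<le> central_binom n * (ln 2 * \<tau> / n - real n powr (-1.85) - 2 * real n powr (-1.4))" by (rule central_binom_absorb[OF elim(1)]) simp
        moreover have "(1 + \<epsilon>)\<^sup>2 * 2 * (n choose r) / n \<le> (1 + \<epsilon>)\<^sup>2 * 2 * (\<eta> * central_binom n) / n"
          using r by (intro divide_right_mono mult_left_mono) auto
        then have "ln 2 * ((1 + \<epsilon>)\<^sup>2 * 2 * (n choose r) / n) \<le> ln 2 * ((1 + \<epsilon>)\<^sup>2 * 2 * (\<eta> * central_binom n) / n)"
          by (intro mult_left_mono) auto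
        moreover have "ln 2 * ((1 + \<epsilon>)\<^sup>2 * 2 * (\<eta> * central_binom n) / n) = ln 2 * (1 - \<tau>) * central_binom n / n" unfolding \<tau>_def \<theta>_def by simp
        ultimately show "central_binom n * real n powr (-1.85) + (ln 2 * ((1 + \<epsilon>)\<^sup>2 * 2 * (n choose r) / n) + 2 * central_binom n * real n powr (-1.4))
            \<le> - real n + ln 2 * central_binom n / n" by (simp add: algebra_simps diff_divide_distrib)
      qed
      also have "\<dots> = exp (- real n) * exp (ln 2 * central_binom n / n)" by (simp only: exp_add)
      also have "\<dots> \<le> exp (- real n) * matroid_count n" using matroid_count_ge[OF elim(6)] by (intro mult_left_mono) auto
      finally show "card (basis_systems {1..n} r) \<le> exp (- real n) * matroid_count n" .
    qed
  qed
qed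

text \<open>The failing exchanges number at most \<open>5 n^2 g + 5 card \<B>\<close>, where 5 is 1
  for unblocked nonbases plus 2 each for small circuits and cocircuits. Relative to
  \<open>n * card \<B>\<close> this is of order \<open>n^(0.18 + 0.2 - 1) = n^-0.62\<close>, below
  the scale \<open>1 / sqrt n\<close> on which \<gamma> and \<open>c\<close> are compared.\<close>

lemma not_bad:
  fixes c \<gamma> :: real
  assumes B: "basis_system {1..n} r \<B>" and e: "e \<in> {1..n}"
    and few: "card (basis_system.K {1..n} r \<B> \<inter> unblocked {1..n} r (basis_system.smallC {1..n} \<B> \<delta>) (basis_system.smallD {1..n} \<B> \<delta>)) * n
        < g * n\<^sup>2 + 5 * card \<B>"
    and circ_covered: "card (basis_system.circ_covered {1..n} r \<B> \<delta> e) < 2 * n * g"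
    and coc_covered: "\<And>f. f \<in> {1..n} \<Longrightarrow> card (basis_system.coc_covered {1..n} r \<B> \<delta> f) < 2 * n * g"
    and b: "central_binom n < 10 * card \<B> * real n powr 0.2"
    and g: "5 * real n ^ 2 * g + 5 * central_binom n \<le> 7 * central_binom n * real n powr 0.18"
    and r: "n / 2 - c * sqrt n \<le> r"
    and \<gamma>: "0 \<le> \<gamma>" "1 \<le> (2 + \<gamma> / sqrt n) * (1 / 2 - c / sqrt n - 70 * real n powr (-0.62))"
  shows "card \<B> \<le> (2 + \<gamma> / sqrt n) * card {B \<in> \<B>. e \<in> B}"
proof -
  interpret basis_system "{1..n}" r \<B> by fact
  have n0: "0 < real n" using e by auto
  have rn: "r \<le> n"
  proof -
    obtain B where "B \<in> \<B>" using nonempty by auto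
    then show ?thesis using basis_sub[of B] basis_card[of B] card_mono[of "{1..n}" B] by auto
  qed
  define be bn where "be = card {B \<in> \<B>. e \<in> B}" and "bn = card {B \<in> \<B>. e \<notin> B}"
  have bb: "card \<B> = be + bn"
  proof -
    have "\<B> = {B \<in> \<B>. e \<in> B} \<union> {B \<in> \<B>. e \<notin> B}" by auto
    moreover have "card ({B \<in> \<B>. e \<in> B} \<union> {B \<in> \<B>. e \<notin> B}) = be + bn"
      unfolding be_def bn_def using finK by (intro card_Un_disjoint) auto
    ultimately show ?thesis by simp
  qed
  have "(\<Sum>f\<in>{1..n}. card (coc_covered \<delta> f)) \<le> (\<Sum>f\<in>{1..n}. 2 * n * g)" using coc_covered by (intro sum_mono less_imp_le) auto
  then have "(\<Sum>f\<in>{1..n}. card (coc_covered \<delta> f)) \<le> 2 * g * n\<^sup>2" by (simp add: power2_eq_square mult.commute mult.left_commute)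
  moreover have "n * card (circ_covered \<delta> e) \<le> n * (2 * n * g)" using circ_covered by (intro mult_le_mono2) simp
  then have "n * card (circ_covered \<delta> e) \<le> 2 * g * n\<^sup>2" by (simp add: power2_eq_square mult.commute mult.left_commute)
  moreover have "n * card (K \<inter> unblockedB \<delta>) \<le> g * n\<^sup>2 + 5 * card \<B>" using few by (simp add: mult.commute)
  moreover have "r * bn \<le> (n - r) * be + (n * card (K \<inter> unblockedB \<delta>) + n * card (circ_covered \<delta> e) + (\<Sum>f\<in>{1..n}. card (coc_covered \<delta> f)))"
    using basis_ratio[OF e, of \<delta>] unfolding be_def bn_def by simp
  ultimately have "r * bn \<le> (n - r) * be + (5 * g * n\<^sup>2 + 5 * card \<B>)" by linarith
  then have "real (r * bn) \<le> real ((n - r) * be + (5 * g * n\<^sup>2 + 5 * card \<B>))" by (simp only: of_nat_le_iff)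
  then have "real r * bn \<le> (real n - r) * be + (5 * real n ^ 2 * g + 5 * card \<B>)" using rn by (simp add: of_nat_diff mult.commute mult.left_commute)
  then have "real r * card \<B> \<le> n * be + (5 * real n ^ 2 * g + 5 * card \<B>)" unfolding bb by (simp add: algebra_simps)
  moreover have "card \<B> \<le> central_binom n"
  proof -
    have "\<B> \<subseteq> lvl {1..n} r" using basis_lvl by auto
    then have "card \<B> \<le> card (lvl {1..n} r)" by (rule card_mono[OF finite_lvl[OF finE]])
    then have "card \<B> \<le> n choose r" unfolding card_lvl[OF finE] by simp
    then have "real (card \<B>) \<le> real (n choose r)" by (simp only: of_nat_le_iff)
    then show ?thesis using central_binom_le[of n r] by (rule order_trans)
  qed
  ultimately have "real r * card \<B> \<le> n * be + 7 * central_binom n * real n powr 0.18" using g by linarith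
  also have "7 * central_binom n * real n powr 0.18 \<le> 7 * (10 * card \<B> * real n powr 0.2) * real n powr 0.18"
    using b by (intro mult_right_mono mult_left_mono) auto
  also have "\<dots> = 70 * card \<B> * (real n powr 0.2 * real n powr 0.18)" by simp
  also have "real n powr 0.2 * real n powr 0.18 = real n * real n powr (-0.62)"
  proof -
    have "real n powr 0.2 * real n powr 0.18 = real n powr 0.38" by (simp add: powr_add[symmetric])
    also have "\<dots> = real n powr (1 + (-0.62))" by simp
    also have "\<dots> = real n * real n powr (-0.62)" unfolding powr_add using n0 by simp
    finally show ?thesis .
  qed
  finally have u: "real r * card \<B> \<le> n * be + 70 * card \<B> * (real n * real n powr (-0.62))" by simp
  have "(n / 2 - c * sqrt n) * card \<B> \<le> real r * card \<B>" using r by (intro mult_right_mono) auto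
  moreover have "c * sqrt n = n * (c / sqrt n)" using n0 by (simp add: real_div_sqrt field_simps)
  ultimately have "n * ((1 / 2 - c / sqrt n - 70 * real n powr (-0.62)) * card \<B>) \<le> n * real be"
    using u by (simp add: algebra_simps)
  then have "(1 / 2 - c / sqrt n - 70 * real n powr (-0.62)) * card \<B> \<le> be" using n0 by simp
  then have "(2 + \<gamma> / sqrt n) * ((1 / 2 - c / sqrt n - 70 * real n powr (-0.62)) * card \<B>) \<le> (2 + \<gamma> / sqrt n) * be"
    using \<gamma>(1) by (intro mult_left_mono) auto
  moreover have "1 * real (card \<B>) \<le> (2 + \<gamma> / sqrt n) * (1 / 2 - c / sqrt n - 70 * real n powr (-0.62)) * card \<B>"
    using \<gamma>(2) by (intro mult_right_mono) auto
  ultimately show ?thesis unfolding be_def by (simp add: mult.assoc)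
qed

lemma gain_bound:
  fixes X S M :: nat
  assumes "X * 2 ^ g \<le> Cd * S * M" "real Cd \<le> exp u" "real S \<le> exp v" "z \<le> ln 2 * g - u - v"
  shows "real X \<le> exp (- z) * M"
proof -
  have "real (X * 2 ^ g) \<le> real (Cd * S * M)" using assms(1) by (simp only: of_nat_le_iff)
  then have "real X * 2 ^ g \<le> real Cd * real S * M" by simp
  also have "\<dots> \<le> exp u * exp v * M" using assms by (intro mult_right_mono mult_mono) auto
  finally have "real X \<le> exp u * exp v * M / 2 ^ g" by (simp add: pos_le_divide_eq)
  also have "(2::real) ^ g = exp (ln 2 * g)" by (metis exp_ln exp_of_nat2_mult zero_less_numeral)
  also have "exp u * exp v * M / exp (ln 2 * g) = exp (u + v - ln 2 * g) * M" by (simp add: exp_add exp_diff)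
  also have "\<dots> \<le> exp (- z) * M" using assms(4) by (intro mult_right_mono) auto
  finally show ?thesis .
qed

text \<open>A bad system has many unblocked nonbases (\<open>A1\<close>), few bases
  (\<open>A2\<close>), or many \<open>r\<close>-sets blocked by small circuits or cocircuits through
  one element (\<open>A3\<close>, \<open>A4\<close>). For \<open>A1\<close>, \<open>A3\<close> and
  \<open>A4\<close> the factor \<open>2 ^ g\<close> outweighs the side information;
  \<open>A2\<close> is measured directly against the lower bound for the number of matroids.\<close>

lemma eventually_good:
  fixes c \<gamma> :: real
  assumes c: "0 < c" "4 * c < \<gamma>"
  shows "\<forall>\<^sub>F n in sequentially. \<forall>r. \<bar>real r - n / 2\<bar> \<le> rank_window n \<longrightarrow> n / 2 - c * sqrt n \<le> r \<longrightarrow> central_binom n / 8 \<le> n choose r \<longrightarrow>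
    card (bad_systems \<gamma> n r) \<le> exp (- real n) * matroid_count n"
proof -
  have \<gamma>0: "0 < \<gamma>" using c by linarith
  have 1: "\<forall>\<^sub>F n::nat in sequentially. real n + ln 4 + ln (real n ^ 2 + 1) \<le> 2 ^ n / (real n + 1) * (ln 2 * real n powr (-1.82) - real n powr (-1.85))"
    by real_asymp
  have 2: "\<forall>\<^sub>F n::nat in sequentially. real n + ln 4 \<le> 2 ^ n / (real n + 1) *
      (ln 2 / n - real n powr (-1.85) - real n powr (-1.2) * (1 + ln (2 * real n powr 1.2)))" by real_asymp
  have 3: "\<forall>\<^sub>F n::nat in sequentially. 2 \<le> 2 ^ n / (real n + 1) * real n powr (-1.2)" by real_asymp
  have 4: "\<forall>\<^sub>F n::nat in sequentially. real n powr (-1.2) \<le> 1 / 8" by real_asymp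
  have 5: "\<forall>\<^sub>F n::nat in sequentially. 5 * real n ^ 2 \<le> 2 ^ n / (real n + 1) * (2 * real n powr 0.18 - 5)" by real_asymp
  have 6: "\<forall>\<^sub>F n::nat in sequentially. 1 \<le> (2 + \<gamma> / sqrt n) * (1 / 2 - c / sqrt n - 70 * real n powr (-0.62))"
  proof -
    define t where "t = \<gamma> - 4 * c"
    have t: "0 < t" and \<gamma>t: "\<gamma> = 4 * c + t" unfolding t_def using c by auto
    show ?thesis unfolding \<gamma>t using c(1) t by real_asymp
  qed
  show ?thesis
    using 1 2 3 4 5 6 eventually_codeN eventually_code_params eventually_rank_window_mid eventually_ge_at_top[of 2]
  proof eventually_elim
    case (elim n)
    show ?case
    proof (intro allI impI)
      fix r assume d: "\<bar>real r - n / 2\<bar> \<le> rank_window n" and r: "n / 2 - c * sqrt n \<le> r" and big: "central_binom n / 8 \<le> n choose r"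
      have mid: "n \<le> 3 * r" "3 * r \<le> 2 * n" using elim(9) d by auto
      have mid': "n \<le> 3 * (n - r)" "3 * (n - r) \<le> 2 * n" "1 \<le> r" "1 \<le> n - r" using mid elim(10) by linarith+
      have n0: "0 < real n" using elim(10) by simp
      have gs: "sum_color n X < card {1..n}" for X unfolding sum_color_def using elim(10) by simp
      interpret C: colored_params "{1..n}" r "rate_threshold n" "small_size n" "greedy_steps n" "cover_size n" "sum_color n"
      proof (rule colored_params.intro)
        show "code_params {1..n} r (rate_threshold n) (small_size n) (greedy_steps n) (cover_size n)" using elim(8) mid by auto
        show "colored_params_axioms {1..n} r (sum_color n)" by unfold_locales (use gs sum_color_adj in auto)
      qed
      have D: "colored_params {1..n} (card {1..n} - r) (rate_threshold n) (small_size n) (greedy_steps n) (cover_size n) (sum_color n)"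
      proof (rule colored_params.intro)
        show "code_params {1..n} (card {1..n} - r) (rate_threshold n) (small_size n) (greedy_steps n) (cover_size n)" using elim(8) mid' by auto
        show "colored_params_axioms {1..n} (card {1..n} - r) (sum_color n)" by unfold_locales (use gs sum_color_adj in auto)
      qed
      define x where "x = real n"
      have cb0: "0 < central_binom n" by (rule central_binom_pos)
      \<comment> \<open>The exponent 1.82 lies below 1.85, so that \<open>2 ^ g\<close> beats the
        side information, and above 1.7, so that \<open>n^2 g\<close> stays below
        \<open>sqrt n\<close> times the number of bases guaranteed outside
        \<open>A2\<close>.\<close>
      define g where "g = nat \<lceil>central_binom n * x powr (-1.82)\<rceil>"
      have g: "central_binom n * x powr (-1.82) \<le> g" "g \<le> central_binom n * x powr (-1.82) + 1"
        using nat_ceil_bounds[of "central_binom n * x powr (-1.82)"] cb0 unfolding g_def by auto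
      \<comment> \<open>Families of at most \<open>q\<close> sets number
        \<open>exp (O(q log n))\<close>, which is below \<open>2 ^ (N / n)\<close>, while a system
        outside \<open>A2\<close> has more than \<open>N n^-0.2 / 10\<close> bases.\<close>
      define q where "q = nat \<lfloor>central_binom n * x powr (-1.2)\<rfloor>"
      have q: "q \<le> central_binom n * x powr (-1.2)" "central_binom n * x powr (-1.2) - 1 \<le> q"
        using nat_floor_bounds[of "central_binom n * x powr (-1.2)"] cb0 unfolding q_def by auto
      have "2 \<le> central_binom n * x powr (-1.2)" unfolding x_def by (rule central_binom_absorb[OF elim(3)]) simp
      then have q2: "central_binom n * x powr (-1.2) / 2 \<le> q" "1 \<le> q" using q by linarith+
      let ?cN = "codeN {1..n} (cover_size n) (small_size n)"
      define A1 where "A1 = {\<B> \<in> basis_systems {1..n} r. g * card {1..n} ^ 2 + 5 * card \<B> \<le>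
        card (basis_system.K {1..n} r \<B> \<inter> unblocked {1..n} r (basis_system.smallC {1..n} \<B> (small_size n)) (basis_system.smallD {1..n} \<B> (small_size n))) * card {1..n}}"
      define A2 where "A2 = {\<B> \<in> basis_systems {1..n} r. 5 * card \<B> \<le> q * card {1..n}}"
      define A3 where "A3 = {\<B> \<in> basis_systems {1..n} r. \<exists>e\<in>{1..n}. 2 * card {1..n} * g \<le> card (basis_system.circ_covered {1..n} r \<B> (small_size n) e)}"
      define A4 where "A4 = {\<B> \<in> basis_systems {1..n} r. \<exists>f\<in>{1..n}. 2 * card {1..n} * g \<le> card (basis_system.coc_covered {1..n} r \<B> (small_size n) f)}"
      have cN: "real ?cN \<le> exp (central_binom n * x powr (-1.85))" using elim(7) unfolding x_def .
      have x2: "real (card {1..n} ^ 2 + 1) \<le> exp (ln (x ^ 2 + 1))" unfolding x_def by (subst exp_ln) (auto simp: add_nonneg_pos)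
      have "x + ln 4 + ln (x ^ 2 + 1) \<le> central_binom n * (ln 2 * x powr (-1.82) - x powr (-1.85))"
        unfolding x_def by (rule central_binom_absorb[OF elim(1)]) (simp add: add_nonneg_nonneg ln_ge_zero)
      also have "\<dots> \<le> ln 2 * g - central_binom n * x powr (-1.85)"
        using mult_left_mono[OF g(1), of "ln 2"] by (simp add: algebra_simps)
      finally have z: "x + ln 4 \<le> ln 2 * g - central_binom n * x powr (-1.85) - ln (x ^ 2 + 1)" by simp
      have l1: "0 \<le> ln (x ^ 2 + 1)" by (simp add: ln_ge_zero)
      have ex4: "exp (- (x + ln 4)) = exp (- x) / 4" by (simp add: exp_diff)
      have fin: "exp (- (x + ln 4)) * real (card (stable_sets {1..n} r')) \<le> exp (- x) / 4 * matroid_count n" if "1 \<le> r'" for r'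
        unfolding ex4 using stable_sets_le_matroid_count[OF that] by (intro mult_left_mono) auto
      have h1: "card A1 * 2 ^ g \<le> ?cN * 1 * card (stable_sets {1..n} r)" unfolding A1_def using C.count_many_free by simp
      have h2: "x + ln 4 \<le> ln 2 * g - central_binom n * x powr (-1.85) - 0" using z l1 by linarith
      have "real (card A1) \<le> exp (- (x + ln 4)) * card (stable_sets {1..n} r)"
        by (rule gain_bound[OF h1 cN _ h2]) simp
      then have a1: "real (card A1) \<le> exp (- x) / 4 * matroid_count n" using fin[OF mid'(3)] by linarith
      have "card A3 * 2 ^ g \<le> ?cN * (card {1..n} ^ 2 + 1) * card (stable_sets {1..n} r)" unfolding A3_def by (rule C.count_many_small_circ)
      from gain_bound[OF this cN x2 z] have a3: "real (card A3) \<le> exp (- x) / 4 * matroid_count n" using fin[OF mid'(3)] by linarith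
      have "card A4 * 2 ^ g \<le> ?cN * (card {1..n} ^ 2 + 1) * card (stable_sets {1..n} (card {1..n} - r))"
        unfolding A4_def by (rule count_many_small_coc[OF D])
      from gain_bound[OF this cN x2 z] have a4: "real (card A4) \<le> exp (- x) / 4 * matroid_count n" using fin[of "card {1..n} - r"] mid'(4) by simp
      have a2: "real (card A2) \<le> exp (- x) / 4 * matroid_count n"
      proof -
        have "real q \<le> central_binom n * (1 / 8)" using q(1) elim(4) cb0 unfolding x_def[symmetric] by (meson mult_left_mono less_imp_le order_trans)
        then have "real q \<le> real (n choose r)" using big by linarith
        then have qN: "q \<le> n choose r" by (simp only: of_nat_le_iff)
        have "real (card A2) \<le> real (?cN * card (smallfam (lvl {1..n} r) q))"
          unfolding A2_def using C.count_few_bases[of q] by (simp only: of_nat_le_iff)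
        also have "\<dots> = real ?cN * card (smallfam (lvl {1..n} r) q)" by simp
        also have "\<dots> \<le> exp (central_binom n * x powr (-1.85)) * exp (q * (1 + ln ((n choose r) / q)))"
          using cN card_smallfam[of "lvl {1..n} r" q] finite_lvl[of "{1..n}" r] card_lvl[of "{1..n}" r] q2 qN
          by (intro mult_mono) auto
        also have "\<dots> \<le> exp (- (x + ln 4) + ln 2 * central_binom n / n)"
          unfolding exp_add[symmetric]
        proof (subst exp_le_cancel_iff)
          have "(n choose r) / q \<le> central_binom n / (central_binom n * x powr (-1.2) / 2)"
            using central_binom_le[of n r] cb0 q2 n0 unfolding x_def by (intro frac_le) auto
          also have "\<dots> = 2 * x powr 1.2" using cb0 n0 unfolding x_def by (simp add: powr_minus field_simps)
          finally have le2: "(n choose r) / q \<le> 2 * x powr 1.2" .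
          have "real q \<le> real (n choose r)" "0 < real q" using qN q2(2) by simp_all
          then have ge1: "1 \<le> (n choose r) / q" by (simp only: pos_le_divide_eq mult_1)
          then have "ln ((n choose r) / q) \<le> ln (2 * x powr 1.2)"
            using le2 by (intro ln_mono) linarith+
          moreover have "0 \<le> ln ((n choose r) / q)" using ge1 by (rule ln_ge_zero)
          ultimately have "q * (1 + ln ((n choose r) / q)) \<le> (central_binom n * x powr (-1.2)) * (1 + ln (2 * x powr 1.2))"
            using q(1) by (intro mult_mono) auto
          moreover have "x + ln 4 \<le> central_binom n * (ln 2 / x - x powr (-1.85) - x powr (-1.2) * (1 + ln (2 * x powr 1.2)))"
            unfolding x_def by (rule central_binom_absorb[OF elim(2)]) simp
          ultimately show "central_binom n * x powr (-1.85) + q * (1 + ln ((n choose r) / q)) \<le> - (x + ln 4) + ln 2 * central_binom n / n"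
            unfolding x_def by (simp add: algebra_simps)
        qed
        also have "\<dots> = exp (- (x + ln 4)) * exp (ln 2 * central_binom n / n)" by (simp only: exp_add)
        also have "\<dots> \<le> exp (- x) / 4 * matroid_count n" unfolding ex4 using matroid_count_ge[OF elim(10)] by (intro mult_left_mono) auto
        finally show ?thesis .
      qed
      have "bad_systems \<gamma> n r \<subseteq> A1 \<union> A2 \<union> A3 \<union> A4"
      proof (rule subsetI, rule ccontr)
        fix \<B> assume Bd: "\<B> \<in> bad_systems \<gamma> n r" and no: "\<B> \<notin> A1 \<union> A2 \<union> A3 \<union> A4"
        from Bd have B: "\<B> \<in> basis_systems {1..n} r" unfolding bad_systems_def by blast
        from Bd obtain e where e: "e \<in> {1..n}" "(2 + \<gamma> / sqrt n) * card {B \<in> \<B>. e \<in> B} < card \<B>"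
          unfolding bad_systems_def by blast
        have no1: "\<B> \<notin> A1" and no2: "\<B> \<notin> A2" and no3: "\<B> \<notin> A3" and no4: "\<B> \<notin> A4" using no by blast+
        have "card \<B> \<le> (2 + \<gamma> / sqrt n) * card {B \<in> \<B>. e \<in> B}"
        proof (rule not_bad[where \<delta> = "small_size n" and g = g])
          show "basis_system {1..n} r \<B>" using B unfolding basis_systems_def by simp
          show "card (basis_system.K {1..n} r \<B> \<inter> unblocked {1..n} r (basis_system.smallC {1..n} \<B> (small_size n)) (basis_system.smallD {1..n} \<B> (small_size n))) * n
              < g * n\<^sup>2 + 5 * card \<B>" using no1 B unfolding A1_def by (simp add: not_le)
          show "card (basis_system.circ_covered {1..n} r \<B> (small_size n) e) < 2 * n * g" using no3 B e(1) unfolding A3_def by (simp add: not_le)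
          show "card (basis_system.coc_covered {1..n} r \<B> (small_size n) f) < 2 * n * g" if "f \<in> {1..n}" for f
            using no4 B that unfolding A4_def by (simp add: not_le)
          have "q * n < 5 * card \<B>" using no2 B unfolding A2_def by (simp add: not_le)
          then have "real (q * n) < real (5 * card \<B>)" by (simp only: of_nat_less_iff)
          then have "real q * x < 5 * card \<B>" unfolding x_def by simp
          moreover have "central_binom n * x powr (-1.2) / 2 * x \<le> real q * x" using q2(1) unfolding x_def by (intro mult_right_mono) auto
          ultimately have "central_binom n * (x powr (-1.2) * x) < 10 * card \<B>" by simp
          moreover have "x powr (-1.2) * x = x powr (-0.2)"
          proof -
            have "x powr (-1.2) * x = x powr (-1.2) * x powr 1" using n0 unfolding x_def by simp
            also have "\<dots> = x powr (-1.2 + 1)" by (rule powr_add[symmetric])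
            finally show ?thesis by simp
          qed
          ultimately have "central_binom n * x powr (-0.2) < 10 * card \<B>" by simp
          then have "central_binom n * x powr (-0.2) * x powr 0.2 < 10 * card \<B> * x powr 0.2"
            using n0 unfolding x_def by (intro mult_strict_right_mono) auto
          moreover have "central_binom n * x powr (-0.2) * x powr 0.2 = central_binom n"
            using n0 unfolding x_def by (simp add: mult.assoc powr_add[symmetric])
          ultimately show "central_binom n < 10 * card \<B> * real n powr 0.2" unfolding x_def by linarith
          have "5 * x ^ 2 * g \<le> 5 * x ^ 2 * (central_binom n * x powr (-1.82) + 1)" using g(2) by (intro mult_left_mono) auto
          also have "\<dots> = 5 * central_binom n * (x ^ 2 * x powr (-1.82)) + 5 * x ^ 2" by (simp add: algebra_simps)
          also have "x ^ 2 * x powr (-1.82) = x powr 0.18"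
          proof -
            have "x ^ 2 = x powr 2" using n0 unfolding x_def by (simp add: powr_numeral)
            then show ?thesis by (simp add: powr_add[symmetric])
          qed
          finally have "5 * x ^ 2 * g \<le> 5 * central_binom n * x powr 0.18 + 5 * x ^ 2" .
          moreover have "5 * x ^ 2 \<le> central_binom n * (2 * x powr 0.18 - 5)" unfolding x_def by (rule central_binom_absorb[OF elim(5)]) simp
          ultimately show "5 * real n ^ 2 * g + 5 * central_binom n \<le> 7 * central_binom n * real n powr 0.18"
            unfolding x_def by (simp add: algebra_simps)
        qed (use e r \<gamma>0 elim(6) in auto)
        then show False using e(2) by linarith
      qed
      then have "card (bad_systems \<gamma> n r) \<le> card (A1 \<union> A2 \<union> A3 \<union> A4)"
        using finite_basis_systems[of "{1..n}" r] unfolding A1_def A2_def A3_def A4_def by (intro card_mono) auto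
      also have "\<dots> \<le> card A1 + card A2 + card A3 + card A4"
        by (meson card_Un_le add_le_mono order_refl order_trans)
      finally have "real (card (bad_systems \<gamma> n r)) \<le> card A1 + card A2 + card A3 + card A4" by (simp flip: of_nat_add)
      then show "card (bad_systems \<gamma> n r) \<le> exp (- real n) * matroid_count n" using a1 a2 a3 a4 unfolding x_def by linarith
    qed
  qed
qed

lemma eventually_bad_systems:
  assumes \<gamma>: "\<gamma> > sqrt (8 * ln 2)"
  shows "\<forall>\<^sub>F n in sequentially. \<forall>r\<le>n. card (bad_systems \<gamma> n r) \<le> exp (- real n) * matroid_count n"
proof -
  define s where "s = sqrt (ln 2 / 2)"
  have s4: "sqrt (8 * ln 2) = 4 * s"
  proof -
    have "sqrt (8 * ln 2) = sqrt (4\<^sup>2 * (ln 2 / 2))" by (simp add: field_simps)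
    also have "\<dots> = 4 * s" unfolding s_def real_sqrt_mult by simp
    finally show ?thesis .
  qed
  have s0: "0 < s" unfolding s_def by simp
  \<comment> \<open>Strictly between \<open>s\<close> and \<open>\<gamma> / 4\<close>: the lower
    bound makes \<open>exp (- 2 c^2) < 1/2\<close>, so low ranks are negligible, and the upper bound
    leaves room in the competitive ratio.\<close>
  define c where "c = (s + \<gamma> / 4) / 2"
  have c: "s < c" "4 * c < \<gamma>" unfolding c_def using \<gamma> s4 by auto
  have c0: "0 < c" using c s0 by linarith
  have "s\<^sup>2 < c\<^sup>2" using c s0 by (intro power_strict_mono) auto
  then have "ln 2 < 2 * c\<^sup>2" unfolding s_def by simp
  then have "exp (- 2 * c\<^sup>2) < exp (- ln 2)" by simp
  then have e: "exp (- 2 * c\<^sup>2) < (1 / 2 :: real)" by (simp add: exp_minus)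
  define w where "w = exp (- 2 * c\<^sup>2)"
  have w: "0 < w" "w < 1 / 2" using e unfolding w_def by auto
  \<comment> \<open>The midpoint lies strictly between \<open>exp (- 2 c^2)\<close> and
    \<open>1/2\<close>. It is also at least \<open>1/8\<close>, which is what connects the remaining
    ranks to \<open>eventually_good\<close>.\<close>
  define \<eta> where "\<eta> = (w + 1 / 2) / 2"
  have "w < \<eta>" and \<eta>: "\<eta> < 1 / 2" "1 / 8 \<le> \<eta>" unfolding \<eta>_def using w by auto
  then have \<eta>w: "exp (- 2 * c\<^sup>2) < \<eta>" unfolding w_def by simp
  have \<eta>0: "0 < \<eta>" using \<eta> by linarith
  show ?thesis
    using eventually_tiny eventually_small[OF \<eta>0 \<eta>(1)] eventually_good[OF c0 c(2)] eventually_low_rank[OF c0 \<eta>w] eventually_ge_at_top[of 2]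
  proof eventually_elim
    case (elim n)
    show ?case
    proof (intro allI impI)
      fix r assume r: "r \<le> n"
      have le: "real (card (bad_systems \<gamma> n r)) \<le> card (basis_systems {1..n} r)" using card_bad_systems_le by simp
      show "card (bad_systems \<gamma> n r) \<le> exp (- real n) * matroid_count n"
      proof (cases "n choose r \<le> central_binom n / n\<^sup>2")
        case True
        then show ?thesis using elim(1) le by (meson order_trans)
      next
        case False
        then have d: "\<bar>real r - n / 2\<bar> \<le> rank_window n" using in_range[OF elim(5) r] by simp
        show ?thesis
        proof (cases "n choose r \<le> \<eta> * central_binom n")
          case True
          then show ?thesis using elim(2) d le by (meson order_trans)
        next
          case F: False
          have "n / 2 - c * sqrt n \<le> r"
          proof (rule ccontr)
            assume "\<not> ?thesis"
            then have "n choose r \<le> \<eta> * central_binom n" using elim(4) d by (meson not_le)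
            then show False using F by simp
          qed
          moreover have "1 / 8 * central_binom n \<le> \<eta> * central_binom n" using \<eta>(2) central_binom_pos[of n] by (intro mult_right_mono) auto
          then have "central_binom n / 8 \<le> n choose r" using F by linarith
          ultimately show ?thesis using elim(3) d by blast
        qed
      qed
    qed
  qed
qed

theorem theorem1p3:
  fixes \<gamma> :: real
  assumes "\<gamma> > sqrt (8 * ln 2)"
  shows "(\<lambda>n::nat.
            real (card {\<I>. matroid {1..n} \<I> \<and>
                            competitive (2 + \<gamma> / sqrt (real n)) {1..n} \<I> (RB \<I>)}) /
            real (card {\<I>. matroid {1..n} \<I>}))
         \<longlonglongrightarrow> 1"
proof -
  have "0 \<le> sqrt (8 * ln 2)" by simp
  then have \<gamma>0: "0 < \<gamma>" using assms by linarith
  let ?good = "\<lambda>n. {\<I>. matroid {1..n} \<I> \<and> competitive (2 + \<gamma> / sqrt (real n)) {1..n} \<I> (RB \<I>)}"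
  let ?bad = "\<lambda>n. {\<I>. matroid {1..n} \<I> \<and> \<not> competitive (2 + \<gamma> / sqrt (real n)) {1..n} \<I> (RB \<I>)}"
  let ?f = "\<lambda>n. real (card (?good n)) / real (card {\<I>. matroid {1..n} \<I>})"
  have lower: "\<forall>\<^sub>F n in sequentially. 1 - (real n + 1) * exp (- real n) \<le> ?f n"
    using eventually_bad_systems[OF assms] eventually_ge_at_top[of 2]
  proof eventually_elim
    case (elim n)
    \<comment> \<open>The rank of the matroid is arbitrary, so each of the \<open>n + 1\<close>
      ranks contributes a proportion of at most \<open>exp (- n)\<close>.\<close>
    have "card (?bad n) \<le> (\<Sum>r\<le>card {1..n}. card (bad_systems \<gamma> n r))"
    proof (rule card_matroids_le)
      fix \<I> assume "matroid {1..n} \<I>" and nc: "\<not> competitive (2 + \<gamma> / sqrt (real n)) {1..n} \<I> (RB \<I>)"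
      then interpret matroid "{1..n}" \<I> by simp
      obtain r where r: "r \<le> card {1..n}" "basis_system {1..n} r (bases \<I>)" using basis_system_bases by auto
      have "0 < 2 + \<gamma> / sqrt n" using \<gamma>0 by (simp add: add_pos_nonneg)
      then obtain e where "e \<in> {1..n}" "\<not> card (bases \<I>) \<le> (2 + \<gamma> / sqrt n) * card {B \<in> bases \<I>. e \<in> B}"
        using RB_competitive nc by blast
      then have "\<exists>e\<in>{1..n}. (2 + \<gamma> / sqrt n) * card {B \<in> bases \<I>. e \<in> B} < card (bases \<I>)"
        by (meson not_le)
      then have "bases \<I> \<in> bad_systems \<gamma> n r" using r(2) unfolding bad_systems_def basis_systems_def by blast
      then show "\<exists>r\<le>card {1..n}. bases \<I> \<in> bad_systems \<gamma> n r" using r(1) by auto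
    qed (auto simp: finite_bad_systems)
    then have "card (?bad n) \<le> (\<Sum>r\<le>n. card (bad_systems \<gamma> n r))" by simp
    then have "real (card (?bad n)) \<le> real (\<Sum>r\<le>n. card (bad_systems \<gamma> n r))" by (simp only: of_nat_le_iff)
    also have "\<dots> = (\<Sum>r\<le>n. real (card (bad_systems \<gamma> n r)))" by simp
    also have "\<dots> \<le> (\<Sum>r\<le>n. exp (- real n) * matroid_count n)" using elim(1) by (intro sum_mono) auto
    also have "\<dots> = (real n + 1) * exp (- real n) * matroid_count n" by simp
    finally have bad: "real (card (?bad n)) \<le> (real n + 1) * exp (- real n) * matroid_count n" .
    have M0: "0 < matroid_count n" using matroid_count_ge[OF elim(2)] exp_gt_zero by (rule less_le_trans[rotated])
    have gb: "{\<I>. matroid {1..n} \<I>} = ?good n \<union> ?bad n" by blast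
    have finM: "finite {\<I>. matroid {1..n} \<I>}" by (rule finite_matroids) simp
    have fgb: "finite (?good n)" "finite (?bad n)" by (rule finite_subset[OF _ finM], blast)+
    have "card {\<I>. matroid {1..n} \<I>} = card (?good n) + card (?bad n)"
      by (subst gb, rule card_Un_disjoint[OF fgb], blast)
    then have "matroid_count n = real (card (?good n)) + card (?bad n)" unfolding matroid_count_def by (simp only: of_nat_add)
    then have "(1 - (real n + 1) * exp (- real n)) * matroid_count n \<le> card (?good n)" using bad by (simp add: algebra_simps)
    then show ?case using M0 unfolding matroid_count_def by (simp add: pos_le_divide_eq)
  qed
  have upper: "?f n \<le> 1" for n
  proof -
    have "card (?good n) \<le> card {\<I>. matroid {1..n} \<I>}" by (rule card_mono[OF finite_matroids]) auto
    then show ?thesis by (intro divide_le_eq_1[THEN iffD2]) (simp, linarith)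
  qed
  show ?thesis
  proof (rule tendsto_sandwich[OF lower always_eventually[OF allI[OF upper]]])
    show "(\<lambda>n::nat. 1 - (real n + 1) * exp (- real n)) \<longlonglongrightarrow> 1" by real_asymp
  qed simp
qed

end
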